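(* Assume that there exist $\alpha > 0$ and a constant $C>0$ such that the angular power spectrum $(A_\ell)_{\ell \in \mathbb{N}_0}$ satisfies $A_\ell \le C\, \ell^{-\alpha}$ for all $\ell > 0$, and that $X_0 \in L^2(\Omega;H^{\eta}(\mathbb{S}^2))$ for some $\eta > 0$. Let $C_c>0$ be a fixed constant (with $C_c \le 1$ in the case of the forward scheme). Then, both for the forward and for the backward Euler--Maruyama scheme, there exists a constant $\hat{C}$, independent of $\kappa$, $h$ and $k$, such that for all $\kappa \in \mathbb{N}$ and all step sizes $h > 0$ with $\kappa(\kappa+1)h \le C_c$, the strong error between $X^{(\kappa)}$ and $X^{(\kappa,h)}$ is bounded on all time grid points $t_k$ by $$\| X^{(\kappa)}(t_k) - X^{(\kappa,h)}(t_k) \|_{L^2(\Omega;L^2(\mathbb{S}^2))} \le \hat{C} \Bigl( h^{\min\{1,\eta/2\}} \|X_0\|_{L^2(\Omega;H^{\eta}(\mathbb{S}^2))} + h^{\min\{1,\alpha/4\}} \Bigr).$$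
   Context: $\mathbb{S}^2$ is the unit sphere in $\mathbb{R}^3$ with its surface measure. $(Y_{\ell,m},\ \ell\in\mathbb{N}_0,\ m=-\ell,\ldots,\ell)$ denotes the standard complex spherical harmonics, an orthonormal basis of $L^2(\mathbb{S}^2;\mathbb{C})$ with $Y_{\ell,m} = (-1)^m\overline{Y_{\ell,-m}}$ and $\Delta_{\mathbb{S}^2}Y_{\ell,m} = -\ell(\ell+1)Y_{\ell,m}$, where $\Delta_{\mathbb{S}^2}$ is the Laplace--Beltrami operator. $L^2(\mathbb{S}^2)$ is the space of real-valued square-integrable functions. For $s\in\mathbb{R}$, $H^s(\mathbb{S}^2) = (\mathrm{Id}-\Delta_{\mathbb{S}^2})^{-s/2}L^2(\mathbb{S}^2)$ with norm $\|f\|_{H^s(\mathbb{S}^2)} = \|(\mathrm{Id}-\Delta_{\mathbb{S}^2})^{s/2}f\|_{L^2(\mathbb{S}^2)}$, and $\|Z\|_{L^2(\Omega;H^s(\mathbb{S}^2))} = \mathbb{E}[\|Z\|_{H^s(\mathbb{S}^2)}^2]^{1/2}$. Let $(\Omega,\mathcal{A},(\mathcal{F}_t)_t,\mathbb{P})$ be a complete filtered probability space and $T<\infty$. Let $(A_\ell)_{\ell\in\mathbb{N}_0}$ be a sequence of nonnegative real numbers (the angular power spectrum), and let $\beta^1_{\ell,m}$ ($\ell\in\mathbb{N}_0$, $0\le m\le \ell$) and $\beta^2_{\ell,m}$ ($\ell\in\mathbb{N}$, $1\le m\le\ell$) be independent real-valued $(\mathcal{F}_t)$-Brownian motions. Set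 $a_{\ell,0}=\sqrt{A_\ell}\,\beta^1_{\ell,0}$, $a_{\ell,m}=\sqrt{A_\ell/2}\,(\beta^1_{\ell,m}+i\beta^2_{\ell,m})$ for $m=1,\ldots,\ell$, and $a_{\ell,-m}=(-1)^m\overline{a_{\ell,m}}$. The isotropic $Q$-Wiener process is $W(t)=\sum_{\ell=0}^\infty\sum_{m=-\ell}^\ell a_{\ell,m}(t)Y_{\ell,m}$. Consider the stochastic heat equation $\mathrm{d}X(t)=\Delta_{\mathbb{S}^2}X(t)\,\mathrm{d}t+\mathrm{d}W(t)$ on $[0,T]$ with $\mathcal{F}_0$-measurable initial condition $X(0)=X_0\in L^2(\Omega;L^2(\mathbb{S}^2))$, and set $X^0_{\ell,m}=\langle X_0,Y_{\ell,m}\rangle_{L^2(\mathbb{S}^2;\mathbb{C})}$. The spectral approximation is $$X^{(\kappa)}(t)=\sum_{\ell=0}^{\kappa}\sum_{m=-\ell}^{\ell}\Bigl(e^{-\ell(\ell+1)t}X^0_{\ell,m}+\int_0^t e^{-\ell(\ell+1)(t-s)}\,\mathrm{d}a_{\ell,m}(s)\Bigr)Y_{\ell,m}.$$ Euler--Maruyama schemes: let $0=t_0<t_1<\cdots<t_n=T$ be an equidistant grid with step size $h=T/n$, $n\in\mathbb{N}$. For each $\ell$ set $\xi=1-\ell(\ell+1)h$ and $\delta=0$ (forward scheme), or $\xi=(1+\ell(\ell+1)h)^{-1}$ and $\delta=1$ (backward scheme). For $m=0,\ldots,\ell$ let $X^{(h)}_{\ell,m}(t_0)=X^0_{\ell,m}$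 and $$X^{(h)}_{\ell,m}(t_k)=\xi X^{(h)}_{\ell,m}(t_{k-1})+\xi^{\delta}\bigl(a_{\ell,m}(t_k)-a_{\ell,m}(t_{k-1})\bigr),\quad k=1,\ldots,n,$$ and $$X^{(\kappa,h)}(t_k)=\sum_{\ell=0}^{\kappa}\Bigl(X^{(h)}_{\ell,0}(t_k)Y_{\ell,0}+2\sum_{m=1}^{\ell}\bigl(\mathrm{Re}(X^{(h)}_{\ell,m}(t_k))\,\mathrm{Re}(Y_{\ell,m})-\mathrm{Im}(X^{(h)}_{\ell,m}(t_k))\,\mathrm{Im}(Y_{\ell,m})\bigr)\Bigr).$$
   Formalization: The case α = 4 is excluded: there the claim fails, since for X_0 = 0 and A_ℓ = Cℓ^{-4} with κ of order h^{-1/2} the squared error is at least of order h² log(1/h), so the rate h does not hold. *)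

theory Defs
  imports
    "HOL-Probability.Probability"
    "HOL-Computational_Algebra.Polynomial"
begin

section \<open>The unit sphere and the spherical harmonics\<close>

(* Surface measure in spherical coordinates, d sigma = sin theta d theta d phi,
   theta being the angle to the third axis. *)
definition S2 :: "(real^3) measure" where
  "S2 = distr
     (density (restrict_space lborel ({0..pi} \<times> {0..2*pi})) (\<lambda>(\<theta>, \<phi>). ennreal (sin \<theta>)))
     (restrict_space borel (sphere 0 1))
     (\<lambda>(\<theta>, \<phi>). vector [sin \<theta> * cos \<phi>, sin \<theta> * sin \<phi>, cos \<theta>])"

(* Rodrigues' formula. *)
definition legendre :: "nat \<Rightarrow> real poly" where
  "legendre l = smult (1 / (2^l * fact l)) ((pderiv ^^ l) ([:-1, 0, 1:] ^ l))"

(* With the Condon-Shortley phase. *)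
definition assoc_legendre :: "nat \<Rightarrow> nat \<Rightarrow> real \<Rightarrow> real" where
  "assoc_legendre l m \<mu> = (-1)^m * sqrt (1 - \<mu>\<^sup>2) ^ m * poly ((pderiv ^^ m) (legendre l)) \<mu>"

definition sph_harm_nonneg :: "nat \<Rightarrow> nat \<Rightarrow> real^3 \<Rightarrow> complex" where
  "sph_harm_nonneg l m x =
     of_real (sqrt ((2 * real l + 1) / (4 * pi) * fact (l - m) / fact (l + m))
              * assoc_legendre l m (x $ 3))
     * cis (real m * Arg (Complex (x $ 1) (x $ 2)))"

(* Meaningful for \<bar>m\<bar> \<le> l only. *)
definition sph_harm :: "nat \<Rightarrow> int \<Rightarrow> real^3 \<Rightarrow> complex" where
  "sph_harm l m x =
     (if 0 \<le> m then sph_harm_nonneg l (nat m) x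
      else (-1) ^ nat (-m) * cnj (sph_harm_nonneg l (nat (-m)) x))"

(* The eigenvalue of the negative Laplace-Beltrami operator on the span of the sph_harm l m. *)
definition lb_eigenvalue :: "nat \<Rightarrow> real" where
  "lb_eigenvalue l = real l * (real l + 1)"


section \<open>Function spaces on the sphere\<close>

(* Elements are functions, not classes modulo null sets; L2_norm and Hs_norm are
   accordingly seminorms. Values off the unit sphere are irrelevant. *)

definition L2_sphere :: "(real^3 \<Rightarrow> real) set" where
  "L2_sphere = {f. f \<in> borel_measurable S2 \<and> integrable S2 (\<lambda>x. (f x)\<^sup>2)}"

definition L2_norm :: "(real^3 \<Rightarrow> 'b::real_normed_vector) \<Rightarrow> real" where
  "L2_norm f = sqrt (\<integral>x. (norm (f x))\<^sup>2 \<partial>S2)"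

definition sph_coeff :: "(real^3 \<Rightarrow> real) \<Rightarrow> nat \<Rightarrow> int \<Rightarrow> complex" where
  "sph_coeff f l m = (\<integral>x. complex_of_real (f x) * cnj (sph_harm l m x) \<partial>S2)"

(* g = (Id - Delta)^(s/2) f as square-integrable functions, by the spectral calculus of Delta. *)
definition bessel_op_graph :: "real \<Rightarrow> (real^3 \<Rightarrow> real) \<Rightarrow> (real^3 \<Rightarrow> real) \<Rightarrow> bool" where
  "bessel_op_graph s f g \<longleftrightarrow>
     f \<in> L2_sphere \<and> g \<in> L2_sphere \<and>
     (\<forall>l m. \<bar>m\<bar> \<le> int l \<longrightarrow>
        sph_coeff g l m = of_real ((1 + lb_eigenvalue l) powr (s/2)) * sph_coeff f l m)"

(* The image of L2_sphere under (Id - Delta)^(-s/2), for s \<ge> 0 (for negative s,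
   elements of the Sobolev space need not be functions). *)
definition Hs_sphere :: "real \<Rightarrow> (real^3 \<Rightarrow> real) set" where
  "Hs_sphere s = {f. \<exists>g. bessel_op_graph s f g}"

(* The choice is unique up to a null set, since the spherical harmonics are complete. *)
definition Hs_norm :: "real \<Rightarrow> (real^3 \<Rightarrow> real) \<Rightarrow> real" where
  "Hs_norm s f = L2_norm (SOME g. bessel_op_graph s f g)"


section \<open>Random functions\<close>

definition seminorm_open ::
  "('x \<Rightarrow> real) set \<Rightarrow> (('x \<Rightarrow> real) \<Rightarrow> real) \<Rightarrow> ('x \<Rightarrow> real) set \<Rightarrow> bool" where
  "seminorm_open B N U \<longleftrightarrow>
     U \<subseteq> B \<and> (\<forall>f\<in>U. \<exists>e>0. \<forall>g\<in>B. N (\<lambda>x. g x - f x) < e \<longrightarrow> g \<in> U)"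

(* Borel measurability of a random element of the seminormed space (B, N). The random
   element may take values outside B on a null set; membership of its values is not part
   of this definition. *)
definition borel_rv ::
  "'w measure \<Rightarrow> ('x \<Rightarrow> real) set \<Rightarrow> (('x \<Rightarrow> real) \<Rightarrow> real) \<Rightarrow> ('w \<Rightarrow> 'x \<Rightarrow> real) \<Rightarrow> bool" where
  "borel_rv M B N Z \<longleftrightarrow> (\<forall>U. seminorm_open B N U \<longrightarrow> {\<omega> \<in> space M. Z \<omega> \<in> U} \<in> sets M)"

(* L^2(Omega; B). *)
definition L2_Omega ::
  "'w measure \<Rightarrow> ('x \<Rightarrow> real) set \<Rightarrow> (('x \<Rightarrow> real) \<Rightarrow> real) \<Rightarrow> ('w \<Rightarrow> 'x \<Rightarrow> real) set" where
  "L2_Omega M B N =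
     {Z. (AE \<omega> in M. Z \<omega> \<in> B) \<and> borel_rv M B N Z \<and> integrable M (\<lambda>\<omega>. (N (Z \<omega>))\<^sup>2)}"

definition L2_Omega_norm :: "'w measure \<Rightarrow> ('f \<Rightarrow> real) \<Rightarrow> ('w \<Rightarrow> 'f) \<Rightarrow> real" where
  "L2_Omega_norm M N Z = sqrt (\<integral>\<omega>. (N (Z \<omega>))\<^sup>2 \<partial>M)"


section \<open>Filtrations, Brownian motion and the stochastic integral\<close>

definition complete_filtered_prob_space :: "'w measure \<Rightarrow> (real \<Rightarrow> 'w measure) \<Rightarrow> real \<Rightarrow> bool" where
  "complete_filtered_prob_space M F T \<longleftrightarrow>
     prob_space M \<and> complete_measure M \<and>
     (\<forall>t\<in>{0..T}. subalgebra M (F t)) \<and>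
     (\<forall>s\<in>{0..T}. \<forall>t\<in>{0..T}. s \<le> t \<longrightarrow> sets (F s) \<subseteq> sets (F t)) \<and>
     null_sets M \<subseteq> sets (F 0)"

definition brownian_motion ::
  "'w measure \<Rightarrow> (real \<Rightarrow> 'w measure) \<Rightarrow> real \<Rightarrow> (real \<Rightarrow> 'w \<Rightarrow> real) \<Rightarrow> bool" where
  "brownian_motion M F T \<beta> \<longleftrightarrow>
     (AE \<omega> in M. \<beta> 0 \<omega> = 0) \<and>
     (\<forall>t\<in>{0..T}. \<beta> t \<in> borel_measurable (F t)) \<and>
     (\<forall>s t. 0 \<le> s \<and> s < t \<and> t \<le> T \<longrightarrow>
        distributed M lborel (\<lambda>\<omega>. \<beta> t \<omega> - \<beta> s \<omega>) (\<lambda>x. ennreal (normal_density 0 (sqrt (t - s)) x)) \<and>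
        prob_space.indep_set M (sets (F s))
          (sets (vimage_algebra (space M) (\<lambda>\<omega>. \<beta> t \<omega> - \<beta> s \<omega>) borel))) \<and>
     (AE \<omega> in M. continuous_on {0..T} (\<lambda>t. \<beta> t \<omega>))"

(* Mutual independence, as path-valued random variables, of the processes beta^1_{l,m}
   (0 \<le> m \<le> l; index Inl) and beta^2_{l,m} (1 \<le> m \<le> l; index Inr). *)
definition independent_family ::
  "'w measure \<Rightarrow> real \<Rightarrow> (nat \<Rightarrow> nat \<Rightarrow> real \<Rightarrow> 'w \<Rightarrow> real) \<Rightarrow> (nat \<Rightarrow> nat \<Rightarrow> real \<Rightarrow> 'w \<Rightarrow> real) \<Rightarrow> bool" where
  "independent_family M T \<beta>1 \<beta>2 \<longleftrightarrow>
     prob_space.indep_vars M (\<lambda>_. \<Pi>\<^sub>M t\<in>{0..T}. (borel :: real measure))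
       (\<lambda>i \<omega>. \<lambda>t\<in>{0..T}.
          (case i of Inl (l, m) \<Rightarrow> \<beta>1 l m t \<omega> | Inr (l, m) \<Rightarrow> \<beta>2 l m t \<omega>))
       (Inl ` {(l, m). m \<le> l} \<union> Inr ` {(l, m). 1 \<le> m \<and> m \<le> l})"

definition step_fun :: "nat \<Rightarrow> (nat \<Rightarrow> real) \<Rightarrow> (nat \<Rightarrow> real) \<Rightarrow> real \<Rightarrow> real" where
  "step_fun N s c u = (\<Sum>i<N. c i * indicator {s i<..s (Suc i)} u)"

definition step_integral ::
  "nat \<Rightarrow> (nat \<Rightarrow> real) \<Rightarrow> (nat \<Rightarrow> real) \<Rightarrow> (real \<Rightarrow> 'w \<Rightarrow> complex) \<Rightarrow> 'w \<Rightarrow> complex" where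
  "step_integral N s c a \<omega> = (\<Sum>i<N. of_real (c i) * (a (s (Suc i)) \<omega> - a (s i) \<omega>))"

(* The Ito integral over [0,t] of the deterministic integrand f (Wiener integral): the
   extension of the elementary integral by L^2-approximation with step functions. *)
definition has_stoch_integral ::
  "'w measure \<Rightarrow> real \<Rightarrow> (real \<Rightarrow> real) \<Rightarrow> (real \<Rightarrow> 'w \<Rightarrow> complex) \<Rightarrow> ('w \<Rightarrow> complex) \<Rightarrow> bool" where
  "has_stoch_integral M t f a I \<longleftrightarrow>
     I \<in> borel_measurable M \<and>
     (\<exists>N s c.
        (\<forall>n. mono_on {..N n} (s n) \<and> s n 0 = 0 \<and> s n (N n) = t) \<and>
        (\<lambda>n. \<integral>\<^sup>+u\<in>{0..t}. ennreal ((step_fun (N n) (s n) (c n) u - f u)\<^sup>2) \<partial>lborel)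
          \<longlonglongrightarrow> 0 \<and>
        (\<lambda>n. \<integral>\<^sup>+\<omega>. ennreal ((norm (step_integral (N n) (s n) (c n) a \<omega> - I \<omega>))\<^sup>2) \<partial>M)
          \<longlonglongrightarrow> 0)"

(* A version; determined almost surely when a is (a complex combination of) Brownian motion. *)
definition stoch_integral ::
  "'w measure \<Rightarrow> real \<Rightarrow> (real \<Rightarrow> real) \<Rightarrow> (real \<Rightarrow> 'w \<Rightarrow> complex) \<Rightarrow> 'w \<Rightarrow> complex" where
  "stoch_integral M t f a = (SOME I. has_stoch_integral M t f a I)"


section \<open>The stochastic heat equation and its approximations\<close>

definition noise_coeff_nonneg ::
  "(nat \<Rightarrow> real) \<Rightarrow> (nat \<Rightarrow> nat \<Rightarrow> real \<Rightarrow> 'w \<Rightarrow> real) \<Rightarrow> (nat \<Rightarrow> nat \<Rightarrow> real \<Rightarrow> 'w \<Rightarrow> real)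
     \<Rightarrow> nat \<Rightarrow> nat \<Rightarrow> real \<Rightarrow> 'w \<Rightarrow> complex" where
  "noise_coeff_nonneg A \<beta>1 \<beta>2 l m t \<omega> =
     (if m = 0 then of_real (sqrt (A l) * \<beta>1 l 0 t \<omega>)
      else of_real (sqrt (A l / 2)) * Complex (\<beta>1 l m t \<omega>) (\<beta>2 l m t \<omega>))"

(* The a_{l,m} of the Q-Wiener process. *)
definition noise_coeff ::
  "(nat \<Rightarrow> real) \<Rightarrow> (nat \<Rightarrow> nat \<Rightarrow> real \<Rightarrow> 'w \<Rightarrow> real) \<Rightarrow> (nat \<Rightarrow> nat \<Rightarrow> real \<Rightarrow> 'w \<Rightarrow> real)
     \<Rightarrow> nat \<Rightarrow> int \<Rightarrow> real \<Rightarrow> 'w \<Rightarrow> complex" where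
  "noise_coeff A \<beta>1 \<beta>2 l m t \<omega> =
     (if 0 \<le> m then noise_coeff_nonneg A \<beta>1 \<beta>2 l (nat m) t \<omega>
      else (-1) ^ nat (-m) * cnj (noise_coeff_nonneg A \<beta>1 \<beta>2 l (nat (-m)) t \<omega>))"

definition spectral_approx ::
  "'w measure \<Rightarrow> (nat \<Rightarrow> int \<Rightarrow> real \<Rightarrow> 'w \<Rightarrow> complex) \<Rightarrow> ('w \<Rightarrow> real^3 \<Rightarrow> real)
     \<Rightarrow> nat \<Rightarrow> real \<Rightarrow> 'w \<Rightarrow> real^3 \<Rightarrow> complex" where
  "spectral_approx M a X0 \<kappa> t \<omega> x =
     (\<Sum>l\<le>\<kappa>. \<Sum>m\<in>{- int l..int l}.
        (of_real (exp (- lb_eigenvalue l * t)) * sph_coeff (X0 \<omega>) l m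
         + stoch_integral M t (\<lambda>s. exp (- lb_eigenvalue l * (t - s))) (a l m) \<omega>)
        * sph_harm l m x)"

datatype scheme = Forward | Backward

fun scheme_xi :: "scheme \<Rightarrow> real \<Rightarrow> nat \<Rightarrow> real" where
  "scheme_xi Forward h l = 1 - lb_eigenvalue l * h"
| "scheme_xi Backward h l = inverse (1 + lb_eigenvalue l * h)"

fun scheme_delta :: "scheme \<Rightarrow> nat" where
  "scheme_delta Forward = 0"
| "scheme_delta Backward = 1"

primrec euler_coeff ::
  "scheme \<Rightarrow> (nat \<Rightarrow> int \<Rightarrow> real \<Rightarrow> 'w \<Rightarrow> complex) \<Rightarrow> ('w \<Rightarrow> real^3 \<Rightarrow> real)
     \<Rightarrow> real \<Rightarrow> nat \<Rightarrow> nat \<Rightarrow> nat \<Rightarrow> 'w \<Rightarrow> complex" where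
  "euler_coeff sch a X0 h l m 0 \<omega> = sph_coeff (X0 \<omega>) l (int m)"
| "euler_coeff sch a X0 h l m (Suc k) \<omega> =
     of_real (scheme_xi sch h l) * euler_coeff sch a X0 h l m k \<omega>
     + of_real (scheme_xi sch h l ^ scheme_delta sch)
       * (a l (int m) (real (Suc k) * h) \<omega> - a l (int m) (real k * h) \<omega>)"

(* The approximation at the grid point t_k = k h. *)
definition euler_approx ::
  "scheme \<Rightarrow> (nat \<Rightarrow> int \<Rightarrow> real \<Rightarrow> 'w \<Rightarrow> complex) \<Rightarrow> ('w \<Rightarrow> real^3 \<Rightarrow> real)
     \<Rightarrow> nat \<Rightarrow> real \<Rightarrow> nat \<Rightarrow> 'w \<Rightarrow> real^3 \<Rightarrow> complex" where
  "euler_approx sch a X0 \<kappa> h k \<omega> x =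
     (\<Sum>l\<le>\<kappa>.
        euler_coeff sch a X0 h l 0 k \<omega> * sph_harm l 0 x
        + 2 * (\<Sum>m=1..l. of_real
            (Re (euler_coeff sch a X0 h l m k \<omega>) * Re (sph_harm l (int m) x)
             - Im (euler_coeff sch a X0 h l m k \<omega>) * Im (sph_harm l (int m) x))))"

end

theory Submission
  imports Defs
begin

text \<open>
Both approximations are finite expansions in the spherical harmonics of degree at most \<open>\<kappa>\<close>, and the
coefficients are decoupled: each one solves a scalar linear equation with decay rate
\<open>\<lambda> = l (l + 1)\<close> and additive noise of intensity \<open>A l\<close>, exactly in one case and by an Euler scheme in the
other (\<open>euler_approx_eq_sum\<close>). The harmonics are orthonormal (\<open>sph_harm_orthonormal\<close>), so the squared
error is the sum over all modes of the squared coefficient errors.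

The error of one mode consists of \<open>(exp (- \<lambda> t) - \<xi> ^ k) X0_lm\<close> with \<open>t = k h\<close>, and of the Wiener
integral of the difference between the kernel \<open>exp (- \<lambda> (t - s))\<close> and a step function built from powers
of \<open>\<xi>\<close>. The inequality \<open>(a + b)\<^sup>2 \<le> 2 a\<^sup>2 + 2 b\<^sup>2\<close> separates these parts. Put \<open>x = \<lambda> h\<close>, which is at most
\<open>C\<^sub>c\<close>. For both schemes \<open>\<xi>\<close> and \<open>exp (- x)\<close> lie in \<open>[1 - x, 1 / (1 + x)]\<close>, so they differ by
at most \<open>x\<^sup>2\<close> and their powers decay geometrically (\<open>euler_factor_power_error\<close>). It follows that the
factor of \<open>X0_lm\<close> is bounded by a constant times \<open>min 1 x\<close>, and, by the Ito isometry, the second moment of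
the stochastic part by a constant times \<open>A l \<lambda> h\<^sup>2\<close> (\<open>mode_noise_error_second_moment\<close>).

It remains to sum. For the initial condition,
\<open>min 1 x \<le> h powr p * (1 + \<lambda>) powr (\<eta> / 2)\<close> with \<open>p = min 1 (\<eta> / 2)\<close>
(\<open>mode_initial_error_bound\<close>), and Bessel's inequality recovers the Sobolev norm (\<open>Hs_norm_bound\<close>). For
the noise, the \<open>2 l + 1\<close> modes of each degree give \<open>h\<^sup>2 \<Sum> l powr (3 - \<alpha>)\<close> up to a constant, which is of order
\<open>h powr (2 min 1 (\<alpha> / 4))\<close> because \<open>\<kappa>\<^sup>2 h\<close> is bounded (\<open>spectrum_sum_bound\<close>). At \<open>\<alpha> = 4\<close> this sum is
logarithmic, which is why that exponent is excluded.

Two foundations are laid along the way. Orthonormality is derived from Rodrigues' formula by repeated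
integration by parts (\<open>cos_integral_by_parts_iterated\<close>). The Wiener integral, defined through
\<open>L\<^sup>2\<close>-limits of elementary integrals, is shown to exist for Lipschitz integrands
(\<open>has_stoch_integral_exists\<close>) and to satisfy an isometry estimate (\<open>stoch_integral_error\<close>).
\<close>

section \<open>Orthogonality of the associated Legendre functions\<close>

text \<open>The substitution \<open>\<mu> = cos \<theta>\<close> turns this into the integral of \<open>p\<close> over \<open>[-1, 1]\<close>, the scalar product of
the Legendre polynomials. The form in \<open>\<theta>\<close> is the one that integration over the sphere produces.\<close>

definition cos_integral :: "real poly \<Rightarrow> real" where
  "cos_integral p = (LINT \<theta>:{0..pi}|lborel. poly p (cos \<theta>) * sin \<theta>)"

lemma cos_integrable: "set_integrable lborel {0..pi} (\<lambda>\<theta>. poly p (cos \<theta>) * sin \<theta>)"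
  by (intro borel_integrable_atLeastAtMost' continuous_intros)

lemma cos_integral_add: "cos_integral (p + q) = cos_integral p + cos_integral q"
  unfolding cos_integral_def
  by (simp add: distrib_right set_integral_add cos_integrable)

lemma cos_integral_smult: "cos_integral (smult c p) = c * cos_integral p"
  unfolding cos_integral_def by (simp add: mult.assoc)

lemma cos_integral_diff: "cos_integral (p - q) = cos_integral p - cos_integral q"
  using cos_integral_add[of p "smult (-1) q"] cos_integral_smult[of "-1" q] by simp

lemma cos_integral_pderiv: "cos_integral (pderiv p) = poly p 1 - poly p (-1)"
proof -
  have "(LBINT \<theta>. indicator {0..pi} \<theta> *\<^sub>R (poly (pderiv p) (cos \<theta>) * sin \<theta>))
      = - poly p (cos pi) - - poly p (cos 0)"
    by (rule integral_FTC_Icc)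
       (auto intro!: derivative_eq_intros continuous_intros
          simp: has_real_derivative_iff_has_vector_derivative[symmetric])
  then show ?thesis by (simp add: cos_integral_def set_lebesgue_integral_def)
qed

lemma cos_integral_by_parts:
  assumes "poly p 1 = 0" "poly p (-1) = 0"
  shows "cos_integral (pderiv p * q) = - cos_integral (p * pderiv q)"
  using cos_integral_pderiv[of "p * q"] assms
  by (simp add: pderiv_mult cos_integral_add mult.commute)

abbreviation one_minus_sq :: "real poly" where "one_minus_sq \<equiv> [:1, 0, -1:]"

lemma pow_dvd_pderiv:
  assumes "w ^ Suc m dvd (p::real poly)" shows "w ^ m dvd pderiv p"
proof -
  obtain r where "p = w ^ Suc m * r" using assms by (auto simp: dvd_def)
  then have "pderiv p = w ^ Suc m * pderiv r + r * (smult (of_nat (Suc m)) (w ^ m) * pderiv w)"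
    by (simp only: pderiv_mult pderiv_power_Suc)
  also have "\<dots> = w ^ m * (w * pderiv r + r * smult (of_nat (Suc m)) (pderiv w))"
    by (simp only: power_Suc mult_smult_left mult_smult_right distrib_left mult_ac)
  finally show ?thesis by simp
qed

text \<open>Each derivative of \<open>p\<close> costs one factor \<open>1 - \<mu>\<^sup>2\<close>, so the first \<open>m\<close> of them still vanish at both
endpoints and no boundary terms appear. Both Rodrigues' formula and the weight
\<open>(1 - \<mu>\<^sup>2) ^ m\<close> of the associated Legendre functions have this divisibility, and all
orthogonality relations below come from this one lemma.\<close>

lemma cos_integral_by_parts_iterated:
  assumes "one_minus_sq ^ m dvd p"
  shows "cos_integral ((pderiv ^^ m) p * q) = (-1) ^ m * cos_integral (p * (pderiv ^^ m) q)"
  using assms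
proof (induction m arbitrary: p)
  case (Suc m)
  have "one_minus_sq dvd p"
    using Suc.prems by (rule dvd_trans[rotated]) (rule dvd_power, simp)
  then have z: "poly p 1 = 0" "poly p (-1) = 0" by (auto simp: dvd_def)
  have "cos_integral ((pderiv ^^ m) (pderiv p) * q)
      = (-1) ^ m * cos_integral (pderiv p * (pderiv ^^ m) q)"
    by (rule Suc.IH[OF pow_dvd_pderiv[OF Suc.prems]])
  then show ?case
    by (simp add: cos_integral_by_parts[OF z] funpow_swap1)
qed simp

text \<open>Integrating by parts against the polynomial \<open>\<mu>\<close> gives \<open>I (l+1) = 2 (l+1) (I l - I (l+1))\<close> for these
integrals \<open>I\<close>, which is solved by the stated quotient of factorials.\<close>

lemma cos_integral_one_minus_sq_power:
  "cos_integral (one_minus_sq ^ l) = 2 ^ (2*l+1) * fact l * fact l / fact (2*l+1)"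
proof (induction l)
  case 0
  show ?case using cos_integral_pderiv[of "[:0,1:]"] by (simp add: pderiv_pCons one_pCons)
next
  case (Suc l)
  have "cos_integral (pderiv [:0,1:] * one_minus_sq ^ Suc l)
      = - cos_integral ([:0,1:] * pderiv (one_minus_sq ^ Suc l))"
    using cos_integral_by_parts[of "one_minus_sq ^ Suc l" "[:0,1:]"]
    by (simp add: mult.commute)
  moreover have "[:0,1:] * pderiv (one_minus_sq ^ Suc l)
      = smult (2 * of_nat (Suc l)) (one_minus_sq ^ Suc l - one_minus_sq ^ l)"
  proof -
    have e: "[:0,1:] * pderiv one_minus_sq = smult 2 (one_minus_sq - 1)"
      by (simp add: pderiv_pCons one_pCons)
    have "[:0,1:] * pderiv (one_minus_sq ^ Suc l)
       = smult (of_nat (Suc l)) (one_minus_sq ^ l * ([:0,1:] * pderiv one_minus_sq))"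
      by (simp only: pderiv_power_Suc mult_smult_right mult_smult_left mult_ac)
    also have "\<dots> = smult (of_nat (Suc l)) (smult 2 (one_minus_sq ^ l * (one_minus_sq - 1)))"
      by (simp only: e mult_smult_right)
    finally show ?thesis
      by (simp only: smult_smult power_Suc2 right_diff_distrib mult_1_right mult.commute[of 2])
  qed
  ultimately have "cos_integral (one_minus_sq ^ Suc l)
     = 2 * real (Suc l) * (cos_integral (one_minus_sq ^ l) - cos_integral (one_minus_sq ^ Suc l))"
    by (simp only: cos_integral_smult cos_integral_diff) (simp add: pderiv_pCons algebra_simps)
  then have "cos_integral (one_minus_sq ^ Suc l) * (2 * real l + 3)
     = 2 * real (Suc l) * cos_integral (one_minus_sq ^ l)"
    by (simp add: algebra_simps)
  then have *: "cos_integral (one_minus_sq ^ Suc l)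
     = 2 * real (Suc l) * cos_integral (one_minus_sq ^ l) / (2 * real l + 3)"
    by (simp add: field_simps)
  have f: "fact (2 * Suc l + 1) = (2 * real l + 3) * (2 * real (Suc l)) * fact (2*l+1)"
    by (simp add: algebra_simps)
  have cancel: "2 * x * (P * F * F / G) / y = (4 * P) * (x * F) * (x * F) / (y * (2 * x) * G)"
    if "x > 0" "y > 0" "G > 0" for x y P F G :: real
    using that by (simp add: field_simps)
  have "fact (Suc l) = real (Suc l) * fact l" "(2::real) ^ (2 * Suc l + 1) = 4 * 2 ^ (2*l+1)"
    by simp_all
  then show ?case
    unfolding * Suc.IH f by (simp only: cancel[OF of_nat_0_less_iff[THEN iffD2, OF zero_less_Suc] _ fact_gt_zero])
qed

lemma legendre_degree_le: "degree (legendre l) \<le> l"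
proof -
  have "degree ([:-1, 0, 1::real:] ^ l) \<le> 2 * l"
    using degree_power_le[of "[:-1, 0, 1::real:]" l] by simp
  then show ?thesis
    by (simp add: legendre_def degree_higher_pderiv)
qed

lemma coeff_legendre: "coeff (legendre l) l = fact (2*l) / (2 ^ l * fact l * fact l)"
proof -
  have d: "degree ([:-1, 0, 1::real:] ^ l) = 2 * l" by (subst degree_power_eq) auto
  have "coeff ([:-1, 0, 1::real:] ^ l) (2*l) = 1"
    using lead_coeff_power[of "[:-1, 0, 1::real:]" l] d by simp
  moreover have "pochhammer (real (Suc l)) l * fact l = fact (2*l)"
    by (simp add: pochhammer_rec' pochhammer_fact flip: pochhammer_product)
       (metis mult_2 pochhammer_fact pochhammer_product' of_nat_1 add.commute mult.commute of_nat_Suc)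
  ultimately have "pochhammer (real (Suc l)) l * coeff ([:-1, 0, 1::real:] ^ l) (l + l)
      = fact (2*l) / fact l"
    by (simp add: field_simps flip: mult_2)
  then show ?thesis
    by (simp only: legendre_def coeff_higher_pderiv coeff_smult) simp
qed

text \<open>Moving the \<open>l\<close> derivatives of Rodrigues' formula onto \<open>q\<close> leaves the constant
\<open>l! coeff q l\<close>. In particular the Legendre polynomial is orthogonal to all polynomials of
smaller degree.\<close>

lemma cos_integral_legendre_mult:
  assumes "degree q \<le> l"
  shows "cos_integral (legendre l * q) = coeff q l * cos_integral (one_minus_sq ^ l) / 2 ^ l"
proof -
  have u: "[:-1, 0, 1::real:] ^ l = smult ((-1) ^ l) (one_minus_sq ^ l)"
    by (simp flip: smult_power)
  have c: "(pderiv ^^ l) q = [:fact l * coeff q l:]"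
  proof (rule poly_eqI)
    fix n
    show "coeff ((pderiv ^^ l) q) n = coeff [:fact l * coeff q l:] n"
      using assms by (cases n) (auto simp: coeff_higher_pderiv pochhammer_fact coeff_eq_0)
  qed
  have "cos_integral ((pderiv ^^ l) ([:-1, 0, 1:] ^ l) * q)
      = (-1) ^ l * cos_integral ([:-1, 0, 1:] ^ l * (pderiv ^^ l) q)"
    by (rule cos_integral_by_parts_iterated) (unfold u, rule dvd_smult, rule dvd_refl)
  also have "\<dots> = fact l * coeff q l * cos_integral (one_minus_sq ^ l)"
    by (simp add: c u cos_integral_smult mult.commute flip: power_mult_distrib)
  finally show ?thesis by (simp add: legendre_def cos_integral_smult field_simps)
qed

text \<open>With \<open>R = (1 - \<mu>\<^sup>2) ^ m D^m P_l\<close>, integration by parts replaces \<open>\<integral> R D^m P_l'\<close> by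
\<open>(-1) ^ m \<integral> (D^m R) P_l'\<close>. The polynomial \<open>D^m R\<close> has degree at most \<open>l\<close>, so only its
coefficient of order \<open>l\<close> matters, and only if \<open>l = l'\<close>. The general case follows by symmetry.\<close>

lemma cos_integral_legendre_pderiv_le:
  assumes "m \<le> l" "l \<le> l'"
  shows "cos_integral (one_minus_sq ^ m * (pderiv ^^ m) (legendre l) * (pderiv ^^ m) (legendre l'))
    = (if l = l' then 2 / (2 * real l + 1) * fact (l + m) / fact (l - m) else 0)"
proof -
  define R where "R = one_minus_sq ^ m * (pderiv ^^ m) (legendre l)"
  define q where "q = (pderiv ^^ m) R"
  have c0: "coeff (legendre l) l \<noteq> 0" by (simp add: coeff_legendre)
  then have dl: "degree (legendre l) = l"
    using legendre_degree_le[of l] le_degree[OF c0] by simp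
  have dw: "degree (one_minus_sq ^ m) = 2 * m" by (subst degree_power_eq) auto
  have lw: "coeff (one_minus_sq ^ m) (2 * m) = (-1) ^ m"
    using lead_coeff_power[of one_minus_sq m] dw by simp
  have dd: "degree ((pderiv ^^ m) (legendre l)) = l - m" by (simp add: degree_higher_pderiv dl)
  have ml: "2 * m + (l - m) = l + m" using assms by simp
  \<comment> \<open>Now the coefficient of order \<open>l\<close> of \<open>D^m R\<close> is computed from leading coefficients.\<close>
  have dR: "degree R \<le> l + m"
    using degree_mult_le[of "one_minus_sq ^ m" "(pderiv ^^ m) (legendre l)"] dw dd ml
    by (simp add: R_def)
  have dq: "degree q \<le> l" using dR by (simp add: q_def degree_higher_pderiv)
  have p1: "pochhammer (real (Suc l)) m = fact (l + m) / fact l"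
    using pochhammer_product'[of "1::real" l m] by (simp add: pochhammer_fact[symmetric] field_simps)
  have p2: "pochhammer (real (Suc (l - m))) m = fact l / fact (l - m)"
    using pochhammer_product'[of "1::real" "l - m" m] assms
    by (simp add: pochhammer_fact[symmetric] field_simps)
  have "coeff R (l + m) = (-1) ^ m * (fact l / fact (l - m) * coeff (legendre l) l)"
    using coeff_mult_degree_sum[of "one_minus_sq ^ m" "(pderiv ^^ m) (legendre l)"] assms
    unfolding dw dd lw ml R_def coeff_higher_pderiv p2 by simp
  then have cq: "coeff q l = (-1) ^ m * (fact (l + m) / fact (l - m) * coeff (legendre l) l)"
    unfolding q_def coeff_higher_pderiv p1 by simp
  have "cos_integral (R * (pderiv ^^ m) (legendre l')) = (-1) ^ m * cos_integral (q * legendre l')"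
    unfolding q_def by (subst cos_integral_by_parts_iterated) (auto simp: R_def)
  also have "\<dots> = (-1) ^ m * (coeff q l' * cos_integral (one_minus_sq ^ l') / 2 ^ l')"
    using cos_integral_legendre_mult[of q l'] dq assms by (simp add: mult.commute)
  also have "\<dots> = (if l = l' then 2 / (2 * real l + 1) * fact (l + m) / fact (l - m) else 0)"
  proof (cases "l = l'")
    case True
    have f: "fact (2*l+1) = (2 * real l + 1) * fact (2*l)" by simp
    have p: "(2::real) ^ (2*l+1) = 2 * 2 ^ l * 2 ^ l"
      by (simp only: mult_2[of l] power_add) simp
    have cancel: "s * (s * (x / y * (G / (P * H * H))) * (2 * P * P * H * H / (z * G)) / P)
        = 2 / z * x / y"
      if "s * s = 1" "y > 0" "z > 0" "G > 0" "P > 0" "H > 0" for s x y z G P H :: real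
    proof -
      have "s = 1 \<or> s = -1" using that(1) by (simp add: square_eq_1_iff)
      then show ?thesis using that(2-) by (auto simp: field_simps)
    qed
    have "(-1) ^ m * (-1) ^ m = (1::real)" by (simp flip: power_mult_distrib)
    then show ?thesis
      unfolding True[symmetric] cq cos_integral_one_minus_sq_power coeff_legendre f p
      by (subst cancel) auto
  next
    case False
    then have "coeff q l' = 0" using dq assms by (intro coeff_eq_0) simp
    then show ?thesis using False by simp
  qed
  finally show ?thesis by (simp add: R_def)
qed

lemma cos_integral_legendre_pderiv:
  assumes "m \<le> l" "m \<le> l'"
  shows "cos_integral (one_minus_sq ^ m * (pderiv ^^ m) (legendre l) * (pderiv ^^ m) (legendre l'))
    = (if l = l' then 2 / (2 * real l + 1) * fact (l + m) / fact (l - m) else 0)"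
proof (cases "l \<le> l'")
  case True
  then show ?thesis using cos_integral_legendre_pderiv_le assms by blast
next
  case False
  have swap: "one_minus_sq ^ m * (pderiv ^^ m) (legendre l) * (pderiv ^^ m) (legendre l')
      = one_minus_sq ^ m * (pderiv ^^ m) (legendre l') * (pderiv ^^ m) (legendre l)"
    by (simp only: mult_ac)
  show ?thesis
    unfolding swap using cos_integral_legendre_pderiv_le[of m l' l] assms False by auto
qed

section \<open>Integration over the sphere\<close>

abbreviation spherical :: "real \<times> real \<Rightarrow> real^3" where
  "spherical \<equiv> (\<lambda>(\<theta>, \<phi>). vector [sin \<theta> * cos \<phi>, sin \<theta> * sin \<phi>, cos \<theta>])"

abbreviation angle_measure :: "(real \<times> real) measure" where
  "angle_measure \<equiv> density (restrict_space lborel ({0..pi} \<times> {0..2*pi}))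
     (\<lambda>p. ennreal (sin (fst p)))"

lemma angle_rectangle_in_sets_borel [measurable]: "{0..pi} \<times> {0..2*pi} \<in> sets (borel :: (real \<times> real) measure)"
  by (intro borel_closed closed_Times) auto

lemma spherical_in_sphere: "spherical p \<in> sphere 0 1"
proof -
  obtain \<theta> \<phi> where p: "p = (\<theta>, \<phi>)" by (cases p)
  have "(sin \<theta> * cos \<phi>)\<^sup>2 + (sin \<theta> * sin \<phi>)\<^sup>2 + (cos \<theta>)\<^sup>2
     = (sin \<theta>)\<^sup>2 * ((cos \<phi>)\<^sup>2 + (sin \<phi>)\<^sup>2) + (cos \<theta>)\<^sup>2"
    by (simp only: power_mult_distrib distrib_left)
  then show ?thesis by (simp add: p norm_vec_def L2_set_def sum_3)
qed

lemma borel_measurable_spherical: "spherical \<in> borel_measurable borel"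
proof -
  have "spherical = (\<lambda>p. \<chi> i. if i = 1 then sin (fst p) * cos (snd p)
      else if i = 2 then sin (fst p) * sin (snd p) else cos (fst p))"
    by (auto simp: fun_eq_iff vec_eq_iff forall_3)
  also have "\<dots> \<in> borel_measurable borel"
  proof (intro borel_measurable_continuous_onI continuous_on_vec_lambda)
    fix i :: 3
    consider "i = 1" | "i \<noteq> 1" "i = 2" | "i \<noteq> 1" "i \<noteq> 2" by blast
    then show "continuous_on UNIV (\<lambda>p::real \<times> real. if i = 1 then sin (fst p) * cos (snd p)
      else if i = 2 then sin (fst p) * sin (snd p) else cos (fst p))"
      by cases (auto intro!: continuous_intros)
  qed
  finally show ?thesis .
qed

lemma measurable_spherical:
  "spherical \<in> measurable angle_measure (restrict_space borel (sphere 0 1))"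
proof -
  have "spherical \<in> measurable (restrict_space lborel ({0..pi} \<times> {0..2*pi}))
          (restrict_space borel (sphere 0 1))"
    using spherical_in_sphere borel_measurable_spherical
    by (intro measurable_restrict_space2 measurable_restrict_space1) auto
  then show ?thesis by simp
qed

lemma S2_eq_distr_angle_measure: "S2 = distr angle_measure (restrict_space borel (sphere 0 1)) spherical"
  by (simp add: S2_def case_prod_unfold)

lemma space_S2: "space S2 = sphere 0 1"
  by (simp add: S2_def space_restrict_space)

lemma borel_measurable_S2: "f \<in> borel_measurable borel \<Longrightarrow> f \<in> borel_measurable S2"
  by (simp add: S2_def measurable_restrict_space1)

lemma borel_measurable_sin_fst [measurable]: "(\<lambda>p::real \<times> real. sin (fst p)) \<in> borel_measurable borel"
  by (intro borel_measurable_continuous_onI continuous_intros)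

lemma finite_measure_S2: "finite_measure S2"
proof -
  have "emeasure angle_measure (space angle_measure)
      = (\<integral>\<^sup>+p. ennreal (sin (fst p)) * indicator (space angle_measure) p
           \<partial>restrict_space lborel ({0..pi} \<times> {0..2*pi}))"
    unfolding space_density
    by (intro emeasure_density sets.top measurable_compose[OF _ measurable_ennreal] measurable_restrict_space1) simp
  also have "\<dots> \<le> (\<integral>\<^sup>+p. 1 \<partial>restrict_space lborel ({0..pi} \<times> {0..2*pi}))"
    by (intro nn_integral_mono) (auto simp: indicator_def)
  also have "\<dots> = emeasure lborel ({0..pi} \<times> {0..2*pi})"
    by (simp add: emeasure_restrict_space space_restrict_space)
  also have "\<dots> = emeasure lborel {0..pi} * emeasure lborel {0..2*pi}"
    by (subst lborel_prod[symmetric]) (rule lborel.emeasure_pair_measure_Times, auto)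
  also have "\<dots> < \<infinity>" by (simp add: ennreal_mult_less_top)
  finally have "emeasure angle_measure (space angle_measure) \<noteq> \<infinity>" by simp
  then have "finite_measure angle_measure" by (rule finite_measureI)
  then show ?thesis
    unfolding S2_eq_distr_angle_measure by (rule finite_measure.finite_measure_distr) (rule measurable_spherical)
qed

text \<open>The surface measure is the image of a weighted Lebesgue measure on the rectangle of angles, so the
integral can be pulled back without any smoothness of \<open>f\<close>.\<close>

lemma S2_integral_eq:
  fixes f :: "real^3 \<Rightarrow> complex"
  assumes f: "f \<in> borel_measurable S2"
  shows "(\<integral>x. f x \<partial>S2) = (LINT p:{0..pi} \<times> {0..2*pi}|lborel. sin (fst p) *\<^sub>R f (spherical p))"
proof -
  have f': "f \<in> borel_measurable (restrict_space borel (sphere 0 1))"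
    using f by (simp add: S2_def)
  have fs: "(\<lambda>p. f (spherical p)) \<in> borel_measurable (restrict_space lborel ({0..pi} \<times> {0..2*pi}))"
    using measurable_compose[OF measurable_spherical f'] by simp
  have "(\<integral>x. f x \<partial>S2) = (\<integral>p. f (spherical p) \<partial>angle_measure)"
    unfolding S2_eq_distr_angle_measure using measurable_spherical f' by (rule integral_distr)
  also have "\<dots> = (\<integral>p. sin (fst p) *\<^sub>R f (spherical p) \<partial>restrict_space lborel ({0..pi} \<times> {0..2*pi}))"
    by (rule integral_density[OF fs])
       (auto intro!: measurable_restrict_space1 AE_I2 sin_ge_zero simp: space_restrict_space)
  also have "\<dots> = (LINT p:{0..pi} \<times> {0..2*pi}|lborel. sin (fst p) *\<^sub>R f (spherical p))"
    unfolding set_lebesgue_integral_def by (subst integral_restrict_space) auto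
  finally show ?thesis .
qed

lemma set_integral_Times:
  fixes G :: "real \<Rightarrow> real" and E :: "real \<Rightarrow> complex"
  assumes G: "set_integrable lborel A G" and E: "set_integrable lborel B E"
  shows "(LINT p:A \<times> B|lborel. G (fst p) *\<^sub>R E (snd p))
       = (LINT x:A|lborel. G x) *\<^sub>R (LINT y:B|lborel. E y)"
proof -
  let ?G = "\<lambda>x. indicator A x *\<^sub>R G x" and ?E = "\<lambda>y. indicator B y *\<^sub>R E y"
  have iG: "integrable lborel ?G" and iE: "integrable lborel ?E"
    using G E by (auto simp: set_integrable_def)
  have m: "?G \<in> borel_measurable lborel" "?E \<in> borel_measurable lborel"
    using iG iE by (auto dest: borel_measurable_integrable)
  have int: "integrable (lborel \<Otimes>\<^sub>M lborel) (\<lambda>p. ?G (fst p) *\<^sub>R ?E (snd p))"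
  proof (rule lborel_pair.Fubini_integrable)
    show "(\<lambda>p. ?G (fst p) *\<^sub>R ?E (snd p)) \<in> borel_measurable (lborel \<Otimes>\<^sub>M lborel)"
      by (rule borel_measurable_scaleR[OF measurable_compose[OF measurable_fst m(1)]
            measurable_compose[OF measurable_snd m(2)]])
    have "integrable lborel (\<lambda>x. \<bar>?G x\<bar> * (\<integral>y. norm (?E y) \<partial>lborel))"
      using iG by (intro integrable_mult_left integrable_abs)
    then show "integrable lborel (\<lambda>x. \<integral>y. norm (?G (fst (x, y)) *\<^sub>R ?E (snd (x, y))) \<partial>lborel)"
      by (simp only: norm_scaleR fst_conv snd_conv integral_mult_right_zero real_norm_def)
    show "AE x in lborel. integrable lborel (\<lambda>y. ?G (fst (x, y)) *\<^sub>R ?E (snd (x, y)))"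
      using iE by (simp only: fst_conv snd_conv) (intro AE_I2 integrable_scaleR_right)
  qed
  have "(LINT p:A \<times> B|lborel. G (fst p) *\<^sub>R E (snd p))
     = (\<integral>p. ?G (fst p) *\<^sub>R ?E (snd p) \<partial>(lborel \<Otimes>\<^sub>M lborel))"
    unfolding set_lebesgue_integral_def lborel_prod
    by (intro Bochner_Integration.integral_cong) (auto simp: indicator_def)
  also have "\<dots> = (\<integral>x. (\<integral>y. ?G x *\<^sub>R ?E y \<partial>lborel) \<partial>lborel)"
    using lborel_pair.integral_fst'[OF int] by simp
  also have "\<dots> = (\<integral>x. ?G x *\<^sub>R (\<integral>y. ?E y \<partial>lborel) \<partial>lborel)"
    by (simp only: integral_scaleR_right)
  also have "\<dots> = (\<integral>x. ?G x \<partial>lborel) *\<^sub>R (\<integral>y. ?E y \<partial>lborel)"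
    using iG by (intro integral_scaleR_left) auto
  finally show ?thesis unfolding set_lebesgue_integral_def .
qed

lemma integral_cis_period:
  "(LINT \<phi>:{0..2*pi}|lborel. cis (of_int n * \<phi>)) = (if n = 0 then of_real (2 * pi) else 0)"
proof (cases "n = 0")
  case True
  then show ?thesis by (simp add: set_lebesgue_integral_def scaleR_conv_of_real)
next
  case False
  have "(LBINT \<phi>. indicator {0..2*pi} \<phi> *\<^sub>R cis (of_int n * \<phi>))
    = (\<lambda>\<phi>. cis (of_int n * \<phi>) / (\<i> * of_int n)) (2*pi) - (\<lambda>\<phi>. cis (of_int n * \<phi>) / (\<i> * of_int n)) 0"
  proof (rule integral_FTC_Icc)
    fix x :: real
    have "((\<lambda>\<phi>. exp (of_int n * of_real \<phi> * \<i>)) has_vector_derivative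
        (of_int n * \<i>) * exp (of_int n * of_real x * \<i>)) (at x within {0..2*pi})"
      by (rule has_vector_derivative_real_field[where f="\<lambda>z. exp (of_int n * z * \<i>)"])
         (auto intro!: derivative_eq_intros)
    then have "((\<lambda>\<phi>. cis (of_int n * \<phi>)) has_vector_derivative
        (of_int n * \<i>) * cis (of_int n * x)) (at x within {0..2*pi})"
      by (simp add: cis_conv_exp mult_ac)
    from has_vector_derivative_mult_right[OF this, of "inverse (\<i> * of_int n)"]
    show "((\<lambda>\<phi>. cis (of_int n * \<phi>) / (\<i> * of_int n)) has_vector_derivative
        cis (of_int n * x)) (at x within {0..2*pi})"
      using False by (simp add: field_simps)
  qed (auto intro!: continuous_intros)
  also have "cis (of_int n * (2*pi)) = 1"
    using cis_multiple_2pi[of "of_int n"] by (simp add: mult_ac)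
  finally show ?thesis using False by (simp add: set_lebesgue_integral_def)
qed

section \<open>Orthonormality of the spherical harmonics\<close>

text \<open>This replaces the argument function, which jumps along the negative real axis, by expressions
whose measurability is immediate.\<close>

lemma cis_Arg_power: "cis (real m * Arg z) = (if z = 0 then 1 else sgn z ^ m)"
proof -
  have "cis (real m * Arg z) = cis (Arg z) ^ m" by (rule Complex.DeMoivre[symmetric])
  then show ?thesis by (simp add: cis_Arg Arg_zero)
qed

lemma borel_measurable_cnj [measurable (raw)]:
  "f \<in> borel_measurable M \<Longrightarrow> (\<lambda>x. cnj (f x)) \<in> borel_measurable M"
  by (rule measurable_compose[OF _ borel_measurable_continuous_onI]) (auto intro!: continuous_intros)

lemma borel_measurable_sph_harm_nonneg: "sph_harm_nonneg l m \<in> borel_measurable borel"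
proof -
  have "(\<lambda>x::real^3. Complex (x $ 1) (x $ 2)) = (\<lambda>x. of_real (x $ 1) + \<i> * of_real (x $ 2))"
    by (auto simp: complex_eq_iff)
  then have [measurable]: "(\<lambda>x::real^3. Complex (x $ 1) (x $ 2)) \<in> borel_measurable borel"
    by simp
  have [measurable]: "poly p \<in> borel_measurable borel" for p :: "real poly"
    by (intro borel_measurable_continuous_onI continuous_intros)
  show ?thesis
    unfolding sph_harm_nonneg_def assoc_legendre_def cis_Arg_power by measurable
qed

lemma borel_measurable_sph_harm: "sph_harm l m \<in> borel_measurable S2"
proof (rule borel_measurable_S2)
  show "sph_harm l m \<in> borel_measurable borel"
    unfolding sph_harm_def[abs_def] using borel_measurable_sph_harm_nonneg[measurable] by (cases "0 \<le> m") auto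
qed

text \<open>The real factor of \<open>sph_harm l m\<close> that remains after splitting off \<open>cis (m \<phi>)\<close>. With it, one formula
covers positive and negative orders.\<close>

definition polar_part :: "nat \<Rightarrow> int \<Rightarrow> real \<Rightarrow> real" where
  "polar_part l m \<mu> = (if 0 \<le> m then 1 else (-1) ^ nat (-m)) *
     (sqrt ((2 * real l + 1) / (4 * pi) * fact (l - nat \<bar>m\<bar>) / fact (l + nat \<bar>m\<bar>))
        * assoc_legendre l (nat \<bar>m\<bar>) \<mu>)"

lemma sph_harm_polar:
  "sph_harm l m x = of_real (polar_part l m (x $ 3)) * cis (of_int m * Arg (Complex (x $ 1) (x $ 2)))"
proof (cases "0 \<le> m")
  case True
  then show ?thesis by (simp add: sph_harm_def sph_harm_nonneg_def polar_part_def)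
next
  case False
  then have "real (nat (- m)) = - of_int m" by simp
  then show ?thesis using False
    by (simp add: sph_harm_def sph_harm_nonneg_def polar_part_def cis_cnj abs_if)
qed

text \<open>Away from the poles the argument of \<open>(x\<^sub>1, x\<^sub>2)\<close> is \<open>\<phi>\<close> up to a multiple of \<open>2 \<pi>\<close>, which the
integer \<open>m\<close> makes invisible. At the poles the azimuth is lost, but there the weight \<open>sin \<theta>\<close> of the
surface measure vanishes.\<close>

lemma sph_harm_spherical:
  assumes "sin \<theta> > 0"
  shows "sph_harm l m (spherical (\<theta>, \<phi>)) = of_real (polar_part l m (cos \<theta>)) * cis (of_int m * \<phi>)"
proof -
  have "cis (Arg (Complex (sin \<theta> * cos \<phi>) (sin \<theta> * sin \<phi>))) = cis \<phi>"
  proof -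
    have e: "Complex (sin \<theta> * cos \<phi>) (sin \<theta> * sin \<phi>) = of_real (sin \<theta>) * cis \<phi>"
      by (simp add: complex_eq_iff)
    then have "Complex (sin \<theta> * cos \<phi>) (sin \<theta> * sin \<phi>) \<noteq> 0" using assms by simp
    moreover have "sgn (of_real (sin \<theta>) * cis \<phi>) = cis \<phi>"
      using assms by (simp add: sgn_mult sgn_of_real sgn_cis)
    ultimately show ?thesis unfolding e by (simp add: cis_Arg)
  qed
  then have "cis (Arg (Complex (sin \<theta> * cos \<phi>) (sin \<theta> * sin \<phi>))) powi m = cis \<phi> powi m" by simp
  then show ?thesis by (simp add: sph_harm_polar cis_power_int mult.commute)
qed

text \<open>For equal orders the half-integer powers of \<open>1 - \<mu>\<^sup>2\<close> pair up, so the product is a polynomial and the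
Legendre orthogonality applies.\<close>

lemma polar_part_mult:
  fixes m :: int
  assumes "\<bar>\<mu>\<bar> \<le> 1"
  defines "k \<equiv> nat \<bar>m\<bar>"
  shows "polar_part l m \<mu> * polar_part l' m \<mu>
    = sqrt ((2 * real l + 1) / (4 * pi) * fact (l - k) / fact (l + k))
      * sqrt ((2 * real l' + 1) / (4 * pi) * fact (l' - k) / fact (l' + k))
      * poly (one_minus_sq ^ k * (pderiv ^^ k) (legendre l) * (pderiv ^^ k) (legendre l')) \<mu>"
proof -
  have sq: "sqrt (1 - \<mu>\<^sup>2) ^ k * sqrt (1 - \<mu>\<^sup>2) ^ k = poly (one_minus_sq ^ k) \<mu>"
  proof -
    have "0 \<le> 1 - \<mu>\<^sup>2" using assms(1) by (simp add: abs_square_le_1)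
    then show ?thesis by (simp add: poly_power power2_eq_square flip: power_mult_distrib)
  qed
  have sgn: "(if 0 \<le> m then 1 else (-1) ^ nat (-m)) * (if 0 \<le> m then 1 else (-1) ^ nat (-m)) = (1::real)"
    by (simp flip: power_mult_distrib)
  have sgn': "(-1) ^ k * (-1) ^ k = (1::real)" by (simp flip: power_mult_distrib)
  have "polar_part l m \<mu> * polar_part l' m \<mu>
    = ((if 0 \<le> m then 1 else (-1) ^ nat (-m)) * (if 0 \<le> m then 1 else (-1) ^ nat (-m)))
      * ((-1) ^ k * (-1) ^ k)
      * (sqrt ((2 * real l + 1) / (4 * pi) * fact (l - k) / fact (l + k))
      * sqrt ((2 * real l' + 1) / (4 * pi) * fact (l' - k) / fact (l' + k)))
      * (sqrt (1 - \<mu>\<^sup>2) ^ k * sqrt (1 - \<mu>\<^sup>2) ^ k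
      * poly ((pderiv ^^ k) (legendre l)) \<mu> * poly ((pderiv ^^ k) (legendre l')) \<mu>)"
    unfolding polar_part_def assoc_legendre_def k_def by (simp only: mult_ac)
  then show ?thesis unfolding sgn sgn' sq by (simp only: poly_mult mult_1_left)
qed

lemma continuous_on_polar_part: "continuous_on A (polar_part l m)"
  unfolding polar_part_def assoc_legendre_def by (intro continuous_intros)

text \<open>Fubini separates the two angles. The azimuthal integral enforces \<open>m = m'\<close>, the polar one then
enforces \<open>l = l'\<close>, and the normalizing constants are the inverse of the Legendre norms.\<close>

theorem sph_harm_orthonormal:
  assumes "\<bar>m\<bar> \<le> int l" "\<bar>m'\<bar> \<le> int l'"
  shows "(\<integral>x. sph_harm l m x * cnj (sph_harm l' m' x) \<partial>S2) = (if l = l' \<and> m = m' then 1 else 0)"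
proof -
  let ?G = "\<lambda>\<theta>. sin \<theta> * (polar_part l m (cos \<theta>) * polar_part l' m' (cos \<theta>))"
  let ?E = "\<lambda>\<phi>. cis (of_int (m - m') * \<phi>)"
  have "(\<lambda>x. sph_harm l m x * cnj (sph_harm l' m' x)) \<in> borel_measurable S2"
    using borel_measurable_sph_harm[measurable] by measurable
  then have "(\<integral>x. sph_harm l m x * cnj (sph_harm l' m' x) \<partial>S2)
    = (LINT p:{0..pi} \<times> {0..2*pi}|lborel.
         sin (fst p) *\<^sub>R (sph_harm l m (spherical p) * cnj (sph_harm l' m' (spherical p))))"
    by (rule S2_integral_eq)
  also have "\<dots> = (LINT p:{0..pi} \<times> {0..2*pi}|lborel. ?G (fst p) *\<^sub>R ?E (snd p))"
  proof (intro set_lebesgue_integral_cong ballI allI impI)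
    fix p :: "real \<times> real" assume "p \<in> {0..pi} \<times> {0..2*pi}"
    then obtain \<theta> \<phi> where p: "p = (\<theta>, \<phi>)" and "0 \<le> \<theta>" "\<theta> \<le> pi" by (cases p) auto
    then have "sin \<theta> > 0 \<or> sin \<theta> = 0" using sin_ge_zero[of \<theta>] by linarith
    moreover have "cis (of_int m * \<phi>) * cis (- (of_int m' * \<phi>)) = ?E \<phi>"
      by (simp add: cis_mult algebra_simps)
    moreover have "sph_harm l m (spherical p) * cnj (sph_harm l' m' (spherical p))
        = of_real (polar_part l m (cos \<theta>) * polar_part l' m' (cos \<theta>))
          * (cis (of_int m * \<phi>) * cis (- (of_int m' * \<phi>)))" if "sin \<theta> > 0"
      unfolding p sph_harm_spherical[OF that] by (simp add: cis_cnj)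
    ultimately show "sin (fst p) *\<^sub>R (sph_harm l m (spherical p) * cnj (sph_harm l' m' (spherical p)))
       = ?G (fst p) *\<^sub>R ?E (snd p)"
      by (auto simp: p scaleR_conv_of_real simp del: of_int_diff)
  qed auto
  also have "\<dots> = (LINT \<theta>:{0..pi}|lborel. ?G \<theta>) *\<^sub>R (LINT \<phi>:{0..2*pi}|lborel. ?E \<phi>)"
    by (intro set_integral_Times borel_integrable_atLeastAtMost' continuous_intros
          continuous_on_compose2[OF continuous_on_polar_part[of UNIV]]) auto
  also have "\<dots> = (if l = l' \<and> m = m' then 1 else 0)"
  proof (cases "m = m'")
    case True
    define k where "k = nat \<bar>m\<bar>"
    have kl: "k \<le> l" "k \<le> l'" using assms True by (auto simp: k_def)
    let ?K = "sqrt ((2 * real l + 1) / (4 * pi) * fact (l - k) / fact (l + k))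
      * sqrt ((2 * real l' + 1) / (4 * pi) * fact (l' - k) / fact (l' + k))"
    let ?p = "one_minus_sq ^ k * (pderiv ^^ k) (legendre l) * (pderiv ^^ k) (legendre l')"
    have G: "?G = (\<lambda>\<theta>. ?K * (poly ?p (cos \<theta>) * sin \<theta>))"
      unfolding True[symmetric] k_def by (subst polar_part_mult) (simp_all only: abs_cos_le_one mult_ac)
    have "(LINT \<theta>:{0..pi}|lborel. ?G \<theta>) = ?K * cos_integral ?p"
      unfolding G cos_integral_def by (rule set_integral_mult_right)
    also have "\<dots> = (if l = l' then 1 / (2 * pi) else 0)"
    proof (cases "l = l'")
      case True
      have cancel: "a / (4 * pi) * x / y * (2 / a * y / x) = 1 / (2 * pi)"
        if "a > 0" "x > 0" "y > 0" for a x y :: real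
        using that by (simp add: field_simps)
      have K: "?K = (2 * real l + 1) / (4 * pi) * fact (l - k) / fact (l + k)"
        unfolding True[symmetric] by (rule real_sqrt_mult_self[THEN trans]) simp
      have "?K * (2 / (2 * real l + 1) * fact (l + k) / fact (l - k)) = 1 / (2 * pi)"
        unfolding K by (rule cancel) auto
      then show ?thesis
        unfolding cos_integral_legendre_pderiv[OF kl] if_P[OF True] .
    qed (simp add: cos_integral_legendre_pderiv[OF kl])
    finally show ?thesis
      unfolding integral_cis_period using True by (simp add: scaleR_conv_of_real)
  qed (simp add: integral_cis_period del: of_int_diff)
  finally show ?thesis .
qed

text \<open>Boundedness on a finite measure space gives every integrability property of the harmonics.\<close>

lemma sph_harm_bounded: "\<exists>B. \<forall>x \<in> space S2. norm (sph_harm l m x) \<le> B"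
proof -
  have "bounded (polar_part l m ` {-1..1})"
    by (intro compact_imp_bounded compact_continuous_image continuous_on_polar_part) simp
  then obtain B where B: "\<forall>\<mu>\<in>{-1..1}. \<bar>polar_part l m \<mu>\<bar> \<le> B"
    by (auto simp: bounded_iff)
  have "norm (sph_harm l m x) \<le> B" if "x \<in> space S2" for x
  proof -
    have "\<bar>x $ 3\<bar> \<le> 1" using component_le_norm_cart[of x 3] that by (simp add: space_S2)
    then show ?thesis using B[THEN bspec, of "x $ 3"] by (simp add: abs_le_iff sph_harm_polar norm_mult)
  qed
  then show ?thesis by blast
qed

section \<open>Bessel's inequality and Parseval's identity\<close>

lemma integrable_mult_cnj:
  fixes f g :: "'a \<Rightarrow> complex"
  assumes [measurable]: "f \<in> borel_measurable N" "g \<in> borel_measurable N"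
    and int: "integrable N (\<lambda>x. (norm (f x))\<^sup>2)" "integrable N (\<lambda>x. (norm (g x))\<^sup>2)"
  shows "integrable N (\<lambda>x. f x * cnj (g x))"
proof (rule Bochner_Integration.integrable_bound)
  show "integrable N (\<lambda>x. (norm (f x))\<^sup>2 + (norm (g x))\<^sup>2)"
    using int by (rule Bochner_Integration.integrable_add)
  have "norm (f x * cnj (g x)) \<le> norm ((norm (f x))\<^sup>2 + (norm (g x))\<^sup>2)" for x
  proof -
    have "2 * norm (f x) * norm (g x) \<le> (norm (f x))\<^sup>2 + (norm (g x))\<^sup>2"
      by (rule sum_squares_bound)
    moreover have "0 \<le> norm (f x) * norm (g x)" by simp
    ultimately have "norm (f x) * norm (g x) \<le> (norm (f x))\<^sup>2 + (norm (g x))\<^sup>2" by linarith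
    then show ?thesis by (simp add: norm_mult)
  qed
  then show "AE x in N. norm (f x * cnj (g x)) \<le> norm ((norm (f x))\<^sup>2 + (norm (g x))\<^sup>2)" by simp
qed measurable

context
  fixes N :: "'a measure" and e :: "'i \<Rightarrow> 'a \<Rightarrow> complex" and I :: "'i set"
  assumes fin: "finite I"
    and e_meas: "\<And>i. i \<in> I \<Longrightarrow> e i \<in> borel_measurable N"
    and e_int: "\<And>i. i \<in> I \<Longrightarrow> integrable N (\<lambda>x. (norm (e i x))\<^sup>2)"
    and e_orth: "\<And>i j. i \<in> I \<Longrightarrow> j \<in> I \<Longrightarrow> (\<integral>x. e i x * cnj (e j x) \<partial>N) = (if i = j then 1 else 0)"
begin

lemma orthonormal_sum_mult_cnj:
  "(\<Sum>i\<in>I. c i * e i x) * cnj (\<Sum>i\<in>I. c i * e i x)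
     = (\<Sum>i\<in>I. \<Sum>j\<in>I. c i * cnj (c j) * (e i x * cnj (e j x)))"
  by (simp add: sum_product mult_ac)

lemma integrable_norm_orthonormal_sum: "integrable N (\<lambda>x. (norm (\<Sum>i\<in>I. c i * e i x))\<^sup>2)"
proof -
  have "integrable N (\<lambda>x. Re ((\<Sum>i\<in>I. c i * e i x) * cnj (\<Sum>i\<in>I. c i * e i x)))"
    unfolding orthonormal_sum_mult_cnj
    by (intro integrable_Re Bochner_Integration.integrable_sum integrable_mult_right
          integrable_mult_cnj e_meas e_int)
  then show ?thesis by (simp only: complex_norm_square[symmetric] Re_complex_of_real)
qed

lemma parseval_orthonormal_sum:
  "(\<integral>x. (norm (\<Sum>i\<in>I. c i * e i x))\<^sup>2 \<partial>N) = (\<Sum>i\<in>I. (norm (c i))\<^sup>2)"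
proof -
  have "complex_of_real (\<integral>x. (norm (\<Sum>i\<in>I. c i * e i x))\<^sup>2 \<partial>N)
      = (\<integral>x. (\<Sum>i\<in>I. c i * e i x) * cnj (\<Sum>i\<in>I. c i * e i x) \<partial>N)"
    by (simp only: integral_complex_of_real[symmetric] complex_norm_square)
  also have "\<dots> = (\<Sum>i\<in>I. \<Sum>j\<in>I. c i * cnj (c j) * (\<integral>x. e i x * cnj (e j x) \<partial>N))"
    unfolding orthonormal_sum_mult_cnj
    by (subst Bochner_Integration.integral_sum,
        intro Bochner_Integration.integrable_sum integrable_mult_right integrable_mult_cnj e_meas e_int,
        (assumption+),
        rule sum.cong[OF refl], subst Bochner_Integration.integral_sum,
        intro integrable_mult_right integrable_mult_cnj e_meas e_int, (assumption+), simp)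
  also have "\<dots> = (\<Sum>i\<in>I. \<Sum>j\<in>I. if i = j then c i * cnj (c j) else 0)"
    by (intro sum.cong refl) (simp add: e_orth)
  also have "\<dots> = complex_of_real (\<Sum>i\<in>I. (norm (c i))\<^sup>2)"
    using fin by (simp only: of_real_sum complex_norm_square sum.delta) simp
  finally show ?thesis by (simp only: of_real_eq_iff)
qed

text \<open>Expand \<open>0 \<le> \<integral> |f - S|\<^sup>2\<close> for the orthogonal projection \<open>S\<close> of \<open>f\<close>.\<close>

lemma bessel_inequality:
  assumes f[measurable]: "f \<in> borel_measurable N" and fi: "integrable N (\<lambda>x. (norm (f x))\<^sup>2)"
  shows "(\<Sum>i\<in>I. (norm (\<integral>x. f x * cnj (e i x) \<partial>N))\<^sup>2) \<le> (\<integral>x. (norm (f x))\<^sup>2 \<partial>N)"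
proof -
  define c where "c i = (\<integral>x. f x * cnj (e i x) \<partial>N)" for i
  define S where "S x = (\<Sum>i\<in>I. c i * e i x)" for x
  have Sm[measurable]: "S \<in> borel_measurable N"
    unfolding S_def using e_meas by (intro borel_measurable_sum borel_measurable_times) auto
  have Si: "integrable N (\<lambda>x. (norm (S x))\<^sup>2)"
    unfolding S_def by (rule integrable_norm_orthonormal_sum)
  have cross: "f x * cnj (S x) = (\<Sum>i\<in>I. cnj (c i) * (f x * cnj (e i x)))" for x
    by (simp add: S_def sum_distrib_left mult_ac)
  have "(\<integral>x. f x * cnj (S x) \<partial>N) = (\<Sum>i\<in>I. cnj (c i) * c i)"
    unfolding cross c_def
    by (subst Bochner_Integration.integral_sum,
        intro integrable_mult_right integrable_mult_cnj e_meas e_int f fi, (assumption+), simp)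
  also have "\<dots> = complex_of_real (\<Sum>i\<in>I. (norm (c i))\<^sup>2)"
    by (simp only: of_real_sum complex_norm_square mult.commute)
  finally have ReS: "(\<integral>x. Re (f x * cnj (S x)) \<partial>N) = (\<Sum>i\<in>I. (norm (c i))\<^sup>2)"
    using integrable_mult_cnj[OF f Sm fi Si] by (simp only: integral_Re Re_complex_of_real)
  have split3: "(\<integral>x. u x - 2 * v x + w x \<partial>N) = (\<integral>x. u x \<partial>N) - 2 * (\<integral>x. v x \<partial>N) + (\<integral>x. w x \<partial>N)"
    if "integrable N u" "integrable N v" "integrable N w" for u v w :: "'a \<Rightarrow> real"
    using that by simp
  have "0 \<le> (\<integral>x. (norm (f x - S x))\<^sup>2 \<partial>N)" by simp
  also have "(\<lambda>x. (norm (f x - S x))\<^sup>2) = (\<lambda>x. (norm (f x))\<^sup>2 - 2 * Re (f x * cnj (S x)) + (norm (S x))\<^sup>2)"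
    unfolding cmod_power2 by (auto simp: fun_eq_iff power2_eq_square algebra_simps)
  also have "(\<integral>x. \<dots> x \<partial>N) = (\<integral>x. (norm (f x))\<^sup>2 \<partial>N) - 2 * (\<Sum>i\<in>I. (norm (c i))\<^sup>2) + (\<integral>x. (norm (S x))\<^sup>2 \<partial>N)"
    unfolding ReS[symmetric]
    by (rule split3) (rule fi Si integrable_Re[OF integrable_mult_cnj[OF f Sm fi Si]])+
  also have "(\<integral>x. (norm (S x))\<^sup>2 \<partial>N) = (\<Sum>i\<in>I. (norm (c i))\<^sup>2)"
    unfolding S_def by (rule parseval_orthonormal_sum)
  finally show ?thesis by (simp add: c_def)
qed

end

abbreviation harmonic_indices :: "nat \<Rightarrow> (nat \<times> int) set" where
  "harmonic_indices \<kappa> \<equiv> (SIGMA l:{..\<kappa>}. {- int l..int l})"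

lemma integrable_norm_sph_harm: "integrable S2 (\<lambda>x. (norm (sph_harm l m x))\<^sup>2)"
proof -
  obtain B where B: "\<And>x. x \<in> space S2 \<Longrightarrow> norm (sph_harm l m x) \<le> B"
    using sph_harm_bounded by blast
  have [measurable]: "sph_harm l m \<in> borel_measurable S2" by (rule borel_measurable_sph_harm)
  show ?thesis
    using B by (intro finite_measure.integrable_const_bound[OF finite_measure_S2, of _ "B\<^sup>2"])
       (auto intro!: AE_I2 power_mono)
qed

lemma L2_norm_sph_harm_sum:
  "(L2_norm (\<lambda>x. \<Sum>l\<le>\<kappa>. \<Sum>m\<in>{- int l..int l}. c l m * sph_harm l m x))\<^sup>2
     = (\<Sum>l\<le>\<kappa>. \<Sum>m\<in>{- int l..int l}. (norm (c l m))\<^sup>2)"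
proof -
  have "(\<integral>x. (norm (\<Sum>i\<in>harmonic_indices \<kappa>. case_prod c i * case_prod sph_harm i x))\<^sup>2 \<partial>S2)
      = (\<Sum>i\<in>harmonic_indices \<kappa>. (norm (case_prod c i))\<^sup>2)"
    by (rule parseval_orthonormal_sum)
       (auto simp: borel_measurable_sph_harm integrable_norm_sph_harm sph_harm_orthonormal abs_le_iff split: if_splits)
  then show ?thesis
    by (simp add: L2_norm_def sum.Sigma case_prod_unfold sum_nonneg)
qed

lemma bessel_sph_coeff:
  assumes "f \<in> L2_sphere"
  shows "(\<Sum>l\<le>\<kappa>. \<Sum>m\<in>{- int l..int l}. (norm (sph_coeff f l m))\<^sup>2) \<le> (L2_norm f)\<^sup>2"
proof -
  have [measurable]: "f \<in> borel_measurable S2" and int: "integrable S2 (\<lambda>x. (f x)\<^sup>2)"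
    using assms by (auto simp: L2_sphere_def)
  have "(\<Sum>i\<in>harmonic_indices \<kappa>. (norm (\<integral>x. complex_of_real (f x) * cnj (case_prod sph_harm i x) \<partial>S2))\<^sup>2)
      \<le> (\<integral>x. (norm (complex_of_real (f x)))\<^sup>2 \<partial>S2)"
    using int by (intro bessel_inequality)
       (auto simp: borel_measurable_sph_harm integrable_norm_sph_harm sph_harm_orthonormal abs_le_iff split: if_splits)
  then show ?thesis
    by (simp add: L2_norm_def sph_coeff_def sum.Sigma case_prod_unfold)
qed

lemma norm_sph_coeff_le:
  assumes "f \<in> L2_sphere" "\<bar>m\<bar> \<le> int l"
  shows "norm (sph_coeff f l m) \<le> L2_norm f"
proof -
  have "(norm (sph_coeff f l m))\<^sup>2 \<le> (\<Sum>m\<in>{- int l..int l}. (norm (sph_coeff f l m))\<^sup>2)"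
    using assms(2) by (intro member_le_sum) auto
  also have "\<dots> \<le> (\<Sum>l\<le>l. \<Sum>m\<in>{- int l..int l}. (norm (sph_coeff f l m))\<^sup>2)"
    by (rule member_le_sum) (auto intro: sum_nonneg)
  also have "\<dots> \<le> (L2_norm f)\<^sup>2" by (rule bessel_sph_coeff[OF assms(1)])
  finally show ?thesis by (rule power2_le_imp_le) (simp add: L2_norm_def)
qed

section \<open>Covariance of the noise\<close>

context
  fixes M :: "'w measure" and F :: "real \<Rightarrow> 'w measure" and T :: real and \<beta> :: "real \<Rightarrow> 'w \<Rightarrow> real"
  assumes filtered: "complete_filtered_prob_space M F T"
    and brownian: "brownian_motion M F T \<beta>"
begin

interpretation prob_space M
  using filtered by (simp add: complete_filtered_prob_space_def)

lemma brownian_adapted: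
  assumes "t \<in> {0..T}" shows "\<beta> t \<in> borel_measurable (F t)" "\<beta> t \<in> borel_measurable M"
  using assms filtered brownian measurable_from_subalg[of M "F t" "\<beta> t" borel]
  by (auto simp: complete_filtered_prob_space_def brownian_motion_def)

lemma brownian_increment_moments:
  assumes st: "0 \<le> s" "s < t" "t \<le> T"
  shows "integrable M (\<lambda>\<omega>. \<beta> t \<omega> - \<beta> s \<omega>)" "expectation (\<lambda>\<omega>. \<beta> t \<omega> - \<beta> s \<omega>) = 0"
    "integrable M (\<lambda>\<omega>. (\<beta> t \<omega> - \<beta> s \<omega>)\<^sup>2)" "expectation (\<lambda>\<omega>. (\<beta> t \<omega> - \<beta> s \<omega>)\<^sup>2) = t - s"
proof -
  have D: "distributed M lborel (\<lambda>\<omega>. \<beta> t \<omega> - \<beta> s \<omega>) (\<lambda>x. ennreal (normal_density 0 (sqrt (t - s)) x))"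
    using brownian st by (simp add: brownian_motion_def)
  have sd: "0 < sqrt (t - s)" using st by simp
  show "integrable M (\<lambda>\<omega>. \<beta> t \<omega> - \<beta> s \<omega>)"
    using distributed_integrable[OF D, of "\<lambda>x. x"] integrable_normal_moment[OF sd, of 0 1] by simp
  show "expectation (\<lambda>\<omega>. \<beta> t \<omega> - \<beta> s \<omega>) = 0"
    by (rule normal_distributed_expectation[OF sd D])
  then show "expectation (\<lambda>\<omega>. (\<beta> t \<omega> - \<beta> s \<omega>)\<^sup>2) = t - s"
    using normal_distributed_variance[OF sd D] st by simp
  show "integrable M (\<lambda>\<omega>. (\<beta> t \<omega> - \<beta> s \<omega>)\<^sup>2)"
    using distributed_integrable[OF D, of "\<lambda>x. x\<^sup>2"] integrable_normal_moment[OF sd, of 0 2] by simp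
qed

lemma brownian_second_moment:
  assumes t: "t \<in> {0..T}"
  shows "integrable M (\<lambda>\<omega>. (\<beta> t \<omega>)\<^sup>2)" "expectation (\<lambda>\<omega>. (\<beta> t \<omega>)\<^sup>2) = t"
proof -
  have [measurable]: "\<beta> t \<in> borel_measurable M" "\<beta> 0 \<in> borel_measurable M"
    using t by (auto intro: brownian_adapted)
  have z: "AE \<omega> in M. \<beta> 0 \<omega> = 0" using brownian by (simp add: brownian_motion_def)
  have "integrable M (\<lambda>\<omega>. (\<beta> t \<omega>)\<^sup>2) \<and> expectation (\<lambda>\<omega>. (\<beta> t \<omega>)\<^sup>2) = t"
  proof (cases "t = 0")
    case True
    have "integrable M (\<lambda>\<omega>. (\<beta> t \<omega>)\<^sup>2) \<longleftrightarrow> integrable M (\<lambda>\<omega>. 0 :: real)"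
      using z by (intro integrable_cong_AE) (auto simp: True elim!: eventually_mono)
    moreover have "expectation (\<lambda>\<omega>. (\<beta> t \<omega>)\<^sup>2) = expectation (\<lambda>\<omega>. 0 :: real)"
      using z by (intro integral_cong_AE) (auto simp: True elim!: eventually_mono)
    ultimately show ?thesis using True by simp
  next
    case False
    then have "0 < t" "t \<le> T" using t by auto
    note mom = brownian_increment_moments[of 0 t, OF order_refl this]
    have "integrable M (\<lambda>\<omega>. (\<beta> t \<omega>)\<^sup>2) \<longleftrightarrow> integrable M (\<lambda>\<omega>. (\<beta> t \<omega> - \<beta> 0 \<omega>)\<^sup>2)"
      using z by (intro integrable_cong_AE) (auto elim!: eventually_mono)
    moreover have "expectation (\<lambda>\<omega>. (\<beta> t \<omega>)\<^sup>2) = expectation (\<lambda>\<omega>. (\<beta> t \<omega> - \<beta> 0 \<omega>)\<^sup>2)"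
      using z by (intro integral_cong_AE) (auto elim!: eventually_mono)
    ultimately show ?thesis using mom by simp
  qed
  then show "integrable M (\<lambda>\<omega>. (\<beta> t \<omega>)\<^sup>2)" "expectation (\<lambda>\<omega>. (\<beta> t \<omega>)\<^sup>2) = t" by auto
qed

text \<open>The past value is measurable with respect to \<open>F s\<close>, so it inherits the independence of the increment
from that \<open>\<sigma>\<close>-algebra.\<close>

lemma brownian_increment_indep:
  assumes st: "0 \<le> s" "s < t" "t \<le> T"
  shows "indep_var borel (\<beta> s) borel (\<lambda>\<omega>. \<beta> t \<omega> - \<beta> s \<omega>)"
proof -
  have F: "subalgebra M (F s)"
    using filtered st by (auto simp: complete_filtered_prob_space_def)
  have [measurable]: "\<beta> s \<in> borel_measurable M" "\<beta> t \<in> borel_measurable M"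
    using st by (auto intro: brownian_adapted)
  have "\<beta> s \<in> borel_measurable (F s)" using st by (auto intro: brownian_adapted)
  then have "sigma_sets (space M) {\<beta> s -` A \<inter> space M | A. A \<in> sets borel} \<subseteq> sets (F s)"
    using F sets.sigma_sets_subset[of "{\<beta> s -` A \<inter> space M | A. A \<in> sets borel}" "F s"]
    by (auto simp: subalgebra_def measurable_def)
  moreover have "indep_set (sets (F s)) (sets (vimage_algebra (space M) (\<lambda>\<omega>. \<beta> t \<omega> - \<beta> s \<omega>) borel))"
    using brownian st by (simp add: brownian_motion_def)
  ultimately have "indep_set (sigma_sets (space M) {\<beta> s -` A \<inter> space M | A. A \<in> sets borel})
     (sigma_sets (space M) {(\<lambda>\<omega>. \<beta> t \<omega> - \<beta> s \<omega>) -` A \<inter> space M | A. A \<in> sets borel})"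
    unfolding indep_set_def sets_vimage_algebra
    by (elim indep_sets_mono_sets) (auto split: bool.splits)
  then show ?thesis unfolding indep_var_eq by simp
qed

lemma brownian_covariance_le:
  assumes st: "0 \<le> s" "s \<le> t" "t \<le> T"
  shows "integrable M (\<lambda>\<omega>. \<beta> s \<omega> * \<beta> t \<omega>)" "expectation (\<lambda>\<omega>. \<beta> s \<omega> * \<beta> t \<omega>) = s"
proof -
  have [measurable]: "\<beta> s \<in> borel_measurable M" using st by (auto intro: brownian_adapted)
  have "s \<in> {0..T}" using st by simp
  note s2 = brownian_second_moment[OF this]
  have "integrable M (\<lambda>\<omega>. \<beta> s \<omega> * \<beta> t \<omega>) \<and> expectation (\<lambda>\<omega>. \<beta> s \<omega> * \<beta> t \<omega>) = s"
  proof (cases "s = t")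
    case True
    then show ?thesis using s2 by (simp add: power2_eq_square)
  next
    case False
    then have lt: "s < t" using st by simp
    have i: "integrable M (\<beta> s)"
      by (rule square_integrable_imp_integrable[OF _ s2(1)]) simp
    note mom = brownian_increment_moments[OF st(1) lt st(3)]
    note ind = brownian_increment_indep[OF st(1) lt st(3)]
    note prod = indep_var_integrable[OF ind i mom(1)] indep_var_lebesgue_integral[OF ind i mom(1)]
    have e: "(\<lambda>\<omega>. \<beta> s \<omega> * \<beta> t \<omega>) = (\<lambda>\<omega>. (\<beta> s \<omega>)\<^sup>2 + \<beta> s \<omega> * (\<beta> t \<omega> - \<beta> s \<omega>))"
      by (simp add: power2_eq_square right_diff_distrib)
    show ?thesis
      unfolding e Bochner_Integration.integral_add[OF s2(1) prod(1)] prod(2) mom(2) s2(2)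
      using Bochner_Integration.integrable_add[OF s2(1) prod(1)] by simp
  qed
  then show "integrable M (\<lambda>\<omega>. \<beta> s \<omega> * \<beta> t \<omega>)" "expectation (\<lambda>\<omega>. \<beta> s \<omega> * \<beta> t \<omega>) = s" by auto
qed

end

text \<open>The second-moment structure of a complex Brownian motion. With the real inner product of
\<open>\<complex>\<close>, no products of real and imaginary parts enter.\<close>

definition brownian_covariance :: "'w measure \<Rightarrow> real \<Rightarrow> real \<Rightarrow> (real \<Rightarrow> 'w \<Rightarrow> complex) \<Rightarrow> bool" where
  "brownian_covariance M T v a \<longleftrightarrow>
     (\<forall>t\<in>{0..T}. a t \<in> borel_measurable M) \<and>
     (\<forall>s\<in>{0..T}. \<forall>t\<in>{0..T}. integrable M (\<lambda>\<omega>. a s \<omega> \<bullet> a t \<omega>) \<and>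
        (\<integral>\<omega>. a s \<omega> \<bullet> a t \<omega> \<partial>M) = v * min s t)"

lemma integral_indicator_Ioc_mult:
  fixes p q p' q' :: real
  assumes "p \<le> q" "p' \<le> q'"
  shows "integrable lborel (\<lambda>u. indicator {p<..q} u * indicator {p'<..q'} u :: real)"
    and "(\<integral>u. indicator {p<..q} u * indicator {p'<..q'} u \<partial>lborel)
       = min q q' - min q p' - min p q' + min p p'"
proof -
  have e: "(\<lambda>u. indicator {p<..q} u * indicator {p'<..q'} u :: real)
      = indicator {max p p'<..min q q'}"
    by (auto simp: indicator_def)
  show "integrable lborel (\<lambda>u. indicator {p<..q} u * indicator {p'<..q'} u :: real)"
    unfolding e
    by (intro integrable_real_indicator emeasure_bounded_finite bounded_Ioc) simp
  have "(\<integral>u. indicator {p<..q} u * indicator {p'<..q'} u \<partial>lborel)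
      = measure lborel {max p p'<..min q q'}" unfolding e by simp
  also have "\<dots> = (if max p p' \<le> min q q' then min q q' - max p p' else 0)"
    by (simp del: max.bounded_iff min.bounded_iff)
  finally show "(\<integral>u. indicator {p<..q} u * indicator {p'<..q'} u \<partial>lborel)
       = min q q' - min q p' - min p q' + min p p'"
    using assms by (cases "p \<le> p'"; cases "q \<le> q'"; cases "q \<le> p'"; cases "q' \<le> p"; simp add: min_def max_def)
qed

lemma integral_double_sum:
  fixes f :: "'i \<Rightarrow> 'i \<Rightarrow> 'a \<Rightarrow> real"
  assumes "\<And>i j. i \<in> I \<Longrightarrow> j \<in> I \<Longrightarrow> integrable N (f i j)"
  shows "(\<integral>x. (\<Sum>i\<in>I. \<Sum>j\<in>I. k i j * f i j x) \<partial>N) = (\<Sum>i\<in>I. \<Sum>j\<in>I. k i j * (\<integral>x. f i j x \<partial>N))"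
proof -
  have "(\<integral>x. (\<Sum>i\<in>I. \<Sum>j\<in>I. k i j * f i j x) \<partial>N) = (\<Sum>i\<in>I. \<integral>x. (\<Sum>j\<in>I. k i j * f i j x) \<partial>N)"
    by (intro Bochner_Integration.integral_sum Bochner_Integration.integrable_sum integrable_mult_right assms)
  also have "\<dots> = (\<Sum>i\<in>I. \<Sum>j\<in>I. \<integral>x. k i j * f i j x \<partial>N)"
    by (intro sum.cong refl Bochner_Integration.integral_sum integrable_mult_right assms)
  finally show ?thesis by simp
qed

text \<open>The Ito isometry for deterministic step functions. Expanding both squares reduces it to one pair of
intervals, where the covariance \<open>min s t\<close> of the end points is the length of the
intersection. The intervals are arbitrary, since the difference of two elementary integrals over
different partitions is again of this form.\<close>

lemma increments_isometry:
  assumes cov: "brownian_covariance M T v a" and "finite I"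
    and pq: "\<And>i. i \<in> I \<Longrightarrow> 0 \<le> p i \<and> p i \<le> q i \<and> q i \<le> T"
  shows "integrable M (\<lambda>\<omega>. (norm (\<Sum>i\<in>I. of_real (c i) * (a (q i) \<omega> - a (p i) \<omega>)))\<^sup>2)"
    and "integrable lborel (\<lambda>u. (\<Sum>i\<in>I. c i * indicator {p i<..q i} u)\<^sup>2)"
    and "(\<integral>\<omega>. (norm (\<Sum>i\<in>I. of_real (c i) * (a (q i) \<omega> - a (p i) \<omega>)))\<^sup>2 \<partial>M)
       = v * (\<integral>u. (\<Sum>i\<in>I. c i * indicator {p i<..q i} u)\<^sup>2 \<partial>lborel)"
proof -
  let ?D = "\<lambda>i \<omega>. a (q i) \<omega> - a (p i) \<omega>"
  let ?J = "\<lambda>i u. indicator {p i<..q i} u :: real"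
  have E: "integrable M (\<lambda>\<omega>. a s \<omega> \<bullet> a t \<omega>)" "(\<integral>\<omega>. a s \<omega> \<bullet> a t \<omega> \<partial>M) = v * min s t"
    if "s \<in> {0..T}" "t \<in> {0..T}" for s t
    using cov that by (auto simp: brownian_covariance_def)
  have mem: "p i \<in> {0..T}" "q i \<in> {0..T}" if "i \<in> I" for i using pq[OF that] by auto
  have D: "integrable M (\<lambda>\<omega>. ?D i \<omega> \<bullet> ?D j \<omega>)"
      "(\<integral>\<omega>. ?D i \<omega> \<bullet> ?D j \<omega> \<partial>M) = v * (\<integral>u. ?J i u * ?J j u \<partial>lborel)"
    if ij: "i \<in> I" "j \<in> I" for i j
  proof -
    have e: "(\<lambda>\<omega>. ?D i \<omega> \<bullet> ?D j \<omega>) = (\<lambda>\<omega>. a (q i) \<omega> \<bullet> a (q j) \<omega> - a (q i) \<omega> \<bullet> a (p j) \<omega>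
        - a (p i) \<omega> \<bullet> a (q j) \<omega> + a (p i) \<omega> \<bullet> a (p j) \<omega>)"
      by (simp add: inner_diff_left inner_diff_right algebra_simps)
    show "integrable M (\<lambda>\<omega>. ?D i \<omega> \<bullet> ?D j \<omega>)"
      unfolding e using mem ij by (intro Bochner_Integration.integrable_add Bochner_Integration.integrable_diff E) auto
    show "(\<integral>\<omega>. ?D i \<omega> \<bullet> ?D j \<omega> \<partial>M) = v * (\<integral>u. ?J i u * ?J j u \<partial>lborel)"
    proof -
      have "(\<integral>\<omega>. ?D i \<omega> \<bullet> ?D j \<omega> \<partial>M)
          = v * min (q i) (q j) - v * min (q i) (p j) - v * min (p i) (q j) + v * min (p i) (p j)"
        unfolding e E(2)[OF mem(2)[OF ij(1)] mem(2)[OF ij(2)], symmetric]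
          E(2)[OF mem(2)[OF ij(1)] mem(1)[OF ij(2)], symmetric]
          E(2)[OF mem(1)[OF ij(1)] mem(2)[OF ij(2)], symmetric]
          E(2)[OF mem(1)[OF ij(1)] mem(1)[OF ij(2)], symmetric]
        using E(1)[OF mem(2)[OF ij(1)] mem(2)[OF ij(2)]]
          E(1)[OF mem(2)[OF ij(1)] mem(1)[OF ij(2)]]
          E(1)[OF mem(1)[OF ij(1)] mem(2)[OF ij(2)]]
          E(1)[OF mem(1)[OF ij(1)] mem(1)[OF ij(2)]] by simp
      also have "\<dots> = v * (min (q i) (q j) - min (q i) (p j) - min (p i) (q j) + min (p i) (p j))"
        by (simp only: right_diff_distrib distrib_left)
      finally show ?thesis
        using pq[OF ij(1)] pq[OF ij(2)] by (simp only: integral_indicator_Ioc_mult(2))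
    qed
  qed
  have l: "(norm (\<Sum>i\<in>I. of_real (c i) * ?D i \<omega>))\<^sup>2 = (\<Sum>i\<in>I. \<Sum>j\<in>I. c i * c j * (?D i \<omega> \<bullet> ?D j \<omega>))" for \<omega>
    unfolding power2_norm_eq_inner inner_sum_left inner_sum_right
    by (simp add: scaleR_conv_of_real[symmetric] mult.assoc mult.left_commute inner_commute)
  have r: "(\<Sum>i\<in>I. c i * ?J i u)\<^sup>2 = (\<Sum>i\<in>I. \<Sum>j\<in>I. c i * c j * (?J i u * ?J j u))" for u
    unfolding power2_eq_square sum_product by (simp add: mult_ac)
  have J: "integrable lborel (\<lambda>u. ?J i u * ?J j u)" if "i \<in> I" "j \<in> I" for i j
    using pq that by (intro integral_indicator_Ioc_mult(1)) auto
  show "integrable M (\<lambda>\<omega>. (norm (\<Sum>i\<in>I. of_real (c i) * ?D i \<omega>))\<^sup>2)"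
    unfolding l by (intro Bochner_Integration.integrable_sum integrable_mult_right D)
  show "integrable lborel (\<lambda>u. (\<Sum>i\<in>I. c i * ?J i u)\<^sup>2)"
    unfolding r by (intro Bochner_Integration.integrable_sum integrable_mult_right J)
  have "(\<integral>\<omega>. (norm (\<Sum>i\<in>I. of_real (c i) * ?D i \<omega>))\<^sup>2 \<partial>M)
      = (\<Sum>i\<in>I. \<Sum>j\<in>I. c i * c j * (\<integral>\<omega>. ?D i \<omega> \<bullet> ?D j \<omega> \<partial>M))"
    unfolding l by (rule integral_double_sum) (rule D(1))
  also have "\<dots> = v * (\<Sum>i\<in>I. \<Sum>j\<in>I. c i * c j * (\<integral>u. ?J i u * ?J j u \<partial>lborel))"
    by (simp add: D(2) sum_distrib_left mult_ac)
  also have "(\<Sum>i\<in>I. \<Sum>j\<in>I. c i * c j * (\<integral>u. ?J i u * ?J j u \<partial>lborel))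
      = (\<integral>u. (\<Sum>i\<in>I. c i * ?J i u)\<^sup>2 \<partial>lborel)"
    unfolding r by (rule integral_double_sum[symmetric]) (rule J)
  finally show "(\<integral>\<omega>. (norm (\<Sum>i\<in>I. of_real (c i) * ?D i \<omega>))\<^sup>2 \<partial>M)
       = v * (\<integral>u. (\<Sum>i\<in>I. c i * ?J i u)\<^sup>2 \<partial>lborel)" .
qed

text \<open>For \<open>m \<noteq> 0\<close> the real and the imaginary part contribute \<open>A l / 2\<close> each, and passing to \<open>-m\<close>
amounts to a conjugation and a sign, which preserve the inner product.\<close>

lemma noise_coeff_covariance:
  assumes filtered: "complete_filtered_prob_space M F T" and A: "0 \<le> A l"
    and b1: "\<And>m. m \<le> l \<Longrightarrow> brownian_motion M F T (\<beta>1 l m)"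
    and b2: "\<And>m. 1 \<le> m \<Longrightarrow> m \<le> l \<Longrightarrow> brownian_motion M F T (\<beta>2 l m)"
    and m: "\<bar>m\<bar> \<le> int l"
  shows "brownian_covariance M T (A l) (noise_coeff A \<beta>1 \<beta>2 l m)"
proof -
  have cov: "integrable M (\<lambda>\<omega>. \<beta> s \<omega> * \<beta> t \<omega>) \<and> (\<integral>\<omega>. \<beta> s \<omega> * \<beta> t \<omega> \<partial>M) = min s t"
    if b: "brownian_motion M F T \<beta>" and st: "s \<in> {0..T}" "t \<in> {0..T}" for \<beta> s t
    using brownian_covariance_le[OF filtered b, of s t] brownian_covariance_le[OF filtered b, of t s] st
    by (cases "s \<le> t") (auto simp: mult.commute min_def)
  have nonneg: "brownian_covariance M T (A l) (noise_coeff_nonneg A \<beta>1 \<beta>2 l k)" if k: "k \<le> l" for k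
  proof (cases "k = 0")
    case True
    have e: "noise_coeff_nonneg A \<beta>1 \<beta>2 l k s \<omega> \<bullet> noise_coeff_nonneg A \<beta>1 \<beta>2 l k t \<omega>
        = A l * (\<beta>1 l 0 s \<omega> * \<beta>1 l 0 t \<omega>)" for s t \<omega>
    proof -
      have "sqrt (A l) * sqrt (A l) = A l" using A by simp
      moreover have "noise_coeff_nonneg A \<beta>1 \<beta>2 l k s \<omega> \<bullet> noise_coeff_nonneg A \<beta>1 \<beta>2 l k t \<omega>
        = (sqrt (A l) * sqrt (A l)) * (\<beta>1 l 0 s \<omega> * \<beta>1 l 0 t \<omega>)"
        using True unfolding noise_coeff_nonneg_def inner_complex_def
        by (simp del: real_sqrt_mult_self add: mult_ac)
      ultimately show ?thesis by metis
    qed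
    have [measurable]: "\<beta>1 l 0 t \<in> borel_measurable M" if "t \<in> {0..T}" for t
      using brownian_adapted(2)[OF filtered b1 that] by simp
    show ?thesis
      unfolding brownian_covariance_def e
      using cov[OF b1] by (auto simp: noise_coeff_nonneg_def[abs_def] True)
  next
    case False
    have e: "noise_coeff_nonneg A \<beta>1 \<beta>2 l k s \<omega> \<bullet> noise_coeff_nonneg A \<beta>1 \<beta>2 l k t \<omega>
        = A l / 2 * (\<beta>1 l k s \<omega> * \<beta>1 l k t \<omega>) + A l / 2 * (\<beta>2 l k s \<omega> * \<beta>2 l k t \<omega>)" for s t \<omega>
    proof -
      have "sqrt (A l / 2) * sqrt (A l / 2) = A l / 2" using A by simp
      moreover have "noise_coeff_nonneg A \<beta>1 \<beta>2 l k s \<omega> \<bullet> noise_coeff_nonneg A \<beta>1 \<beta>2 l k t \<omega>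
        = (sqrt (A l / 2) * sqrt (A l / 2)) * (\<beta>1 l k s \<omega> * \<beta>1 l k t \<omega>)
          + (sqrt (A l / 2) * sqrt (A l / 2)) * (\<beta>2 l k s \<omega> * \<beta>2 l k t \<omega>)"
        using False unfolding noise_coeff_nonneg_def inner_complex_def
        by (simp del: real_sqrt_mult_self real_sqrt_divide add: mult_ac)
      ultimately show ?thesis by metis
    qed
    have b2': "brownian_motion M F T (\<beta>2 l k)" using b2[of k] False k by simp
    have meas: "noise_coeff_nonneg A \<beta>1 \<beta>2 l k t \<in> borel_measurable M" if "t \<in> {0..T}" for t
    proof -
      have [measurable]: "\<beta>1 l k t \<in> borel_measurable M" "\<beta>2 l k t \<in> borel_measurable M"
        using brownian_adapted(2)[OF filtered b1[OF k] that] brownian_adapted(2)[OF filtered b2' that] by auto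
      have "noise_coeff_nonneg A \<beta>1 \<beta>2 l k t
        = (\<lambda>\<omega>. of_real (sqrt (A l / 2)) * (of_real (\<beta>1 l k t \<omega>) + \<i> * of_real (\<beta>2 l k t \<omega>)))"
        using False by (auto simp: noise_coeff_nonneg_def complex_eq_iff)
      then show ?thesis by simp
    qed
    show ?thesis
      unfolding brownian_covariance_def e
      using cov[OF b1[OF k]] cov[OF b2'] meas by (auto simp: field_simps)
  qed
  show ?thesis
  proof (cases "0 \<le> m")
    case True
    then show ?thesis using nonneg[of "nat m"] m by (simp add: noise_coeff_def[abs_def])
  next
    case False
    define k where "k = nat (- m)"
    have inner: "((-1) ^ k * cnj z) \<bullet> ((-1) ^ k * cnj w) = z \<bullet> w" for z w
      by (cases "even k") (auto simp: inner_complex_def)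
    have cnj: "(\<lambda>\<omega>. (-1) ^ k * cnj (f \<omega>)) \<in> borel_measurable M" if "f \<in> borel_measurable M" for f :: "_ \<Rightarrow> complex"
      using that by (intro borel_measurable_times borel_measurable_const borel_measurable_cnj)
    have "noise_coeff A \<beta>1 \<beta>2 l m = (\<lambda>t \<omega>. (-1) ^ k * cnj (noise_coeff_nonneg A \<beta>1 \<beta>2 l k t \<omega>))"
      using False by (auto simp: noise_coeff_def k_def fun_eq_iff)
    moreover have "k \<le> l" using m by (simp add: k_def)
    ultimately show ?thesis
      using nonneg[of k] by (auto simp: brownian_covariance_def inner cnj)
  qed
qed

section \<open>The Wiener integral\<close>

lemma norm_add_power2_le: "(norm (x + y))\<^sup>2 \<le> 2 * (norm x)\<^sup>2 + 2 * (norm (y::'a::real_normed_vector))\<^sup>2"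
proof -
  have "(norm (x + y))\<^sup>2 \<le> (norm x + norm y)\<^sup>2" by (intro power_mono norm_triangle_ineq) simp
  then show ?thesis using sum_squares_bound[of "norm x" "norm y"] by (simp add: power2_sum)
qed

lemma nn_integral_square_diff_le:
  fixes f g h :: "'a \<Rightarrow> 'b::{real_normed_vector, second_countable_topology}"
  assumes [measurable]: "f \<in> borel_measurable N" "g \<in> borel_measurable N" "h \<in> borel_measurable N"
    "A \<in> sets N"
  shows "(\<integral>\<^sup>+x\<in>A. ennreal ((norm (f x - g x))\<^sup>2) \<partial>N)
    \<le> 2 * (\<integral>\<^sup>+x\<in>A. ennreal ((norm (f x - h x))\<^sup>2) \<partial>N) + 2 * (\<integral>\<^sup>+x\<in>A. ennreal ((norm (g x - h x))\<^sup>2) \<partial>N)"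
proof -
  have "ennreal ((norm (f x - g x))\<^sup>2) * indicator A x
    \<le> 2 * (ennreal ((norm (f x - h x))\<^sup>2) * indicator A x) + 2 * (ennreal ((norm (g x - h x))\<^sup>2) * indicator A x)" for x
  proof -
    have e: "2 * ennreal y + 2 * ennreal z = ennreal (2 * y + 2 * z)" if "0 \<le> y" "0 \<le> z" for y z
      using that by (simp add: ennreal_plus ennreal_mult')
    then show ?thesis
      using norm_add_power2_le[of "f x - h x" "h x - g x"]
      by (cases "x \<in> A") (simp_all add: e norm_minus_commute ennreal_leI del: ennreal_plus)
  qed
  then have "(\<integral>\<^sup>+x\<in>A. ennreal ((norm (f x - g x))\<^sup>2) \<partial>N)
    \<le> (\<integral>\<^sup>+x. 2 * (ennreal ((norm (f x - h x))\<^sup>2) * indicator A x)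
         + 2 * (ennreal ((norm (g x - h x))\<^sup>2) * indicator A x) \<partial>N)"
    by (intro nn_integral_mono)
  also have "\<dots> = 2 * (\<integral>\<^sup>+x\<in>A. ennreal ((norm (f x - h x))\<^sup>2) \<partial>N) + 2 * (\<integral>\<^sup>+x\<in>A. ennreal ((norm (g x - h x))\<^sup>2) \<partial>N)"
    by (subst nn_integral_add, measurable) (simp add: nn_integral_cmult)
  finally show ?thesis .
qed

abbreviation partition_of :: "nat \<Rightarrow> (nat \<Rightarrow> real) \<Rightarrow> real \<Rightarrow> bool" where
  "partition_of N s t \<equiv> mono_on {..N} s \<and> s 0 = 0 \<and> s N = t"

lemma partition_bounds:
  assumes "partition_of N s t" "i < N"
  shows "0 \<le> s i" "s i \<le> s (Suc i)" "s (Suc i) \<le> t"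
  using assms mono_onD[of "{..N}" s 0 i] mono_onD[of "{..N}" s i "Suc i"] mono_onD[of "{..N}" s "Suc i" N]
  by auto

lemma borel_measurable_step_fun [measurable]: "step_fun N s c \<in> borel_measurable borel"
  unfolding step_fun_def by measurable

lemma step_fun_outside:
  assumes "partition_of N s t" "u \<notin> {0..t}" shows "step_fun N s c u = 0"
  unfolding step_fun_def
proof (intro sum.neutral ballI)
  fix i assume "i \<in> {..<N}"
  then show "c i * indicator {s i<..s (Suc i)} u = 0"
    using partition_bounds[OF assms(1), of i] assms(2) by (auto simp: indicator_def)
qed

lemma borel_measurable_step_integral:
  assumes cov: "brownian_covariance M T v a" and "partition_of N s t" "t \<le> T"
  shows "step_integral N s c a \<in> borel_measurable M"
proof -
  have "a (s i) \<in> borel_measurable M" "a (s (Suc i)) \<in> borel_measurable M" if "i < N" for i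
    using cov partition_bounds[OF assms(2) that] assms(3) by (auto simp: brownian_covariance_def)
  then show ?thesis
    unfolding step_integral_def[abs_def]
    by (intro borel_measurable_sum borel_measurable_times borel_measurable_diff borel_measurable_const) auto
qed

lemma step_integral_isometry:
  assumes cov: "brownian_covariance M T v a" and v: "0 \<le> v" and t: "t \<le> T"
    and s: "partition_of N s t" and s': "partition_of N' s' t"
  shows "(\<integral>\<^sup>+\<omega>. ennreal ((norm (step_integral N s c a \<omega> - step_integral N' s' c' a \<omega>))\<^sup>2) \<partial>M)
     = ennreal v * (\<integral>\<^sup>+u\<in>{0..t}. ennreal ((norm (step_fun N s c u - step_fun N' s' c' u))\<^sup>2) \<partial>lborel)"
proof -
  \<comment> \<open>The difference as a single family of weighted intervals.\<close>
  let ?I = "{..<N} <+> {..<N'}"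
  define k where "k = case_sum c (\<lambda>j. - c' j)"
  define p where "p = case_sum s s'"
  define q where "q = case_sum (\<lambda>i. s (Suc i)) (\<lambda>i. s' (Suc i))"
  have pq: "0 \<le> p i \<and> p i \<le> q i \<and> q i \<le> T" if "i \<in> ?I" for i
    using that partition_bounds[OF s] partition_bounds[OF s'] t by (force simp: p_def q_def)
  have fin: "finite ?I" by simp
  have S: "step_integral N s c a \<omega> - step_integral N' s' c' a \<omega>
      = (\<Sum>i\<in>?I. of_real (k i) * (a (q i) \<omega> - a (p i) \<omega>))" for \<omega>
    unfolding step_integral_def k_def p_def q_def
    by (subst sum.Plus) (simp_all only: o_def sum.case finite_lessThan of_real_minus mult_minus_left sum_negf diff_conv_add_uminus)
  have J: "step_fun N s c u - step_fun N' s' c' u = (\<Sum>i\<in>?I. k i * indicator {p i<..q i} u)" for u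
    unfolding step_fun_def k_def p_def q_def
    by (subst sum.Plus) (simp_all only: o_def sum.case finite_lessThan mult_minus_left sum_negf diff_conv_add_uminus)
  note iso = increments_isometry[where c = k and p = p and q = q, OF cov fin pq]
  have "(\<integral>\<^sup>+\<omega>. ennreal ((norm (step_integral N s c a \<omega> - step_integral N' s' c' a \<omega>))\<^sup>2) \<partial>M)
     = ennreal (\<integral>\<omega>. (norm (\<Sum>i\<in>?I. of_real (k i) * (a (q i) \<omega> - a (p i) \<omega>)))\<^sup>2 \<partial>M)"
    unfolding S by (rule nn_integral_eq_integral[OF iso(1)]) auto
  also have "\<dots> = ennreal (v * (\<integral>u. (step_fun N s c u - step_fun N' s' c' u)\<^sup>2 \<partial>lborel))"
    unfolding J by (rule arg_cong[OF iso(3)])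
  also have "\<dots> = ennreal v * (\<integral>\<^sup>+u. ennreal ((step_fun N s c u - step_fun N' s' c' u)\<^sup>2) \<partial>lborel)"
    unfolding J using v by (subst nn_integral_eq_integral[OF iso(2)]) (auto simp: ennreal_mult' integral_nonneg_AE)
  also have "(\<integral>\<^sup>+u. ennreal ((step_fun N s c u - step_fun N' s' c' u)\<^sup>2) \<partial>lborel)
     = (\<integral>\<^sup>+u\<in>{0..t}. ennreal ((norm (step_fun N s c u - step_fun N' s' c' u))\<^sup>2) \<partial>lborel)"
    using step_fun_outside[OF s] step_fun_outside[OF s']
    by (intro nn_integral_cong) (auto simp: indicator_def)
  finally show ?thesis .
qed

text \<open>Insert an elementary integral \<open>S n\<close> from the approximating sequence of \<open>I\<close> between \<open>I\<close> and the given
elementary integral, apply the isometry to the difference of the two elementary integrals, and let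
\<open>n\<close> tend to infinity. Using \<open>(a + b)\<^sup>2 \<le> 2 a\<^sup>2 + 2 b\<^sup>2\<close> twice costs the factor 4. The estimate holds for
every \<open>I\<close> that satisfies the definition, hence for the one selected by \<open>stoch_integral\<close>.\<close>

lemma stoch_integral_error:
  assumes cov: "brownian_covariance M T v a" and v: "0 \<le> v" and t: "t \<le> T"
    and I: "has_stoch_integral M t f a I" and f[measurable]: "f \<in> borel_measurable borel"
    and r: "partition_of N' r t"
  shows "(\<integral>\<^sup>+\<omega>. ennreal ((norm (I \<omega> - step_integral N' r d a \<omega>))\<^sup>2) \<partial>M)
    \<le> ennreal (4 * v) * (\<integral>\<^sup>+u\<in>{0..t}. ennreal ((f u - step_fun N' r d u)\<^sup>2) \<partial>lborel)"
proof -
  obtain N s c where Im[measurable]: "I \<in> borel_measurable M"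
    and s: "\<And>n. partition_of (N n) (s n) t"
    and f_lim: "(\<lambda>n. \<integral>\<^sup>+u\<in>{0..t}. ennreal ((step_fun (N n) (s n) (c n) u - f u)\<^sup>2) \<partial>lborel) \<longlonglongrightarrow> 0"
    and I_lim: "(\<lambda>n. \<integral>\<^sup>+\<omega>. ennreal ((norm (step_integral (N n) (s n) (c n) a \<omega> - I \<omega>))\<^sup>2) \<partial>M) \<longlonglongrightarrow> 0"
    using I unfolding has_stoch_integral_def by blast
  let ?S = "\<lambda>n. step_integral (N n) (s n) (c n) a" and ?J = "step_integral N' r d a"
  let ?\<phi> = "\<lambda>n. step_fun (N n) (s n) (c n)" and ?\<psi> = "step_fun N' r d"
  have [measurable]: "?S n \<in> borel_measurable M" "?J \<in> borel_measurable M" for n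
    by (rule borel_measurable_step_integral[OF cov s t]) (rule borel_measurable_step_integral[OF cov r t])
  let ?E = "\<integral>\<^sup>+\<omega>. ennreal ((norm (I \<omega> - ?J \<omega>))\<^sup>2) \<partial>M"
  let ?D = "\<integral>\<^sup>+u\<in>{0..t}. ennreal ((f u - ?\<psi> u)\<^sup>2) \<partial>lborel"
  let ?e = "\<lambda>n. \<integral>\<^sup>+\<omega>. ennreal ((norm (?S n \<omega> - I \<omega>))\<^sup>2) \<partial>M"
  let ?d = "\<lambda>n. \<integral>\<^sup>+u\<in>{0..t}. ennreal ((?\<phi> n u - f u)\<^sup>2) \<partial>lborel"
  have "?E \<le> 2 * ?e n + 2 * (ennreal v * (2 * ?d n + 2 * ?D))" for n
  proof -
    have "?E \<le> 2 * (\<integral>\<^sup>+\<omega>. ennreal ((norm (I \<omega> - ?S n \<omega>))\<^sup>2) \<partial>M)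
        + 2 * (\<integral>\<^sup>+\<omega>. ennreal ((norm (?S n \<omega> - ?J \<omega>))\<^sup>2) \<partial>M)"
      using nn_integral_square_diff_le[of I M ?J "?S n" "space M"]
      by (simp add: norm_minus_commute[of _ "?J _"] nn_set_integral_space)
    moreover have "(\<integral>\<^sup>+\<omega>. ennreal ((norm (?S n \<omega> - ?J \<omega>))\<^sup>2) \<partial>M)
        = ennreal v * (\<integral>\<^sup>+u\<in>{0..t}. ennreal ((norm (?\<phi> n u - ?\<psi> u))\<^sup>2) \<partial>lborel)"
      by (rule step_integral_isometry[OF cov v t s r])
    moreover have "(\<integral>\<^sup>+u\<in>{0..t}. ennreal ((norm (?\<phi> n u - ?\<psi> u))\<^sup>2) \<partial>lborel) \<le> 2 * ?d n + 2 * ?D"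
      using nn_integral_square_diff_le[of "?\<phi> n" lborel ?\<psi> f "{0..t}"]
      by (simp add: power2_commute[of "?\<psi> _"])
    moreover have "(\<integral>\<^sup>+\<omega>. ennreal ((norm (I \<omega> - ?S n \<omega>))\<^sup>2) \<partial>M) = ?e n"
      by (simp only: norm_minus_commute)
    ultimately show ?thesis
      by (auto elim!: order.trans intro!: add_left_mono mult_left_mono)
  qed
  moreover have "(\<lambda>n. 2 * ?e n + 2 * (ennreal v * (2 * ?d n + 2 * ?D)))
      \<longlonglongrightarrow> 2 * 0 + 2 * (ennreal v * (2 * 0 + 2 * ?D))"
    by (intro tendsto_add ennreal_tendsto_cmult tendsto_const f_lim I_lim) auto
  ultimately have "?E \<le> 2 * 0 + 2 * (ennreal v * (2 * 0 + 2 * ?D))"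
    by (intro LIMSEQ_le_const) auto
  also have "\<dots> = ennreal (4 * v) * ?D"
  proof -
    have "ennreal (4 * v) = ennreal (2 * (v * 2))" by (simp add: mult.commute)
    also have "\<dots> = ennreal 2 * (ennreal v * ennreal 2)"
      using v by (simp only: ennreal_mult' zero_le_numeral)
    finally show ?thesis by (simp add: mult.assoc)
  qed
  finally show ?thesis .
qed

text \<open>Completeness of \<open>L\<^sup>2\<close> along a geometrically Cauchy sequence. The increments are absolutely summable
almost surely because their expectations are summable, so the sequence converges almost surely, and
Fatou's lemma turns this into convergence in the mean square.\<close>

lemma (in prob_space) L2_geometric_Cauchy_limit:
  fixes S :: "nat \<Rightarrow> 'a \<Rightarrow> complex"
  assumes S[measurable]: "\<And>n. S n \<in> borel_measurable M" and K: "0 \<le> K"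
    and cauchy: "\<And>n m. n \<le> m \<Longrightarrow> (\<integral>\<^sup>+\<omega>. ennreal ((norm (S n \<omega> - S m \<omega>))\<^sup>2) \<partial>M) \<le> ennreal (K * (1/4) ^ n)"
  obtains I where "I \<in> borel_measurable M"
    "\<And>n. (\<integral>\<^sup>+\<omega>. ennreal ((norm (S n \<omega> - I \<omega>))\<^sup>2) \<partial>M) \<le> ennreal (K * (1/4) ^ n)"
proof -
  define I where "I \<omega> = lim (\<lambda>n. S n \<omega>)" for \<omega>
  have [measurable]: "I \<in> borel_measurable M" unfolding I_def[abs_def] by measurable
  let ?d = "\<lambda>n \<omega>. norm (S n \<omega> - S (Suc n) \<omega>)"
  have "(\<integral>\<^sup>+\<omega>. ennreal (?d n \<omega>) \<partial>M) \<le> ennreal ((1 + K) * (1/2) ^ n)" for n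
  proof -
    \<comment> \<open>The weights balance the two terms: \<open>2 ^ n * (1/4) ^ n = (1/2) ^ n\<close>.\<close>
    have amgm: "?d n \<omega> \<le> (1/2) ^ n + 2 ^ n * (?d n \<omega>)\<^sup>2" for \<omega>
    proof -
      have pos: "0 < (2::real) ^ n" by simp
      have "y \<le> 1 + y\<^sup>2" for y :: real
      proof -
        have "2 * y \<le> y\<^sup>2 + 1" using sum_squares_bound[of y 1] by simp
        then show ?thesis using zero_le_power2[of y] by linarith
      qed
      then have "2 ^ n * ?d n \<omega> \<le> 1 + (2 ^ n * ?d n \<omega>)\<^sup>2" .
      also have "\<dots> = 2 ^ n * ((1/2) ^ n + 2 ^ n * (?d n \<omega>)\<^sup>2)"
        by (simp add: distrib_left power_one_over power2_eq_square mult_ac)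
      finally show ?thesis using pos by (simp only: mult_le_cancel_left_pos)
    qed
    have "(\<integral>\<^sup>+\<omega>. ennreal (?d n \<omega>) \<partial>M)
        \<le> (\<integral>\<^sup>+\<omega>. ennreal ((1/2) ^ n) + ennreal (2 ^ n) * ennreal ((?d n \<omega>)\<^sup>2) \<partial>M)"
      using amgm by (intro nn_integral_mono) (simp add: ennreal_leI flip: ennreal_mult' ennreal_plus)
    also have "\<dots> = ennreal ((1/2) ^ n) + ennreal (2 ^ n) * (\<integral>\<^sup>+\<omega>. ennreal ((?d n \<omega>)\<^sup>2) \<partial>M)"
      by (subst nn_integral_add) (auto simp: nn_integral_cmult emeasure_space_1)
    also have "\<dots> \<le> ennreal ((1/2) ^ n) + ennreal (2 ^ n) * ennreal (K * (1/4) ^ n)"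
      using cauchy[of n "Suc n"] by (intro add_left_mono mult_left_mono) auto
    also have "\<dots> = ennreal ((1/2) ^ n + 2 ^ n * (K * (1/4) ^ n))"
      using K by (simp add: ennreal_mult' ennreal_plus)
    also have "(1/2) ^ n + 2 ^ n * (K * (1/4) ^ n) = (1 + K) * (1/2) ^ n"
      by (simp add: algebra_simps flip: power_mult_distrib)
    finally show ?thesis .
  qed
  then have "(\<integral>\<^sup>+\<omega>. (\<Sum>n. ennreal (?d n \<omega>)) \<partial>M) \<le> (\<Sum>n. ennreal ((1 + K) * (1/2) ^ n))"
    by (subst nn_integral_suminf) (auto intro!: suminf_le)
  also have "\<dots> = ennreal (\<Sum>n. (1 + K) * (1/2) ^ n)"
    using K by (intro suminf_ennreal2) (auto intro!: summable_mult summable_geometric)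
  finally have "(\<integral>\<^sup>+\<omega>. (\<Sum>n. ennreal (?d n \<omega>)) \<partial>M) \<noteq> \<infinity>"
    by (metis ennreal_less_top infinity_ennreal_def leD)
  then have "AE \<omega> in M. (\<Sum>n. ennreal (?d n \<omega>)) \<noteq> \<infinity>"
    by (intro nn_integral_noteq_infinite) auto
  then have lim: "AE \<omega> in M. (\<lambda>n. S n \<omega>) \<longlonglongrightarrow> I \<omega>"
  proof eventually_elim
    case (elim \<omega>)
    then have "summable (\<lambda>n. ?d n \<omega>)"
      by (intro summable_suminf_not_top) auto
    then have "summable (\<lambda>n. S (Suc n) \<omega> - S n \<omega>)"
      by (intro summable_norm_cancel[of "\<lambda>n. S (Suc n) \<omega> - S n \<omega>"]) (simp add: norm_minus_commute)
    then have "(\<lambda>n. \<Sum>i<n. S (Suc i) \<omega> - S i \<omega>) \<longlonglongrightarrow> (\<Sum>i. S (Suc i) \<omega> - S i \<omega>)"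
      by (rule summable_LIMSEQ)
    then have "(\<lambda>n. (S n \<omega> - S 0 \<omega>) + S 0 \<omega>) \<longlonglongrightarrow> (\<Sum>i. S (Suc i) \<omega> - S i \<omega>) + S 0 \<omega>"
      unfolding sum_lessThan_telescope[of "\<lambda>i. S i \<omega>"] by (rule tendsto_add[OF _ tendsto_const])
    then have "convergent (\<lambda>n. S n \<omega>)" by (auto simp: convergent_def)
    then show ?case by (simp add: I_def convergent_LIMSEQ_iff)
  qed
  have "(\<integral>\<^sup>+\<omega>. ennreal ((norm (S n \<omega> - I \<omega>))\<^sup>2) \<partial>M) \<le> ennreal (K * (1/4) ^ n)" for n
  proof -
    have "(\<integral>\<^sup>+\<omega>. ennreal ((norm (S n \<omega> - I \<omega>))\<^sup>2) \<partial>M)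
        = (\<integral>\<^sup>+\<omega>. liminf (\<lambda>m. ennreal ((norm (S n \<omega> - S m \<omega>))\<^sup>2)) \<partial>M)"
      using lim
    proof (intro nn_integral_cong_AE, eventually_elim)
      case (elim \<omega>)
      then have "(\<lambda>m. ennreal ((norm (S n \<omega> - S m \<omega>))\<^sup>2)) \<longlonglongrightarrow> ennreal ((norm (S n \<omega> - I \<omega>))\<^sup>2)"
        by (intro tendsto_ennrealI tendsto_intros)
      from lim_imp_Liminf[OF trivial_limit_sequentially this] show ?case by simp
    qed
    also have "\<dots> \<le> liminf (\<lambda>m. \<integral>\<^sup>+\<omega>. ennreal ((norm (S n \<omega> - S m \<omega>))\<^sup>2) \<partial>M)"
      by (rule nn_integral_liminf) measurable
    also have "\<dots> \<le> ennreal (K * (1/4) ^ n)"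
      using cauchy[of n] by (intro Liminf_le) (auto simp: eventually_sequentially)
    finally show ?thesis .
  qed
  then show ?thesis using that \<open>I \<in> borel_measurable M\<close> by blast
qed

lemma uniform_partition: "0 \<le> d \<Longrightarrow> t = real N * d \<Longrightarrow> partition_of N (\<lambda>i. real i * d) t"
  by (auto intro!: mono_onI mult_right_mono)

lemma step_fun_uniform:
  assumes "j < N" "u \<in> {real j * d<..real (Suc j) * d}"
  shows "step_fun N (\<lambda>i. real i * d) c u = c j"
proof -
  have d: "0 < d"
  proof -
    have "real j * d < real (Suc j) * d" using assms(2) by auto
    then show ?thesis by (simp add: algebra_simps)
  qed
  have "c i * indicator {real i * d<..real (Suc i) * d} u = (if i = j then c j else 0)" for i
  proof -
    consider "i = j" | "Suc i \<le> j" | "Suc j \<le> i" by linarith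
    then show ?thesis
    proof cases
      case 2
      then have "real (Suc i) * d \<le> real j * d" using d by (intro mult_right_mono) auto
      then show ?thesis using assms 2 by auto
    next
      case 3
      then have "real (Suc j) * d \<le> real i * d" using d by (intro mult_right_mono) auto
      then show ?thesis using assms 3 by auto
    qed (use assms in auto)
  qed
  then show ?thesis using assms(1) unfolding step_fun_def by (simp only: sum.delta finite_lessThan lessThan_iff if_True)
qed

lemma uniform_partition_cell:
  assumes "0 \<le> d" "u \<in> {0<..real N * d}"
  obtains j where "j < N" "u \<in> {real j * d<..real (Suc j) * d}"
proof -
  have d: "0 < d" using assms by (cases "d = 0") auto
  define j where "j = nat (\<lceil>u / d\<rceil> - 1)"
  have "0 < u / d" "u / d \<le> real N" using assms d by (auto simp: field_simps)
  then have c: "1 \<le> \<lceil>u / d\<rceil>" "\<lceil>u / d\<rceil> \<le> int N" by (auto simp: ceiling_le_iff le_ceiling_iff)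
  have "int j = \<lceil>u / d\<rceil> - 1" unfolding j_def by (rule nat_0_le) (use c in linarith)
  then have j: "real j = of_int \<lceil>u / d\<rceil> - 1" "j < N" using c(2) by linarith+
  then have "real j < u / d" "u / d \<le> real (Suc j)" using ceiling_correct[of "u / d"] by auto
  then have "u \<in> {real j * d<..real (Suc j) * d}" using d by (auto simp: field_simps)
  then show ?thesis using that j by blast
qed

text \<open>Sampling a Lipschitz integrand on the dyadic partitions with \<open>2 ^ n\<close> cells gives step functions at
\<open>L\<^sup>2\<close>-distance \<open>O(2 ^ -n)\<close> from \<open>f\<close>. By the isometry the elementary integrals are then
geometrically Cauchy.\<close>

lemma has_stoch_integral_exists:
  assumes "prob_space M" and cov: "brownian_covariance M T v a" and v: "0 \<le> v" and t: "0 \<le> t" "t \<le> T"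
    and f[measurable]: "f \<in> borel_measurable borel" and L: "0 \<le> L"
    and lip: "\<And>u w. u \<in> {0..t} \<Longrightarrow> w \<in> {0..t} \<Longrightarrow> \<bar>f u - f w\<bar> \<le> L * \<bar>u - w\<bar>"
  obtains I where "has_stoch_integral M t f a I"
proof -
  interpret prob_space M by fact
  define N where "N n = (2::nat) ^ n" for n
  define s where "s n i = real i * (t / 2 ^ n)" for n i
  define c where "c n i = f (s n i)" for n i
  let ?S = "\<lambda>n. step_integral (N n) (s n) (c n) a" and ?\<phi> = "\<lambda>n. step_fun (N n) (s n) (c n)"
  have s: "partition_of (N n) (s n) t" for n
    unfolding s_def N_def using t by (intro uniform_partition) auto
  define K where "K = (L * t)\<^sup>2 * t"
  have K: "0 \<le> K" using t by (simp add: K_def)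
  have fe: "(\<integral>\<^sup>+u\<in>{0..t}. ennreal ((?\<phi> n u - f u)\<^sup>2) \<partial>lborel) \<le> ennreal (K * (1/4) ^ n)" for n
  proof -
    have "AE u in lborel. ennreal ((?\<phi> n u - f u)\<^sup>2) * indicator {0..t} u
        \<le> ennreal ((L * (t / 2 ^ n))\<^sup>2) * indicator {0..t} u"
      \<comment> \<open>The cells are left-open, so step functions vanish at \<open>0\<close>.\<close>
      using AE_lborel_singleton[of "0::real"]
    proof eventually_elim
      case (elim u)
      show ?case
      proof (cases "u \<in> {0..t}")
        case True
        then have "u \<in> {0<..real (N n) * (t / 2 ^ n)}" using elim by (auto simp: N_def)
        moreover have d: "0 \<le> t / 2 ^ n" using t by simp
        ultimately obtain j where j: "j < N n" "u \<in> {real j * (t / 2 ^ n)<..real (Suc j) * (t / 2 ^ n)}"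
          using uniform_partition_cell by metis
        have "?\<phi> n u = f (s n j)"
          using step_fun_uniform[OF j] by (simp add: s_def[abs_def] c_def)
        moreover have "\<bar>s n j - u\<bar> \<le> t / 2 ^ n"
        proof -
          have "\<bar>real j * e - u\<bar> \<le> e" if "u \<in> {real j * e<..real (Suc j) * e}" for e
            using that by (auto simp: algebra_simps abs_le_iff)
          from this[OF j(2)] show ?thesis unfolding s_def .
        qed
        moreover have "s n j \<in> {0..t}" using partition_bounds[OF s j(1)] by auto
        ultimately have "\<bar>?\<phi> n u - f u\<bar> \<le> L * (t / 2 ^ n)"
          using order.trans[OF lip[of "s n j" u] mult_left_mono[of "\<bar>s n j - u\<bar>" "t / 2 ^ n" L]] True L by simp
        then have "(?\<phi> n u - f u)\<^sup>2 \<le> (L * (t / 2 ^ n))\<^sup>2"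
          using mult_nonneg_nonneg[OF L d] by (simp only: power2_le_iff_abs_le)
        then show ?thesis using True by (simp add: ennreal_leI)
      qed simp
    qed
    then have "(\<integral>\<^sup>+u\<in>{0..t}. ennreal ((?\<phi> n u - f u)\<^sup>2) \<partial>lborel)
        \<le> (\<integral>\<^sup>+u. ennreal ((L * (t / 2 ^ n))\<^sup>2) * indicator {0..t} u \<partial>lborel)"
      by (rule nn_integral_mono_AE)
    also have "\<dots> = ennreal ((L * (t / 2 ^ n))\<^sup>2 * t)"
      using t by (simp add: nn_integral_cmult_indicator ennreal_mult')
    also have "(L * (t / 2 ^ n))\<^sup>2 * t = K * (1/4) ^ n"
    proof -
      have "((2::real) ^ n)\<^sup>2 = 4 ^ n" by (simp add: power2_eq_square flip: power_mult_distrib)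
      then show ?thesis by (simp add: K_def power_divide power_mult_distrib)
    qed
    finally show ?thesis .
  qed
  have [measurable]: "?S n \<in> borel_measurable M" for n
    by (rule borel_measurable_step_integral[OF cov s t(2)])
  have cauchy: "(\<integral>\<^sup>+\<omega>. ennreal ((norm (?S n \<omega> - ?S m \<omega>))\<^sup>2) \<partial>M) \<le> ennreal (4 * v * K * (1/4) ^ n)"
    if "n \<le> m" for n m
  proof -
    have "(\<integral>\<^sup>+\<omega>. ennreal ((norm (?S n \<omega> - ?S m \<omega>))\<^sup>2) \<partial>M)
      = ennreal v * (\<integral>\<^sup>+u\<in>{0..t}. ennreal ((norm (?\<phi> n u - ?\<phi> m u))\<^sup>2) \<partial>lborel)"
      by (rule step_integral_isometry[OF cov v t(2) s s])
    also have "\<dots> \<le> ennreal v * (2 * ennreal (K * (1/4) ^ n) + 2 * ennreal (K * (1/4) ^ m))"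
    proof (rule mult_left_mono)
      have "(\<integral>\<^sup>+u\<in>{0..t}. ennreal ((norm (?\<phi> n u - ?\<phi> m u))\<^sup>2) \<partial>lborel)
        \<le> 2 * (\<integral>\<^sup>+u\<in>{0..t}. ennreal ((?\<phi> n u - f u)\<^sup>2) \<partial>lborel)
          + 2 * (\<integral>\<^sup>+u\<in>{0..t}. ennreal ((?\<phi> m u - f u)\<^sup>2) \<partial>lborel)"
        using nn_integral_square_diff_le[of "?\<phi> n" lborel "?\<phi> m" f "{0..t}"] by simp
      also have "\<dots> \<le> 2 * ennreal (K * (1/4) ^ n) + 2 * ennreal (K * (1/4) ^ m)"
        by (intro add_mono mult_left_mono fe) simp_all
      finally show "(\<integral>\<^sup>+u\<in>{0..t}. ennreal ((norm (?\<phi> n u - ?\<phi> m u))\<^sup>2) \<partial>lborel)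
        \<le> 2 * ennreal (K * (1/4) ^ n) + 2 * ennreal (K * (1/4) ^ m)" .
    qed simp
    also have "\<dots> \<le> ennreal v * (2 * ennreal (K * (1/4) ^ n) + 2 * ennreal (K * (1/4) ^ n))"
      using that K by (intro mult_left_mono add_left_mono ennreal_leI power_decreasing) simp_all
    also have "\<dots> = ennreal (4 * v * K * (1/4) ^ n)"
    proof -
      have four: "2 * ennreal y + 2 * ennreal y = ennreal 4 * ennreal y" for y
        by (simp flip: distrib_right)
      have mult: "ennreal v * (ennreal 4 * ennreal y) = ennreal (v * (4 * y))" for y
        using v by (simp only: ennreal_mult' zero_le_numeral)
      show ?thesis unfolding four mult by (simp only: mult_ac)
    qed
    finally show ?thesis .
  qed
  obtain I where I: "I \<in> borel_measurable M"
    "\<And>n. (\<integral>\<^sup>+\<omega>. ennreal ((norm (?S n \<omega> - I \<omega>))\<^sup>2) \<partial>M) \<le> ennreal (4 * v * K * (1/4) ^ n)"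
    using L2_geometric_Cauchy_limit[of ?S "4 * v * K"] cauchy v K by auto
  have lim0: "(\<lambda>n. ennreal (k * (1/4) ^ n)) \<longlonglongrightarrow> 0" for k
  proof -
    have "(\<lambda>n. ennreal (k * (1/4) ^ n)) \<longlonglongrightarrow> ennreal (k * 0)"
      by (intro tendsto_ennrealI tendsto_mult tendsto_const LIMSEQ_realpow_zero) auto
    then show ?thesis by simp
  qed
  have "has_stoch_integral M t f a I"
    unfolding has_stoch_integral_def
  proof (intro conjI exI)
    show "\<forall>n. partition_of (N n) (s n) t" using s by blast
    show "(\<lambda>n. \<integral>\<^sup>+u\<in>{0..t}. ennreal ((?\<phi> n u - f u)\<^sup>2) \<partial>lborel) \<longlonglongrightarrow> 0"
      by (rule tendsto_sandwich[OF _ _ tendsto_const lim0]) (auto intro: always_eventually fe)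
    show "(\<lambda>n. \<integral>\<^sup>+\<omega>. ennreal ((norm (?S n \<omega> - I \<omega>))\<^sup>2) \<partial>M) \<longlonglongrightarrow> 0"
      by (rule tendsto_sandwich[OF _ _ tendsto_const lim0]) (auto intro: always_eventually I(2))
  qed (rule I(1))
  then show ?thesis using that by blast
qed

section \<open>Discretization error of the exponential kernel\<close>

lemma power_diff_bound:
  fixes y z r :: real
  assumes "0 \<le> y" "y \<le> r" "0 \<le> z" "z \<le> r"
  shows "\<bar>y ^ Suc n - z ^ Suc n\<bar> \<le> real (Suc n) * \<bar>y - z\<bar> * r ^ n"
proof (induction n)
  case (Suc n)
  have r: "0 \<le> r" using assms by simp
  have "y ^ Suc (Suc n) - z ^ Suc (Suc n) = y * (y ^ Suc n - z ^ Suc n) + z ^ Suc n * (y - z)"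
    by (simp add: algebra_simps)
  then have "\<bar>y ^ Suc (Suc n) - z ^ Suc (Suc n)\<bar> \<le> y * \<bar>y ^ Suc n - z ^ Suc n\<bar> + z ^ Suc n * \<bar>y - z\<bar>"
    using assms by (metis abs_mult abs_of_nonneg abs_triangle_ineq zero_le_power)
  also have "\<dots> \<le> r * (real (Suc n) * \<bar>y - z\<bar> * r ^ n) + r ^ Suc n * \<bar>y - z\<bar>"
    using assms r Suc.IH by (intro add_mono mult_mono power_mono) auto
  also have "\<dots> = real (Suc (Suc n)) * \<bar>y - z\<bar> * r ^ Suc n" by (simp add: algebra_simps)
  finally show ?case .
qed simp

text \<open>The geometric sum \<open>1 + r + \<dots> + r ^ n\<close> has \<open>n + 1\<close> terms of size at least \<open>r ^ n\<close>, and it is at most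
\<open>1 / (1 - r)\<close>.\<close>

lemma Suc_mult_power_le:
  fixes r :: real
  assumes "0 \<le> r" "r \<le> 1"
  shows "real (Suc n) * r ^ n * (1 - r) \<le> 1"
proof -
  have "real (Suc n) * r ^ n = (\<Sum>i<Suc n. r ^ n)" by simp
  also have "\<dots> \<le> (\<Sum>i<Suc n. r ^ i)"
    using assms by (intro sum_mono power_decreasing) auto
  finally have "real (Suc n) * r ^ n * (1 - r) \<le> (\<Sum>i<Suc n. r ^ i) * (1 - r)"
    using assms by (intro mult_right_mono) auto
  also have "\<dots> = 1 - r ^ Suc n" by (simp only: one_diff_power_eq[of r "Suc n"] mult.commute)
  also have "\<dots> \<le> 1" using assms by simp
  finally show ?thesis .
qed

lemma exp_neg_bounds:
  fixes x :: real assumes "0 \<le> x"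
  shows "1 - x \<le> exp (- x)" "exp (- x) \<le> 1 / (1 + x)"
proof -
  show "1 - x \<le> exp (- x)" using exp_ge_add_one_self[of "- x"] by simp
  have "1 + x \<le> exp x" by (rule exp_ge_add_one_self)
  then show "exp (- x) \<le> 1 / (1 + x)"
    using assms by (simp add: exp_minus field_simps)
qed

text \<open>Together with the preceding lemma: one step of either scheme and one step of the exact semigroup
lie in the same interval \<open>[1 - x, 1 / (1 + x)]\<close>, whose length is at most \<open>x\<^sup>2\<close>. This allows a common
treatment of both schemes. For the forward scheme the restriction \<open>x \<le> 1\<close> keeps \<open>\<xi>\<close> nonnegative.\<close>

lemma scheme_xi_bounds:
  fixes l h defines "x \<equiv> lb_eigenvalue l * h"
  assumes x: "0 \<le> x" and fwd: "sch = Forward \<Longrightarrow> x \<le> 1"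
  shows "0 \<le> scheme_xi sch h l" "1 - x \<le> scheme_xi sch h l" "scheme_xi sch h l \<le> 1 / (1 + x)"
proof -
  have "1 - x \<le> 1 / (1 + x)" using x by (simp add: field_simps)
  then show "1 - x \<le> scheme_xi sch h l" "scheme_xi sch h l \<le> 1 / (1 + x)" "0 \<le> scheme_xi sch h l"
    using x fwd by (cases sch; simp add: x_def inverse_eq_divide)+
qed

context
  fixes sch :: scheme and h :: real and l :: nat and x r :: real
  assumes h: "0 < h"
  defines "x \<equiv> lb_eigenvalue l * h"
  defines "r \<equiv> sqrt (1 / (1 + x))"
  assumes fwd: "sch = Forward \<Longrightarrow> x \<le> 1"
begin

lemma step_times_eigenvalue_nonneg: "0 \<le> x" using h by (simp add: x_def lb_eigenvalue_def)

lemma sqrt_decay_bounds: "0 < r" "r \<le> 1" "r * r = 1 / (1 + x)" "1 \<le> (1 + x) * r"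
proof -
  show "0 < r" using step_times_eigenvalue_nonneg by (simp add: r_def)
  show r1: "r \<le> 1" using step_times_eigenvalue_nonneg by (simp add: r_def)
  show sq: "r * r = 1 / (1 + x)" using step_times_eigenvalue_nonneg by (simp add: r_def del: real_sqrt_divide)
  have "1 = (1 + x) * (r * r)" using step_times_eigenvalue_nonneg by (simp add: sq)
  also have "\<dots> \<le> (1 + x) * (r * 1)"
    using step_times_eigenvalue_nonneg r1 \<open>0 < r\<close> by (intro mult_left_mono) auto
  finally show "1 \<le> (1 + x) * r" by simp
qed

text \<open>The local errors, at most \<open>x\<^sup>2\<close> each, add up to \<open>n x\<^sup>2 / (1 + x) ^ (n - 1)\<close>. Half of the decay, that is
one factor \<open>r ^ (n - 1)\<close> with \<open>r = sqrt (1 / (1 + x))\<close>, is spent on absorbing the number \<open>n\<close> of steps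
at the price of a factor of order \<open>1 / x\<close>. The other half remains and makes the bound
square summable in \<open>n\<close>. For \<open>n = 0\<close> the left side is zero, and the truncated exponent is harmless.\<close>

lemma euler_factor_power_error:
  "\<bar>exp (- x) ^ n - scheme_xi sch h l ^ n\<bar> \<le> 2 * (1 + x) * x * r ^ (n - 1)"
proof (cases n)
  case 0
  then show ?thesis using step_times_eigenvalue_nonneg sqrt_decay_bounds by simp
next
  case (Suc m)
  let ?\<rho> = "1 / (1 + x)"
  note xi = scheme_xi_bounds[of l h sch, folded x_def, OF step_times_eigenvalue_nonneg fwd]
  have "?\<rho> - (1 - x) = x\<^sup>2 / (1 + x)" using step_times_eigenvalue_nonneg by (simp add: field_simps power2_eq_square)
  also have "\<dots> \<le> x\<^sup>2" using step_times_eigenvalue_nonneg by (simp add: divide_le_eq distrib_left)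
  finally have gap: "\<bar>exp (- x) - scheme_xi sch h l\<bar> \<le> x\<^sup>2"
    using xi exp_neg_bounds[OF step_times_eigenvalue_nonneg] by linarith
  have "\<bar>exp (- x) ^ n - scheme_xi sch h l ^ n\<bar>
      \<le> real (Suc m) * \<bar>exp (- x) - scheme_xi sch h l\<bar> * ?\<rho> ^ m"
    unfolding Suc using xi exp_neg_bounds[OF step_times_eigenvalue_nonneg] by (intro power_diff_bound) auto
  also have "\<dots> \<le> real (Suc m) * x\<^sup>2 * ?\<rho> ^ m"
    using gap step_times_eigenvalue_nonneg by (intro mult_right_mono mult_left_mono) auto
  also have "\<dots> = x * r ^ m * (x * (real (Suc m) * r ^ m))"
    unfolding sqrt_decay_bounds(3)[symmetric] by (simp add: power_mult_distrib power2_eq_square mult_ac)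
  also have "\<dots> \<le> x * r ^ m * (2 * (1 + x))"
  proof (intro mult_left_mono)
    have "x = (1 + x) * (1 - r * r)" using step_times_eigenvalue_nonneg sqrt_decay_bounds(3) by (simp add: field_simps)
    also have "\<dots> = (1 + x) * ((1 + r) * (1 - r))" by (simp add: algebra_simps)
    also have "\<dots> \<le> (1 + x) * (2 * (1 - r))"
      using step_times_eigenvalue_nonneg sqrt_decay_bounds by (intro mult_left_mono mult_right_mono) auto
    finally have "x * (real (Suc m) * r ^ m) \<le> (1 + x) * (2 * (1 - r)) * (real (Suc m) * r ^ m)"
      using sqrt_decay_bounds by (intro mult_right_mono) auto
    also have "\<dots> = 2 * (1 + x) * (real (Suc m) * r ^ m * (1 - r))" by (simp only: mult_ac)
    also have "\<dots> \<le> 2 * (1 + x) * 1"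
      using step_times_eigenvalue_nonneg sqrt_decay_bounds by (intro mult_left_mono Suc_mult_power_le) auto
    finally show "x * (real (Suc m) * r ^ m) \<le> 2 * (1 + x)" by simp
  qed (use step_times_eigenvalue_nonneg sqrt_decay_bounds in auto)
  finally show ?thesis by (simp add: Suc mult_ac)
qed

lemma semigroup_power_error:
  "\<bar>exp (- lb_eigenvalue l * (real k * h)) - scheme_xi sch h l ^ k\<bar> \<le> 2 * (1 + x) * x"
proof -
  have "exp (- lb_eigenvalue l * (real k * h)) = exp (- x) ^ k"
    by (simp add: x_def mult_ac flip: exp_of_nat_mult)
  moreover have "2 * (1 + x) * x * r ^ (k - 1) \<le> 2 * (1 + x) * x * 1"
    using step_times_eigenvalue_nonneg sqrt_decay_bounds by (intro mult_left_mono power_le_one) auto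
  ultimately show ?thesis using euler_factor_power_error[of k] by simp
qed

text \<open>On a cell at distance \<open>i\<close> steps from the final time, the exponential kernel varies by at most
\<open>x r ^ i\<close>, and its value at the end point chosen by the scheme (\<open>scheme_delta\<close>) differs from the power
of \<open>\<xi>\<close> by the preceding lemma.\<close>

lemma kernel_error_cell:
  assumes \<tau>: "real i * h \<le> \<tau>" "\<tau> \<le> real (Suc i) * h"
  shows "\<bar>exp (- lb_eigenvalue l * \<tau>) - scheme_xi sch h l ^ (i + scheme_delta sch)\<bar>
    \<le> 3 * (1 + x)\<^sup>2 * x * r ^ i"
proof -
  let ?e = "exp (- x)" and ?n = "i + scheme_delta sch"
  have lam: "0 \<le> lb_eigenvalue l" by (simp add: lb_eigenvalue_def)
  have pow: "?e ^ n = exp (- lb_eigenvalue l * (real n * h))" for n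
    by (simp add: x_def mult_ac flip: exp_of_nat_mult)
  have d: "scheme_delta sch = 0 \<or> scheme_delta sch = 1" by (cases sch) auto
  have "?e ^ Suc i \<le> exp (- lb_eigenvalue l * \<tau>)" "exp (- lb_eigenvalue l * \<tau>) \<le> ?e ^ i"
    unfolding pow using \<tau> lam by (auto intro!: mult_left_mono simp del: of_nat_Suc)
  moreover have "?e ^ Suc i \<le> ?e ^ ?n" "?e ^ ?n \<le> ?e ^ i"
    using d step_times_eigenvalue_nonneg by (auto intro!: mult_left_le_one_le)
  ultimately have "\<bar>exp (- lb_eigenvalue l * \<tau>) - ?e ^ ?n\<bar> \<le> ?e ^ i - ?e ^ Suc i" by linarith
  also have "\<dots> = ?e ^ i * (1 - ?e)" by (simp add: algebra_simps)
  also have "\<dots> \<le> r ^ i * x"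
  proof (intro mult_mono power_mono)
    have "?e \<le> r * r" using exp_neg_bounds(2)[OF step_times_eigenvalue_nonneg] sqrt_decay_bounds(3) by simp
    also have "\<dots> \<le> 1 * r" using sqrt_decay_bounds(1,2) by (intro mult_right_mono) auto
    also have "\<dots> = r" by simp
    finally show "?e \<le> r" .
    show "1 - ?e \<le> x" using exp_neg_bounds(1)[OF step_times_eigenvalue_nonneg] by simp
  qed (use step_times_eigenvalue_nonneg sqrt_decay_bounds in auto)
  finally have 1: "\<bar>exp (- lb_eigenvalue l * \<tau>) - ?e ^ ?n\<bar> \<le> r ^ i * x" .
  \<comment> \<open>The forward scheme is one power of \<open>r\<close> short, which \<open>(1 + x) * r \<ge> 1\<close> makes up for.\<close>
  have "r ^ (?n - 1) \<le> (1 + x) * r ^ i"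
  proof (cases "?n = 0 \<or> scheme_delta sch = 1")
    case True
    then have "r ^ (?n - 1) = r ^ i" by auto
    then show ?thesis using step_times_eigenvalue_nonneg sqrt_decay_bounds by (simp add: mult_le_cancel_right1)
  next
    case False
    then obtain j where "i = Suc j" "?n = Suc j" using d by (cases i) auto
    then show ?thesis
      using mult_right_mono[OF sqrt_decay_bounds(4), of "r ^ j"] sqrt_decay_bounds(1) by (simp add: mult_ac)
  qed
  then have "2 * (1 + x) * x * r ^ (?n - 1) \<le> 2 * (1 + x) * x * ((1 + x) * r ^ i)"
    using step_times_eigenvalue_nonneg by (intro mult_left_mono) auto
  with euler_factor_power_error[of ?n] have 2: "\<bar>?e ^ ?n - scheme_xi sch h l ^ ?n\<bar> \<le> 2 * (1 + x)\<^sup>2 * x * r ^ i"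
    by (simp add: power2_eq_square mult_ac)
  have "1 * (x * r ^ i) \<le> (1 + x)\<^sup>2 * (x * r ^ i)"
    using step_times_eigenvalue_nonneg sqrt_decay_bounds by (intro mult_right_mono) auto
  then have "r ^ i * x + 2 * (1 + x)\<^sup>2 * x * r ^ i \<le> 3 * (1 + x)\<^sup>2 * x * r ^ i"
    by (simp add: mult_ac)
  then show ?thesis using 1 2 by linarith
qed

text \<open>Squaring the bound on the cells and summing the geometric series gives
\<open>h x\<^sup>2 \<Sum> (1 + x) ^ -i\<close>, which is \<open>h x = \<lambda> h\<^sup>2\<close> up to powers of \<open>1 + x\<close>, uniformly in the number of steps.\<close>

lemma kernel_error_integral:
  "(\<integral>\<^sup>+u\<in>{0..real k * h}. ennreal ((exp (- lb_eigenvalue l * (real k * h - u))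
       - step_fun k (\<lambda>j. real j * h) (\<lambda>j. scheme_xi sch h l ^ (k - Suc j + scheme_delta sch)) u)\<^sup>2) \<partial>lborel)
    \<le> ennreal (9 * (1 + x) ^ 5 * (lb_eigenvalue l * h\<^sup>2))"
proof -
  let ?c = "\<lambda>j. scheme_xi sch h l ^ (k - Suc j + scheme_delta sch)"
  let ?B = "\<lambda>j. (3 * (1 + x)\<^sup>2 * x * r ^ (k - Suc j))\<^sup>2"
  let ?cell = "\<lambda>j. {real j * h<..real (Suc j) * h}"
  let ?g = "\<lambda>u. exp (- lb_eigenvalue l * (real k * h - u)) - step_fun k (\<lambda>j. real j * h) ?c u"
  have "AE u in lborel. ennreal ((?g u)\<^sup>2) * indicator {0..real k * h} u
      \<le> (\<Sum>j<k. ennreal (?B j) * indicator (?cell j) u)"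
    using AE_lborel_singleton[of "0::real"]
  proof eventually_elim
    case (elim u)
    show ?case
    proof (cases "u \<in> {0..real k * h}")
      case True
      then have "u \<in> {0<..real k * h}" using elim by auto
      then obtain j where j: "j < k" "u \<in> ?cell j"
        using uniform_partition_cell[of h u k] h by auto
      have kj: "real k = real (k - Suc j) + real (Suc j)" using j(1) by simp
      have tau: "real (k - Suc j) * h \<le> real k * h - u" "real k * h - u \<le> real (Suc (k - Suc j)) * h"
        using j(2) unfolding kj by (auto simp: algebra_simps)
      have "\<bar>?g u\<bar> \<le> 3 * (1 + x)\<^sup>2 * x * r ^ (k - Suc j)"
        unfolding step_fun_uniform[OF j] by (rule kernel_error_cell[OF tau])
      moreover have "0 \<le> 3 * (1 + x)\<^sup>2 * x * r ^ (k - Suc j)"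
        using step_times_eigenvalue_nonneg sqrt_decay_bounds by simp
      ultimately have "(?g u)\<^sup>2 \<le> ?B j" by (simp only: power2_le_iff_abs_le)
      then have "ennreal ((?g u)\<^sup>2) * indicator {0..real k * h} u \<le> ennreal (?B j) * indicator (?cell j) u"
        using True j(2) by (simp add: ennreal_leI)
      also have "\<dots> \<le> (\<Sum>j<k. ennreal (?B j) * indicator (?cell j) u)"
        using j(1) by (intro member_le_sum[of j "{..<k}"]) auto
      finally show ?thesis .
    qed simp
  qed
  then have "(\<integral>\<^sup>+u\<in>{0..real k * h}. ennreal ((?g u)\<^sup>2) \<partial>lborel)
      \<le> (\<integral>\<^sup>+u. (\<Sum>j<k. ennreal (?B j) * indicator (?cell j) u) \<partial>lborel)"
    by (rule nn_integral_mono_AE)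
  also have "\<dots> = (\<Sum>j<k. ennreal (?B j) * emeasure lborel (?cell j))"
    by (subst nn_integral_sum) (auto simp: nn_integral_cmult_indicator)
  also have "\<dots> = (\<Sum>j<k. ennreal (?B j * h))"
  proof (intro sum.cong refl)
    fix j
    have "real j * h \<le> real (Suc j) * h" using h by (intro mult_right_mono) auto
    then have "emeasure lborel (?cell j) = ennreal (real (Suc j) * h - real j * h)"
      by (rule emeasure_lborel_Ioc)
    also have "real (Suc j) * h - real j * h = h" by (simp add: algebra_simps)
    finally show "ennreal (?B j) * emeasure lborel (?cell j) = ennreal (?B j * h)"
      by (simp only: ennreal_mult' zero_le_power2)
  qed
  also have "\<dots> = ennreal (\<Sum>j<k. ?B j * h)"
    using h by (intro sum_ennreal) auto
  also have "\<dots> \<le> ennreal (9 * (1 + x) ^ 5 * (lb_eigenvalue l * h\<^sup>2))"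
  proof (rule ennreal_leI)
    let ?\<rho> = "1 / (1 + x)"
    have sq: "(3 * z\<^sup>2 * x * y)\<^sup>2 * h = 9 * z ^ 4 * x\<^sup>2 * h * (y * y)" for z y
      by (simp add: power2_eq_square eval_nat_numeral mult_ac)
    have "(\<Sum>j<k. ?B j * h) = (\<Sum>j<k. 9 * (1 + x) ^ 4 * x\<^sup>2 * h * ?\<rho> ^ (k - Suc j))"
      unfolding sqrt_decay_bounds(3)[symmetric] sq by (simp only: power_mult_distrib)
    also have "\<dots> = 9 * (1 + x) ^ 4 * x * h * (x * (\<Sum>i<k. ?\<rho> ^ i))"
      by (simp add: sum.nat_diff_reindex power2_eq_square mult_ac flip: sum_distrib_left)
    also have "\<dots> \<le> 9 * (1 + x) ^ 4 * x * h * (1 + x)"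
    proof (intro mult_left_mono)
      have "x = (1 + x) * (1 - ?\<rho>)" using step_times_eigenvalue_nonneg by (simp add: field_simps)
      then have "x * (\<Sum>i<k. ?\<rho> ^ i) = (1 + x) * ((1 - ?\<rho>) * (\<Sum>i<k. ?\<rho> ^ i))"
        by (metis mult.assoc)
      also have "\<dots> = (1 + x) * (1 - ?\<rho> ^ k)" by (simp only: one_diff_power_eq)
      also have "\<dots> \<le> (1 + x) * 1" using step_times_eigenvalue_nonneg by (intro mult_left_mono) auto
      finally show "x * (\<Sum>i<k. ?\<rho> ^ i) \<le> 1 + x" by simp
    qed (use step_times_eigenvalue_nonneg h in auto)
    also have "\<dots> = 9 * (1 + x) ^ 5 * (lb_eigenvalue l * h\<^sup>2)"
      by (simp add: x_def power2_eq_square eval_nat_numeral)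
    finally show "(\<Sum>j<k. ?B j * h) \<le> 9 * (1 + x) ^ 5 * (lb_eigenvalue l * h\<^sup>2)" .
  qed
  finally show ?thesis .
qed

end

section \<open>Summation over the angular power spectrum\<close>

text \<open>For negative \<open>p\<close> the sum is compared with the increments of \<open>l powr (p + 1) / (p + 1)\<close> by the mean
value theorem. The maximum with 1 takes care of the first term and of nonnegative \<open>p\<close>.\<close>

lemma sum_powr_le:
  fixes p :: real
  assumes p: "- 1 < p" and n: "1 \<le> n"
  shows "(\<Sum>l=1..n. real l powr p) \<le> max 1 (1 / (p + 1)) * real n powr (p + 1)"
proof (cases "0 \<le> p")
  case True
  have "(\<Sum>l=1..n. real l powr p) \<le> (\<Sum>l=1..n. real n powr p)"
    using True by (intro sum_mono powr_mono2) auto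
  also have "\<dots> = 1 * real n powr (p + 1)" using n by (simp add: powr_add)
  also have "\<dots> \<le> max 1 (1 / (p + 1)) * real n powr (p + 1)" by (intro mult_right_mono) auto
  finally show ?thesis .
next
  case False
  let ?D = "max 1 (1 / (p + 1))"
  show ?thesis using n
  proof (induction n rule: dec_induct)
    case (step n)
    let ?n = "real n" and ?n' = "real (Suc n)"
    have "\<exists>z>?n. z < ?n' \<and> ?n' powr (p + 1) - ?n powr (p + 1) = (?n' - ?n) * ((p + 1) * z powr p)"
      using step.hyps by (intro MVT2) (auto intro!: derivative_eq_intros simp: powr_diff)
    then obtain z where z: "?n < z" "z < ?n'" "?n' powr (p + 1) - ?n powr (p + 1) = (p + 1) * z powr p"
      by auto
    have "?n' powr p \<le> z powr p" using z step.hyps False by (intro powr_mono2') auto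
    then have "(p + 1) * ?n' powr p \<le> ?n' powr (p + 1) - ?n powr (p + 1)"
      unfolding z(3) using p by (intro mult_left_mono) auto
    then have "?n' powr p \<le> 1 / (p + 1) * (?n' powr (p + 1) - ?n powr (p + 1))"
      using p by (simp add: field_simps)
    also have "\<dots> \<le> ?D * (?n' powr (p + 1) - ?n powr (p + 1))"
      using p by (intro mult_right_mono) (auto intro!: powr_mono2)
    finally show ?case using step.IH by (simp add: algebra_simps)
  qed simp
qed

text \<open>There are \<open>2 l + 1\<close> modes of degree \<open>l\<close>, each contributing \<open>A l \<lambda> h\<^sup>2\<close>, so the total is at most a constant
times \<open>h\<^sup>2 \<Sum> l powr (3 - \<alpha>)\<close>. The series converges for \<open>\<alpha> > 4\<close>. For \<open>\<alpha> < 4\<close> the partial sums grow like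
\<open>\<kappa> powr (4 - \<alpha>)\<close>, and the bound on \<open>\<kappa>\<^sup>2 h\<close> converts this growth into powers of \<open>1 / h\<close>. For
\<open>\<alpha> = 4\<close> a logarithm of \<open>\<kappa>\<close> would appear.\<close>

lemma spectrum_sum_bound:
  assumes A: "\<And>l. 0 \<le> A l" "\<And>l. 0 < l \<Longrightarrow> A l \<le> C * real l powr (- \<alpha>)"
    and "0 < C" "0 < \<alpha>" "\<alpha> \<noteq> 4" "0 < Cc"
  obtains B where "0 \<le> B" "\<And>\<kappa> h. 1 \<le> \<kappa> \<Longrightarrow> 0 < h \<Longrightarrow> real \<kappa> * (real \<kappa> + 1) * h \<le> Cc \<Longrightarrow>
     (\<Sum>l\<le>\<kappa>. real (2 * l + 1) * (A l * (lb_eigenvalue l * h\<^sup>2))) \<le> B * (h powr min 1 (\<alpha> / 4))\<^sup>2"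
proof -
  have reduce: "(\<Sum>l\<le>\<kappa>. real (2 * l + 1) * (A l * (lb_eigenvalue l * h\<^sup>2)))
      \<le> 6 * C * h\<^sup>2 * (\<Sum>l=1..\<kappa>. real l powr (3 - \<alpha>))" for \<kappa> h
  proof -
    have "(\<Sum>l\<le>\<kappa>. real (2 * l + 1) * (A l * (lb_eigenvalue l * h\<^sup>2)))
        = (\<Sum>l=1..\<kappa>. real (2 * l + 1) * (A l * (lb_eigenvalue l * h\<^sup>2)))"
      by (rule sum.mono_neutral_right) (auto simp: lb_eigenvalue_def not_less_eq_eq)
    also have "\<dots> \<le> (\<Sum>l=1..\<kappa>. 6 * C * h\<^sup>2 * real l powr (3 - \<alpha>))"
    proof (rule sum_mono)
      fix l assume "l \<in> {1..\<kappa>}"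
      then have l: "1 \<le> real l" "0 < l" by auto
      have "real (2 * l + 1) * lb_eigenvalue l \<le> (3 * real l) * (real l * (2 * real l))"
        unfolding lb_eigenvalue_def using l by (intro mult_mono) auto
      also have "\<dots> = 6 * real l powr 3" using l by (simp add: power3_eq_cube)
      finally have "(real (2 * l + 1) * lb_eigenvalue l) * (A l * h\<^sup>2)
          \<le> (6 * real l powr 3) * ((C * real l powr (- \<alpha>)) * h\<^sup>2)"
        by (rule mult_mono[OF _ mult_right_mono[OF A(2)[OF l(2)]]]) (simp_all add: A(1))
      also have "\<dots> = 6 * C * h\<^sup>2 * real l powr (3 - \<alpha>)"
        using l by (simp add: powr_diff powr_minus field_simps)
      finally show "real (2 * l + 1) * (A l * (lb_eigenvalue l * h\<^sup>2)) \<le> 6 * C * h\<^sup>2 * real l powr (3 - \<alpha>)"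
        by (simp only: mult_ac)
    qed
    finally show ?thesis by (simp add: sum_distrib_left)
  qed
  show thesis
  proof (cases "\<alpha> < 4")
    case False
    then have sm: "summable (\<lambda>l. real l powr (3 - \<alpha>))"
      using \<open>\<alpha> \<noteq> 4\<close> by (simp add: summable_real_powr_iff)
    let ?S = "\<Sum>l. real l powr (3 - \<alpha>)"
    show thesis
    proof (rule that)
      show "0 \<le> 6 * C * ?S" using \<open>0 < C\<close> suminf_nonneg[OF sm] by simp
      fix \<kappa> :: nat and h :: real assume h: "0 < h"
      have "(\<Sum>l=1..\<kappa>. real l powr (3 - \<alpha>)) \<le> ?S" by (rule sum_le_suminf[OF sm]) auto
      then have "6 * C * h\<^sup>2 * (\<Sum>l=1..\<kappa>. real l powr (3 - \<alpha>)) \<le> 6 * C * h\<^sup>2 * ?S"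
        using \<open>0 < C\<close> by (intro mult_left_mono) auto
      also have "\<dots> = 6 * C * ?S * (h powr min 1 (\<alpha> / 4))\<^sup>2"
        using False h by (simp add: min_def)
      finally show "(\<Sum>l\<le>\<kappa>. real (2 * l + 1) * (A l * (lb_eigenvalue l * h\<^sup>2)))
          \<le> 6 * C * ?S * (h powr min 1 (\<alpha> / 4))\<^sup>2"
        using reduce[of h \<kappa>] by linarith
    qed
  next
    case True
    define q where "q = 4 - \<alpha>"
    have q: "0 < q" using True by (simp add: q_def)
    let ?D = "max 1 (1 / q)"
    show thesis
    proof (rule that)
      show "0 \<le> 6 * C * (?D * Cc powr (q / 2))" using \<open>0 < C\<close> by simp
      fix \<kappa> :: nat and h :: real
      assume \<kappa>: "1 \<le> \<kappa>" and h: "0 < h" and CFL: "real \<kappa> * (real \<kappa> + 1) * h \<le> Cc"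
      have "(real \<kappa>)\<^sup>2 * h \<le> real \<kappa> * (real \<kappa> + 1) * h"
        using h by (simp add: power2_eq_square algebra_simps)
      then have "(real \<kappa>)\<^sup>2 \<le> Cc / h" using CFL h by (simp add: field_simps)
      then have "((real \<kappa>)\<^sup>2) powr (q / 2) \<le> (Cc / h) powr (q / 2)"
        using q by (intro powr_mono2) auto
      moreover have "((real \<kappa>)\<^sup>2) powr (q / 2) = real \<kappa> powr q"
        using \<kappa> by (simp add: powr_powr flip: powr_numeral)
      ultimately have \<kappa>q: "real \<kappa> powr q \<le> Cc powr (q / 2) * h powr (- (q / 2))"
        using h \<open>0 < Cc\<close> by (simp add: powr_divide powr_minus field_simps)
      have "(\<Sum>l=1..\<kappa>. real l powr (3 - \<alpha>)) \<le> ?D * real \<kappa> powr q"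
        using sum_powr_le[of "3 - \<alpha>" \<kappa>] True \<kappa> by (simp add: q_def)
      also have "\<dots> \<le> ?D * (Cc powr (q / 2) * h powr (- (q / 2)))"
        by (intro mult_left_mono \<kappa>q) auto
      finally have "6 * C * h\<^sup>2 * (\<Sum>l=1..\<kappa>. real l powr (3 - \<alpha>))
          \<le> 6 * C * h\<^sup>2 * (?D * (Cc powr (q / 2) * h powr (- (q / 2))))"
        using \<open>0 < C\<close> by (intro mult_left_mono) auto
      also have "\<dots> = 6 * C * (?D * Cc powr (q / 2)) * (h powr 2 * h powr (- (q / 2)))"
        using h by simp
      also have "h powr 2 * h powr (- (q / 2)) = (h powr min 1 (\<alpha> / 4))\<^sup>2"
      proof -
        have "h powr 2 * h powr (- (q / 2)) = h powr (2 + - (q / 2))" by (simp only: powr_add)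
        also have "2 + - (q / 2) = \<alpha> / 4 + \<alpha> / 4" by (simp add: q_def field_simps)
        finally show ?thesis using True by (simp add: power2_eq_square min_def flip: powr_add)
      qed
      finally show "(\<Sum>l\<le>\<kappa>. real (2 * l + 1) * (A l * (lb_eigenvalue l * h\<^sup>2)))
          \<le> 6 * C * (?D * Cc powr (q / 2)) * (h powr min 1 (\<alpha> / 4))\<^sup>2"
        using reduce[of h \<kappa>] by linarith
    qed
  qed
qed

section \<open>Coefficients of the initial condition\<close>

lemma L2_sphere_complex:
  assumes "f \<in> L2_sphere"
  shows "(\<lambda>x. complex_of_real (f x)) \<in> borel_measurable S2"
    "integrable S2 (\<lambda>x. (norm (complex_of_real (f x)))\<^sup>2)"
  using assms by (auto simp: L2_sphere_def)

lemma L2_sphere_diff: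
  assumes "f \<in> L2_sphere" "g \<in> L2_sphere"
  shows "(\<lambda>x. g x - f x) \<in> L2_sphere"
proof -
  have [measurable]: "f \<in> borel_measurable S2" "g \<in> borel_measurable S2"
    and int: "integrable S2 (\<lambda>x. (f x)\<^sup>2)" "integrable S2 (\<lambda>x. (g x)\<^sup>2)"
    using assms by (auto simp: L2_sphere_def)
  have "integrable S2 (\<lambda>x. (g x - f x)\<^sup>2)"
  proof (rule Bochner_Integration.integrable_bound)
    show "integrable S2 (\<lambda>x. 2 * (g x)\<^sup>2 + 2 * (f x)\<^sup>2)" using int by simp
    show "AE x in S2. norm ((g x - f x)\<^sup>2) \<le> norm (2 * (g x)\<^sup>2 + 2 * (f x)\<^sup>2)"
      using norm_add_power2_le[of "g _" "- f _"] by simp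
  qed measurable
  then show ?thesis by (simp add: L2_sphere_def)
qed

lemma sph_coeff_diff:
  assumes "f \<in> L2_sphere" "g \<in> L2_sphere"
  shows "sph_coeff (\<lambda>x. g x - f x) l m = sph_coeff g l m - sph_coeff f l m"
proof -
  have "integrable S2 (\<lambda>x. complex_of_real (u x) * cnj (sph_harm l m x))" if "u \<in> L2_sphere" for u
    using L2_sphere_complex[OF that] by (intro integrable_mult_cnj borel_measurable_sph_harm integrable_norm_sph_harm)
  then show ?thesis
    using assms unfolding sph_coeff_def by (simp add: left_diff_distrib)
qed

text \<open>By Bessel's inequality each coefficient is a contraction from \<open>L2_sphere\<close> to \<open>\<complex>\<close>, so preimages of
open sets are open in the seminorm. Where the values of \<open>X0\<close> leave \<open>L2_sphere\<close>, completeness of the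
probability space supplies measurability.\<close>

lemma borel_measurable_sph_coeff:
  assumes "complete_measure M" and X0: "X0 \<in> L2_Omega M L2_sphere L2_norm" and m: "\<bar>m\<bar> \<le> int l"
  shows "(\<lambda>\<omega>. sph_coeff (X0 \<omega>) l m) \<in> borel_measurable M"
proof (rule borel_measurableI)
  interpret complete_measure M by fact
  fix V :: "complex set" assume V: "open V"
  let ?U = "{f \<in> L2_sphere. sph_coeff f l m \<in> V}"
  have "seminorm_open L2_sphere L2_norm ?U"
    unfolding seminorm_open_def
  proof (intro conjI ballI)
    fix f assume f: "f \<in> ?U"
    then obtain e where e: "e > 0" "\<And>z. dist z (sph_coeff f l m) < e \<Longrightarrow> z \<in> V"
      using V by (auto simp: open_dist)
    have "g \<in> ?U" if g: "g \<in> L2_sphere" "L2_norm (\<lambda>x. g x - f x) < e" for g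
    proof -
      have "norm (sph_coeff g l m - sph_coeff f l m) \<le> L2_norm (\<lambda>x. g x - f x)"
        using norm_sph_coeff_le[OF L2_sphere_diff[of f g] m] sph_coeff_diff[of f g] f g by simp
      then show ?thesis using g e(2) by (simp add: dist_norm)
    qed
    then show "\<exists>e>0. \<forall>g\<in>L2_sphere. L2_norm (\<lambda>x. g x - f x) < e \<longrightarrow> g \<in> ?U" using e(1) by blast
  qed auto
  then have S1: "{\<omega> \<in> space M. X0 \<omega> \<in> ?U} \<in> sets M"
    using X0 by (auto simp: L2_Omega_def borel_rv_def)
  have "AE \<omega> in M. X0 \<omega> \<in> L2_sphere" using X0 by (simp add: L2_Omega_def)
  then obtain N where N: "{\<omega> \<in> space M. X0 \<omega> \<notin> L2_sphere} \<subseteq> N" "emeasure M N = 0" "N \<in> sets M"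
    by (rule AE_E)
  let ?S2 = "{\<omega> \<in> space M. X0 \<omega> \<notin> L2_sphere \<and> sph_coeff (X0 \<omega>) l m \<in> V}"
  have "?S2 \<in> sets M" by (rule complete[of _ N]) (use N in auto)
  moreover have "(\<lambda>\<omega>. sph_coeff (X0 \<omega>) l m) -` V \<inter> space M = {\<omega> \<in> space M. X0 \<omega> \<in> ?U} \<union> ?S2" by auto
  ultimately show "(\<lambda>\<omega>. sph_coeff (X0 \<omega>) l m) -` V \<inter> space M \<in> sets M" using S1 by simp
qed

text \<open>Bessel's inequality for the square-integrable function \<open>(1 - \<Delta>) powr (s/2) f\<close> whose norm defines
\<open>Hs_norm\<close>.\<close>

lemma Hs_norm_bound:
  assumes "f \<in> Hs_sphere s"
  shows "(\<Sum>l\<le>\<kappa>. \<Sum>m\<in>{- int l..int l}. ((1 + lb_eigenvalue l) powr (s / 2) * norm (sph_coeff f l m))\<^sup>2)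
    \<le> (Hs_norm s f)\<^sup>2"
proof -
  define g where "g = (SOME g. bessel_op_graph s f g)"
  have g: "bessel_op_graph s f g" 
    unfolding g_def using assms someI_ex[of "bessel_op_graph s f"] by (simp add: Hs_sphere_def)
  have "(\<Sum>l\<le>\<kappa>. \<Sum>m\<in>{- int l..int l}. ((1 + lb_eigenvalue l) powr (s / 2) * norm (sph_coeff f l m))\<^sup>2)
     = (\<Sum>l\<le>\<kappa>. \<Sum>m\<in>{- int l..int l}. (norm (sph_coeff g l m))\<^sup>2)"
    using g by (intro sum.cong refl) (auto simp: bessel_op_graph_def norm_mult abs_le_iff)
  also have "\<dots> \<le> (L2_norm g)\<^sup>2" using g by (intro bessel_sph_coeff) (simp add: bessel_op_graph_def)
  finally show ?thesis by (simp add: Hs_norm_def g_def)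
qed

section \<open>The Euler scheme mode by mode\<close>

text \<open>The Euler recursion solved explicitly, for orders of both signs: a power of the step factor applied
to the initial coefficient, plus an elementary stochastic integral of a step function. In this form
it can be compared with the exact mode, the integrand being a discretized exponential kernel.\<close>

definition euler_mode ::
  "scheme \<Rightarrow> (nat \<Rightarrow> int \<Rightarrow> real \<Rightarrow> 'w \<Rightarrow> complex) \<Rightarrow> ('w \<Rightarrow> real^3 \<Rightarrow> real)
     \<Rightarrow> real \<Rightarrow> nat \<Rightarrow> int \<Rightarrow> nat \<Rightarrow> 'w \<Rightarrow> complex" where
  "euler_mode sch a X0 h l m k \<omega> = of_real (scheme_xi sch h l ^ k) * sph_coeff (X0 \<omega>) l m
     + step_integral k (\<lambda>j. real j * h) (\<lambda>j. scheme_xi sch h l ^ (k - Suc j + scheme_delta sch)) (a l m) \<omega>"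

lemma euler_coeff_eq_mode: "euler_coeff sch a X0 h l m k \<omega> = euler_mode sch a X0 h l (int m) k \<omega>"
proof (induction k)
  case 0
  then show ?case by (simp add: euler_mode_def step_integral_def)
next
  case (Suc k)
  let ?\<xi> = "scheme_xi sch h l" and ?\<delta> = "scheme_delta sch"
  let ?D = "\<lambda>j. a l (int m) (real (Suc j) * h) \<omega> - a l (int m) (real j * h) \<omega>"
  have "(\<Sum>j<k. of_real (?\<xi> ^ (Suc k - Suc j + ?\<delta>)) * ?D j)
      = of_real ?\<xi> * (\<Sum>j<k. of_real (?\<xi> ^ (k - Suc j + ?\<delta>)) * ?D j)"
  proof -
    have "Suc k - Suc j + ?\<delta> = Suc (k - Suc j + ?\<delta>)" if "j < k" for j using that by simp
    then show ?thesis unfolding sum_distrib_left by (intro sum.cong refl) (simp add: mult.assoc)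
  qed
  then show ?case
    by (simp only: euler_coeff.simps Suc.IH euler_mode_def step_integral_def sum.lessThan_Suc)
       (simp add: algebra_simps)
qed

lemma sph_harm_minus: "1 \<le> m \<Longrightarrow> sph_harm l (- int m) x = (-1) ^ m * cnj (sph_harm l (int m) x)"
  by (simp add: sph_harm_def)

lemma noise_coeff_minus:
  "1 \<le> m \<Longrightarrow> noise_coeff A \<beta>1 \<beta>2 l (- int m) t \<omega> = (-1) ^ m * cnj (noise_coeff A \<beta>1 \<beta>2 l (int m) t \<omega>)"
  by (simp add: noise_coeff_def)

lemma sph_coeff_minus:
  assumes "1 \<le> m" shows "sph_coeff f l (- int m) = (-1) ^ m * cnj (sph_coeff f l (int m))"
proof -
  have "(\<integral>x. of_real (f x) * cnj (sph_harm l (- int m) x) \<partial>S2)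
      = (\<integral>x. (-1) ^ m * cnj (of_real (f x) * cnj (sph_harm l (int m) x)) \<partial>S2)"
    unfolding sph_harm_minus[OF assms] by (simp add: mult_ac)
  then show ?thesis
    by (simp only: sph_coeff_def integral_mult_right_zero Bochner_Integration.integral_cnj)
qed

lemma euler_mode_minus:
  assumes a: "a = noise_coeff A \<beta>1 \<beta>2" and m: "1 \<le> m"
  shows "euler_mode sch a X0 h l (- int m) k \<omega> = (-1) ^ m * cnj (euler_mode sch a X0 h l (int m) k \<omega>)"
proof -
  have "step_integral k s c (a l (- int m)) \<omega> = (-1) ^ m * cnj (step_integral k s c (a l (int m)) \<omega>)" for s c
    unfolding step_integral_def a noise_coeff_minus[OF m]
    by (simp add: sum_distrib_left cnj_sum algebra_simps)
  then show ?thesis by (simp add: euler_mode_def sph_coeff_minus[OF m] algebra_simps)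
qed

lemma sum_symmetric_interval:
  fixes g :: "int \<Rightarrow> 'b::comm_monoid_add"
  shows "(\<Sum>m\<in>{- int l..int l}. g m) = g 0 + (\<Sum>m=1..l. g (int m) + g (- int m))"
proof (induction l)
  case (Suc l)
  have "{- int (Suc l)..int (Suc l)} = insert (int (Suc l)) (insert (- int (Suc l)) {- int l..int l})" by auto
  then show ?case using Suc.IH by (simp add: add_ac)
qed simp

text \<open>The real form used by the scheme combines the orders \<open>m\<close> and \<open>-m\<close>, whose terms are complex conjugates
of each other.\<close>

lemma euler_approx_eq_sum:
  assumes "a = noise_coeff A \<beta>1 \<beta>2"
  shows "euler_approx sch a X0 \<kappa> h k \<omega> x
     = (\<Sum>l\<le>\<kappa>. \<Sum>m\<in>{- int l..int l}. euler_mode sch a X0 h l m k \<omega> * sph_harm l m x)"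
proof -
  have "2 * complex_of_real (Re c * Re y - Im c * Im y) = c * y + ((-1) ^ m * cnj c) * ((-1) ^ m * cnj y)"
    for c y :: complex and m :: nat
    by (cases "even m") (auto simp: complex_eq_iff)
  then have "2 * complex_of_real (Re (euler_coeff sch a X0 h l m k \<omega>) * Re (sph_harm l (int m) x)
               - Im (euler_coeff sch a X0 h l m k \<omega>) * Im (sph_harm l (int m) x))
      = euler_mode sch a X0 h l (int m) k \<omega> * sph_harm l (int m) x
        + euler_mode sch a X0 h l (- int m) k \<omega> * sph_harm l (- int m) x" if "m \<in> {1..l}" for l m
    using that unfolding euler_coeff_eq_mode by (simp add: euler_mode_minus[OF assms] sph_harm_minus)
  then show ?thesis
    unfolding euler_approx_def sum_symmetric_interval sum_distrib_left euler_coeff_eq_mode[of _ _ _ _ _ 0]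
    by simp
qed

section \<open>The strong error\<close>

text \<open>The exact stochastic convolution is a Wiener integral of a Lipschitz kernel, so it exists, and the
Euler convolution is an elementary integral. Their distance is controlled by the distance of the
integrands.\<close>

lemma mode_noise_error_second_moment:
  assumes M: "prob_space M" and cov: "brownian_covariance M T v a" and v: "0 \<le> v"
    and h: "0 < h" and t: "real k * h \<le> T"
    and fwd: "sch = Forward \<Longrightarrow> lb_eigenvalue l * h \<le> 1"
  defines "R \<equiv> \<lambda>\<omega>. stoch_integral M (real k * h) (\<lambda>s. exp (- lb_eigenvalue l * (real k * h - s))) a \<omega>
     - step_integral k (\<lambda>j. real j * h) (\<lambda>j. scheme_xi sch h l ^ (k - Suc j + scheme_delta sch)) a \<omega>"
  shows "R \<in> borel_measurable M" "integrable M (\<lambda>\<omega>. (norm (R \<omega>))\<^sup>2)"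
    "(\<integral>\<omega>. (norm (R \<omega>))\<^sup>2 \<partial>M) \<le> 36 * (1 + lb_eigenvalue l * h) ^ 5 * (v * (lb_eigenvalue l * h\<^sup>2))"
proof -
  let ?t = "real k * h" and ?f = "\<lambda>s. exp (- lb_eigenvalue l * (real k * h - s))"
  let ?c = "\<lambda>j. scheme_xi sch h l ^ (k - Suc j + scheme_delta sch)"
  let ?J = "step_integral k (\<lambda>j. real j * h) ?c a"
  define I where "I = stoch_integral M ?t ?f a"
  have lam: "0 \<le> lb_eigenvalue l" by (simp add: lb_eigenvalue_def)
  have t0: "0 \<le> ?t" using h by simp
  have f: "?f \<in> borel_measurable borel"
    by (intro borel_measurable_continuous_onI continuous_intros)
  have lip: "\<bar>?f u - ?f w\<bar> \<le> lb_eigenvalue l * \<bar>u - w\<bar>" if "u \<in> {0..?t}" "w \<in> {0..?t}" for u w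
  proof -
    have *: "\<bar>?f u - ?f w\<bar> \<le> lb_eigenvalue l * (u - w)" if "w \<le> u" "u \<le> ?t" for u w
    proof -
      have "?f w = ?f u * exp (- (lb_eigenvalue l * (u - w)))"
        by (simp add: algebra_simps flip: exp_add)
      then have "?f u - ?f w = ?f u * (1 - exp (- (lb_eigenvalue l * (u - w))))"
        by (simp add: algebra_simps)
      moreover have "0 \<le> lb_eigenvalue l * (u - w)" using lam that by simp
      moreover have "?f u \<le> 1" using lam that by simp
      moreover have "1 - exp (- (lb_eigenvalue l * (u - w))) \<le> lb_eigenvalue l * (u - w)"
        using exp_ge_add_one_self[of "- (lb_eigenvalue l * (u - w))"] by simp
      moreover have "0 \<le> 1 - exp (- (lb_eigenvalue l * (u - w)))" using calculation(2) by simp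
      ultimately show ?thesis
        using mult_mono[of "?f u" 1 "1 - exp (- (lb_eigenvalue l * (u - w)))" "lb_eigenvalue l * (u - w)"]
        by (simp add: abs_of_nonneg)
    qed
    show ?thesis
      using *[of w u] *[of u w] that by (cases "w \<le> u") (auto simp: abs_minus_commute)
  qed
  have "\<exists>I. has_stoch_integral M ?t ?f a I"
    using has_stoch_integral_exists[OF M cov v t0 t f lam lip] by blast
  then have I: "has_stoch_integral M ?t ?f a I"
    unfolding I_def stoch_integral_def by (rule someI_ex)
  have part: "partition_of k (\<lambda>j. real j * h) ?t" using h by (intro uniform_partition) auto
  have [measurable]: "I \<in> borel_measurable M" using I by (simp add: has_stoch_integral_def)
  have [measurable]: "?J \<in> borel_measurable M" by (rule borel_measurable_step_integral[OF cov part t])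
  have R: "R = (\<lambda>\<omega>. I \<omega> - ?J \<omega>)" by (simp add: R_def I_def)
  show Rm[measurable]: "R \<in> borel_measurable M" unfolding R by measurable
  have "(\<integral>\<^sup>+\<omega>. ennreal ((norm (R \<omega>))\<^sup>2) \<partial>M)
      \<le> ennreal (4 * v) * (\<integral>\<^sup>+u\<in>{0..?t}. ennreal ((?f u - step_fun k (\<lambda>j. real j * h) ?c u)\<^sup>2) \<partial>lborel)"
    unfolding R by (rule stoch_integral_error[OF cov v t I f part])
  also have "\<dots> \<le> ennreal (4 * v) * ennreal (9 * (1 + lb_eigenvalue l * h) ^ 5 * (lb_eigenvalue l * h\<^sup>2))"
    by (intro mult_left_mono kernel_error_integral[OF h fwd]) auto
  also have "\<dots> = ennreal (4 * v * (9 * (1 + lb_eigenvalue l * h) ^ 5 * (lb_eigenvalue l * h\<^sup>2)))"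
    using v by (intro ennreal_mult'[symmetric]) auto
  also have "4 * v * (9 * (1 + lb_eigenvalue l * h) ^ 5 * (lb_eigenvalue l * h\<^sup>2))
      = 36 * (1 + lb_eigenvalue l * h) ^ 5 * (v * (lb_eigenvalue l * h\<^sup>2))" (is "_ = ?b") by simp
  finally have nn: "(\<integral>\<^sup>+\<omega>. ennreal ((norm (R \<omega>))\<^sup>2) \<partial>M) \<le> ennreal ?b" .
  show int: "integrable M (\<lambda>\<omega>. (norm (R \<omega>))\<^sup>2)"
    by (rule integrableI_nonneg) (use nn in \<open>auto intro: le_less_trans\<close>)
  have "0 \<le> ?b" using v lam h by simp
  moreover have "ennreal (\<integral>\<omega>. (norm (R \<omega>))\<^sup>2 \<partial>M) \<le> ennreal ?b"
    using nn nn_integral_eq_integral[OF int] by simp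
  ultimately show "(\<integral>\<omega>. (norm (R \<omega>))\<^sup>2 \<partial>M) \<le> ?b" by simp
qed

text \<open>The error is at most \<open>2 (1 + Cc) x\<close> with \<open>x = \<lambda> h\<close>, and also at most 1, since both terms lie in
\<open>[0, 1]\<close>. Interpolating between these bounds gives any power of \<open>x\<close> with exponent in \<open>[0, 1]\<close>. The
choice \<open>min 1 (\<eta> / 2)\<close> is the largest for which the Sobolev weight absorbs the power of \<open>\<lambda>\<close>.\<close>

lemma mode_initial_error_bound:
  assumes h: "0 < h" and x: "lb_eigenvalue l * h \<le> Cc" and fwd: "sch = Forward \<Longrightarrow> lb_eigenvalue l * h \<le> 1"
    and \<eta>: "0 < \<eta>"
  shows "\<bar>exp (- lb_eigenvalue l * (real k * h)) - scheme_xi sch h l ^ k\<bar>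
    \<le> 2 * (1 + Cc) * h powr min 1 (\<eta> / 2) * (1 + lb_eigenvalue l) powr (\<eta> / 2)"
proof -
  let ?x = "lb_eigenvalue l * h" and ?p = "min 1 (\<eta> / 2)"
  let ?d = "\<bar>exp (- lb_eigenvalue l * (real k * h)) - scheme_xi sch h l ^ k\<bar>"
  have lam: "0 \<le> lb_eigenvalue l" by (simp add: lb_eigenvalue_def)
  then have x0: "0 \<le> ?x" using h by simp
  note xi = scheme_xi_bounds[of l h sch, OF x0 fwd]
  have xi1: "scheme_xi sch h l \<le> 1" using xi(3) x0 by (auto elim!: order.trans)
  have "?d \<le> 2 * (1 + ?x) * ?x" by (rule semigroup_power_error[OF h fwd])
  also have "\<dots> \<le> 2 * (1 + Cc) * ?x" using x x0 by (intro mult_right_mono) auto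
  finally have d1: "?d \<le> 2 * (1 + Cc) * ?x" .
  have "0 \<le> scheme_xi sch h l ^ k" "scheme_xi sch h l ^ k \<le> 1"
    using xi(1) xi1 by (auto intro: power_le_one)
  moreover have "exp (- lb_eigenvalue l * (real k * h)) \<le> 1" "0 \<le> exp (- lb_eigenvalue l * (real k * h))"
    using lam h by simp_all
  ultimately have d2: "?d \<le> 1" by linarith
  have "?d \<le> 2 * (1 + Cc) * ?x powr ?p"
  proof (cases "?x \<le> 1")
    case True
    have "?x powr 1 \<le> ?x powr ?p" using True x0 by (intro powr_mono') auto
    then have "?x \<le> ?x powr ?p" using x0 by simp
    then show ?thesis using d1 x x0 by (elim order.trans) (intro mult_left_mono, auto)
  next
    case False
    then have "1 * 1 \<le> 2 * (1 + Cc) * ?x powr ?p"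
      using \<eta> x by (intro mult_mono ge_one_powr_ge_zero) auto
    then show ?thesis using d2 by simp
  qed
  also have "?x powr ?p = h powr ?p * lb_eigenvalue l powr ?p"
    using lam h by (simp add: powr_mult)
  also have "2 * (1 + Cc) * (h powr ?p * lb_eigenvalue l powr ?p)
      \<le> 2 * (1 + Cc) * (h powr ?p * (1 + lb_eigenvalue l) powr (\<eta> / 2))"
  proof (intro mult_left_mono)
    have "lb_eigenvalue l powr ?p \<le> (1 + lb_eigenvalue l) powr ?p"
      using lam \<eta> by (intro powr_mono2) auto
    also have "\<dots> \<le> (1 + lb_eigenvalue l) powr (\<eta> / 2)" using lam by (intro powr_mono) auto
    finally show "lb_eigenvalue l powr ?p \<le> (1 + lb_eigenvalue l) powr (\<eta> / 2)" .
  qed (use x x0 in auto)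
  finally show ?thesis by (simp only: mult.assoc)
qed

theorem theorem4p4:
  fixes M :: "'w measure" and F :: "real \<Rightarrow> 'w measure" and T :: real
    and A :: "nat \<Rightarrow> real"
    and \<beta>1 \<beta>2 :: "nat \<Rightarrow> nat \<Rightarrow> real \<Rightarrow> 'w \<Rightarrow> real"
    and X0 :: "'w \<Rightarrow> real^3 \<Rightarrow> real"
    and \<alpha> C \<eta> C\<^sub>c :: real
    and sch :: scheme
  defines "a \<equiv> noise_coeff A \<beta>1 \<beta>2"
  assumes "complete_filtered_prob_space M F T" and "0 < T"
    and "\<And>l. 0 \<le> A l"
    and "\<And>l m. m \<le> l \<Longrightarrow> brownian_motion M F T (\<beta>1 l m)"
    and "\<And>l m. 1 \<le> m \<Longrightarrow> m \<le> l \<Longrightarrow> brownian_motion M F T (\<beta>2 l m)"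
    and "independent_family M T \<beta>1 \<beta>2"
    and "X0 \<in> L2_Omega M L2_sphere L2_norm" and "borel_rv (F 0) L2_sphere L2_norm X0"
    and "0 < \<alpha>" and "\<alpha> \<noteq> 4" and "0 < C"
    and "\<And>l. 0 < l \<Longrightarrow> A l \<le> C * real l powr (- \<alpha>)"
    and "0 < \<eta>" and "X0 \<in> L2_Omega M (Hs_sphere \<eta>) (Hs_norm \<eta>)"
    and "0 < C\<^sub>c" and "sch = Forward \<Longrightarrow> C\<^sub>c \<le> 1"
  shows "\<exists>Chat::real. \<forall>(\<kappa>::nat) (n::nat) (h::real).
           1 \<le> \<kappa> \<and> 1 \<le> n \<and> h = T / real n \<and> real \<kappa> * (real \<kappa> + 1) * h \<le> C\<^sub>c \<longrightarrow>
           (\<forall>k\<le>n.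
              integrable M (\<lambda>\<omega>. (L2_norm (\<lambda>x. spectral_approx M a X0 \<kappa> (real k * h) \<omega> x
                                              - euler_approx sch a X0 \<kappa> h k \<omega> x))\<^sup>2) \<and>
              L2_Omega_norm M L2_norm
                (\<lambda>\<omega> x. spectral_approx M a X0 \<kappa> (real k * h) \<omega> x - euler_approx sch a X0 \<kappa> h k \<omega> x)
              \<le> Chat * (h powr min 1 (\<eta>/2) * L2_Omega_norm M (Hs_norm \<eta>) X0
                        + h powr min 1 (\<alpha>/4)))"
proof -
  note filtered = \<open>complete_filtered_prob_space M F T\<close>
  have M: "prob_space M" and complete: "complete_measure M"
    using filtered by (auto simp: complete_filtered_prob_space_def)
  have cov: "brownian_covariance M T (A l) (a l m)" if "\<bar>m\<bar> \<le> int l" for l m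
    unfolding a_def using assms that by (intro noise_coeff_covariance) auto
  obtain B where B: "0 \<le> B" "\<And>\<kappa> h. 1 \<le> \<kappa> \<Longrightarrow> 0 < h \<Longrightarrow> real \<kappa> * (real \<kappa> + 1) * h \<le> C\<^sub>c \<Longrightarrow>
     (\<Sum>l\<le>\<kappa>. real (2 * l + 1) * (A l * (lb_eigenvalue l * h\<^sup>2))) \<le> B * (h powr min 1 (\<alpha> / 4))\<^sup>2"
    using assms by (rule_tac spectrum_sum_bound[of A C \<alpha> C\<^sub>c]) auto
  have sq_int: "integrable M (\<lambda>\<omega>. (L2_norm (X0 \<omega>))\<^sup>2)" and X0_L2: "AE \<omega> in M. X0 \<omega> \<in> L2_sphere"
    using \<open>X0 \<in> L2_Omega M L2_sphere L2_norm\<close> by (auto simp: L2_Omega_def)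
  have Hs_int: "integrable M (\<lambda>\<omega>. (Hs_norm \<eta> (X0 \<omega>))\<^sup>2)" and X0_Hs: "AE \<omega> in M. X0 \<omega> \<in> Hs_sphere \<eta>"
    using \<open>X0 \<in> L2_Omega M (Hs_sphere \<eta>) (Hs_norm \<eta>)\<close> by (auto simp: L2_Omega_def)
  let ?H = "L2_Omega_norm M (Hs_norm \<eta>) X0"
  have H2: "?H\<^sup>2 = (\<integral>\<omega>. (Hs_norm \<eta> (X0 \<omega>))\<^sup>2 \<partial>M)" and H0: "0 \<le> ?H"
    by (simp_all add: L2_Omega_norm_def)
  define K where "K = 2 * (1 + C\<^sub>c)"
  define B' where "B' = 72 * (1 + C\<^sub>c) ^ 5 * B"
  have K: "0 \<le> K" and B': "0 \<le> B'" using \<open>0 < C\<^sub>c\<close> B(1) by (auto simp: K_def B'_def)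
  \<comment> \<open>The factors 2 in both constants come from separating the two parts of each mode error; 36 is
    the constant of one noise mode.\<close>
  let ?Chat = "max (sqrt 2 * K) (sqrt B')"
  show ?thesis
  proof (intro exI[of _ ?Chat] allI impI)
    fix \<kappa> n k :: nat and h :: real
    assume asm: "1 \<le> \<kappa> \<and> 1 \<le> n \<and> h = T / real n \<and> real \<kappa> * (real \<kappa> + 1) * h \<le> C\<^sub>c" and "k \<le> n"
    then have h: "0 < h" and CFL: "real \<kappa> * (real \<kappa> + 1) * h \<le> C\<^sub>c" and \<kappa>: "1 \<le> \<kappa>"
      using \<open>0 < T\<close> by auto
    let ?t = "real k * h"
    have t: "?t \<le> T" using asm \<open>k \<le> n\<close> \<open>0 < T\<close> by (auto simp: field_simps)
    have xC: "lb_eigenvalue l * h \<le> C\<^sub>c" if "l \<le> \<kappa>" for l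
    proof -
      have "lb_eigenvalue l * h \<le> real \<kappa> * (real \<kappa> + 1) * h"
        unfolding lb_eigenvalue_def using that h by (intro mult_right_mono mult_mono) auto
      then show ?thesis using CFL by simp
    qed
    have fwd: "lb_eigenvalue l * h \<le> 1" if "l \<le> \<kappa>" "sch = Forward" for l
      using xC[OF that(1)] assms that by force
    let ?p = "h powr min 1 (\<eta>/2)" and ?q = "h powr min 1 (\<alpha>/4)"
    define d where "d l = exp (- lb_eigenvalue l * ?t) - scheme_xi sch h l ^ k" for l
    define R where "R l m \<omega> = stoch_integral M ?t (\<lambda>s. exp (- lb_eigenvalue l * (?t - s))) (a l m) \<omega>
      - step_integral k (\<lambda>j. real j * h) (\<lambda>j. scheme_xi sch h l ^ (k - Suc j + scheme_delta sch)) (a l m) \<omega>"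
      for l m \<omega>
    define D where "D l m \<omega> = of_real (d l) * sph_coeff (X0 \<omega>) l m + R l m \<omega>" for l m \<omega>
    let ?err = "\<lambda>\<omega> x. spectral_approx M a X0 \<kappa> ?t \<omega> x - euler_approx sch a X0 \<kappa> h k \<omega> x"
    have err: "?err \<omega> x = (\<Sum>l\<le>\<kappa>. \<Sum>m\<in>{- int l..int l}. D l m \<omega> * sph_harm l m x)" for \<omega> x
      unfolding euler_approx_eq_sum[OF meta_eq_to_obj_eq[OF a_def]] spectral_approx_def sum_subtractf[symmetric]
      by (intro sum.cong refl) (simp add: D_def R_def d_def euler_mode_def algebra_simps)
    have err_norm: "(L2_norm (?err \<omega>))\<^sup>2 = (\<Sum>l\<le>\<kappa>. \<Sum>m\<in>{- int l..int l}. (norm (D l m \<omega>))\<^sup>2)" for \<omega>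
      unfolding err by (rule L2_norm_sph_harm_sum)
    have R: "R l m \<in> borel_measurable M" "integrable M (\<lambda>\<omega>. (norm (R l m \<omega>))\<^sup>2)"
        "(\<integral>\<omega>. (norm (R l m \<omega>))\<^sup>2 \<partial>M) \<le> 36 * (1 + C\<^sub>c) ^ 5 * (A l * (lb_eigenvalue l * h\<^sup>2))"
      if lm: "l \<le> \<kappa>" "\<bar>m\<bar> \<le> int l" for l m
    proof -
      note se = mode_noise_error_second_moment[OF M cov[OF lm(2)] \<open>\<And>l. 0 \<le> A l\<close> h t fwd[OF lm(1)]]
      show "R l m \<in> borel_measurable M" "integrable M (\<lambda>\<omega>. (norm (R l m \<omega>))\<^sup>2)"
        using se(1,2) unfolding R_def by auto
      have "(\<integral>\<omega>. (norm (R l m \<omega>))\<^sup>2 \<partial>M) \<le> 36 * (1 + lb_eigenvalue l * h) ^ 5 * (A l * (lb_eigenvalue l * h\<^sup>2))"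
        unfolding R_def by (rule se(3))
      also have "\<dots> \<le> 36 * (1 + C\<^sub>c) ^ 5 * (A l * (lb_eigenvalue l * h\<^sup>2))"
        using xC[OF lm(1)] h \<open>\<And>l. 0 \<le> A l\<close>
        by (intro mult_right_mono mult_left_mono power_mono add_left_mono) (auto simp: lb_eigenvalue_def)
      finally show "(\<integral>\<omega>. (norm (R l m \<omega>))\<^sup>2 \<partial>M) \<le> 36 * (1 + C\<^sub>c) ^ 5 * (A l * (lb_eigenvalue l * h\<^sup>2))" .
    qed
    have cf_meas: "(\<lambda>\<omega>. sph_coeff (X0 \<omega>) l m) \<in> borel_measurable M" if "\<bar>m\<bar> \<le> int l" for l m
      by (rule borel_measurable_sph_coeff[OF complete \<open>X0 \<in> L2_Omega M L2_sphere L2_norm\<close> that])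
    have cf_int: "integrable M (\<lambda>\<omega>. (norm (sph_coeff (X0 \<omega>) l m))\<^sup>2)" if "\<bar>m\<bar> \<le> int l" for l m
    proof (rule Bochner_Integration.integrable_bound[OF sq_int])
      show "AE \<omega> in M. norm ((norm (sph_coeff (X0 \<omega>) l m))\<^sup>2) \<le> norm ((L2_norm (X0 \<omega>))\<^sup>2)"
        using X0_L2 by eventually_elim (auto intro!: power_mono norm_sph_coeff_le that)
    qed (use cf_meas[OF that] in measurable)
    have D_le: "(norm (D l m \<omega>))\<^sup>2 \<le> 2 * (d l * norm (sph_coeff (X0 \<omega>) l m))\<^sup>2 + 2 * (norm (R l m \<omega>))\<^sup>2" for l m \<omega>
      using norm_add_power2_le[of "of_real (d l) * sph_coeff (X0 \<omega>) l m" "R l m \<omega>"]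
      by (simp add: D_def norm_mult power_mult_distrib)
    have D_int: "integrable M (\<lambda>\<omega>. (norm (D l m \<omega>))\<^sup>2)" if lm: "l \<le> \<kappa>" "\<bar>m\<bar> \<le> int l" for l m
    proof (rule Bochner_Integration.integrable_bound)
      show "integrable M (\<lambda>\<omega>. 2 * (d l * norm (sph_coeff (X0 \<omega>) l m))\<^sup>2 + 2 * (norm (R l m \<omega>))\<^sup>2)"
        unfolding power_mult_distrib using cf_int[OF lm(2)] R(2)[OF lm] by simp
      show "AE \<omega> in M. norm ((norm (D l m \<omega>))\<^sup>2)
          \<le> norm (2 * (d l * norm (sph_coeff (X0 \<omega>) l m))\<^sup>2 + 2 * (norm (R l m \<omega>))\<^sup>2)"
        using D_le by simp
      show "(\<lambda>\<omega>. (norm (D l m \<omega>))\<^sup>2) \<in> borel_measurable M"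
        unfolding D_def using cf_meas[OF lm(2)] R(1)[OF lm] by measurable
    qed
    let ?E = "\<lambda>\<omega>. \<Sum>l\<le>\<kappa>. \<Sum>m\<in>{- int l..int l}. (norm (D l m \<omega>))\<^sup>2"
    have err_int: "integrable M ?E"
      by (intro Bochner_Integration.integrable_sum D_int) auto
    have R_sum_int: "integrable M (\<lambda>\<omega>. \<Sum>l\<le>\<kappa>. \<Sum>m\<in>{- int l..int l}. (norm (R l m \<omega>))\<^sup>2)"
      by (intro Bochner_Integration.integrable_sum R(2)) auto
    have E_le: "AE \<omega> in M. ?E \<omega> \<le> 2 * (K * ?p)\<^sup>2 * (Hs_norm \<eta> (X0 \<omega>))\<^sup>2
        + 2 * (\<Sum>l\<le>\<kappa>. \<Sum>m\<in>{- int l..int l}. (norm (R l m \<omega>))\<^sup>2)"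
      using X0_Hs
    proof eventually_elim
      case (elim \<omega>)
      have "(d l * norm (sph_coeff (X0 \<omega>) l m))\<^sup>2
          \<le> (K * ?p)\<^sup>2 * ((1 + lb_eigenvalue l) powr (\<eta> / 2) * norm (sph_coeff (X0 \<omega>) l m))\<^sup>2"
        if "l \<le> \<kappa>" for l m
      proof -
        have "\<bar>d l\<bar> \<le> K * ?p * (1 + lb_eigenvalue l) powr (\<eta> / 2)"
          unfolding d_def K_def by (rule mode_initial_error_bound[OF h xC[OF that] fwd[OF that] \<open>0 < \<eta>\<close>])
        then have dsq: "(d l)\<^sup>2 \<le> (K * ?p * (1 + lb_eigenvalue l) powr (\<eta> / 2))\<^sup>2"
          using K by (subst power2_le_iff_abs_le) auto
        show ?thesis
          using mult_right_mono[OF dsq, of "(norm (sph_coeff (X0 \<omega>) l m))\<^sup>2"]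
          by (simp add: power_mult_distrib mult_ac)
      qed
      then have "(\<Sum>l\<le>\<kappa>. \<Sum>m\<in>{- int l..int l}. (d l * norm (sph_coeff (X0 \<omega>) l m))\<^sup>2)
          \<le> (\<Sum>l\<le>\<kappa>. \<Sum>m\<in>{- int l..int l}. (K * ?p)\<^sup>2 *
               ((1 + lb_eigenvalue l) powr (\<eta> / 2) * norm (sph_coeff (X0 \<omega>) l m))\<^sup>2)"
        by (intro sum_mono) auto
      also have "\<dots> \<le> (K * ?p)\<^sup>2 * (Hs_norm \<eta> (X0 \<omega>))\<^sup>2"
        unfolding sum_distrib_left[symmetric] by (intro mult_left_mono Hs_norm_bound elim) auto
      finally have det: "(\<Sum>l\<le>\<kappa>. \<Sum>m\<in>{- int l..int l}. (d l * norm (sph_coeff (X0 \<omega>) l m))\<^sup>2)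
          \<le> (K * ?p)\<^sup>2 * (Hs_norm \<eta> (X0 \<omega>))\<^sup>2" .
      have "?E \<omega> \<le> (\<Sum>l\<le>\<kappa>. \<Sum>m\<in>{- int l..int l}.
            2 * (d l * norm (sph_coeff (X0 \<omega>) l m))\<^sup>2 + 2 * (norm (R l m \<omega>))\<^sup>2)"
        by (intro sum_mono D_le)
      also have "\<dots> = 2 * (\<Sum>l\<le>\<kappa>. \<Sum>m\<in>{- int l..int l}. (d l * norm (sph_coeff (X0 \<omega>) l m))\<^sup>2)
          + 2 * (\<Sum>l\<le>\<kappa>. \<Sum>m\<in>{- int l..int l}. (norm (R l m \<omega>))\<^sup>2)"
        by (simp only: sum.distrib sum_distrib_left)
      finally show ?case using det by linarith
    qed
    have "(\<integral>\<omega>. ?E \<omega> \<partial>M) \<le> (\<integral>\<omega>. 2 * (K * ?p)\<^sup>2 * (Hs_norm \<eta> (X0 \<omega>))\<^sup>2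
        + 2 * (\<Sum>l\<le>\<kappa>. \<Sum>m\<in>{- int l..int l}. (norm (R l m \<omega>))\<^sup>2) \<partial>M)"
      using err_int R_sum_int Hs_int
      by (intro integral_mono_AE Bochner_Integration.integrable_add integrable_mult_right E_le)
    also have "\<dots> = 2 * (K * ?p)\<^sup>2 * ?H\<^sup>2 + 2 * (\<integral>\<omega>. (\<Sum>l\<le>\<kappa>. \<Sum>m\<in>{- int l..int l}. (norm (R l m \<omega>))\<^sup>2) \<partial>M)"
      unfolding H2 using R_sum_int Hs_int
      by (subst Bochner_Integration.integral_add) auto
    also have "(\<integral>\<omega>. (\<Sum>l\<le>\<kappa>. \<Sum>m\<in>{- int l..int l}. (norm (R l m \<omega>))\<^sup>2) \<partial>M)
        = (\<Sum>l\<le>\<kappa>. \<integral>\<omega>. (\<Sum>m\<in>{- int l..int l}. (norm (R l m \<omega>))\<^sup>2) \<partial>M)"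
      by (intro Bochner_Integration.integral_sum Bochner_Integration.integrable_sum R(2)) auto
    also have "\<dots> = (\<Sum>l\<le>\<kappa>. \<Sum>m\<in>{- int l..int l}. \<integral>\<omega>. (norm (R l m \<omega>))\<^sup>2 \<partial>M)"
      by (intro sum.cong refl Bochner_Integration.integral_sum R(2)) auto
    finally have E1: "(\<integral>\<omega>. ?E \<omega> \<partial>M) \<le> 2 * (K * ?p)\<^sup>2 * ?H\<^sup>2
        + 2 * (\<Sum>l\<le>\<kappa>. \<Sum>m\<in>{- int l..int l}. \<integral>\<omega>. (norm (R l m \<omega>))\<^sup>2 \<partial>M)" .
    have "(\<Sum>l\<le>\<kappa>. \<Sum>m\<in>{- int l..int l}. \<integral>\<omega>. (norm (R l m \<omega>))\<^sup>2 \<partial>M)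
        \<le> (\<Sum>l\<le>\<kappa>. \<Sum>m\<in>{- int l..int l}. 36 * (1 + C\<^sub>c) ^ 5 * (A l * (lb_eigenvalue l * h\<^sup>2)))"
      by (intro sum_mono R(3)) auto
    also have "\<dots> = 36 * (1 + C\<^sub>c) ^ 5 * (\<Sum>l\<le>\<kappa>. real (2 * l + 1) * (A l * (lb_eigenvalue l * h\<^sup>2)))"
      unfolding sum_distrib_left by (intro sum.cong refl) (simp add: nat_add_distrib algebra_simps)
    also have "\<dots> \<le> 36 * (1 + C\<^sub>c) ^ 5 * (B * ?q\<^sup>2)"
      using \<open>0 < C\<^sub>c\<close> by (intro mult_left_mono B(2)[OF \<kappa> h CFL]) auto
    finally have "(\<integral>\<omega>. ?E \<omega> \<partial>M) \<le> 2 * (K * ?p)\<^sup>2 * ?H\<^sup>2 + B' * ?q\<^sup>2"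
      using E1 by (simp add: B'_def)
    then have "L2_Omega_norm M L2_norm ?err \<le> sqrt (2 * (K * ?p)\<^sup>2 * ?H\<^sup>2 + B' * ?q\<^sup>2)"
      unfolding L2_Omega_norm_def err_norm by (rule real_sqrt_le_mono)
    also have "\<dots> \<le> sqrt (2 * (K * ?p)\<^sup>2 * ?H\<^sup>2) + sqrt (B' * ?q\<^sup>2)"
      using B' by (intro sqrt_add_le_add_sqrt) auto
    also have "\<dots> = sqrt 2 * K * (?p * ?H) + sqrt B' * ?q"
      using K H0 by (simp add: real_sqrt_mult)
    also have "\<dots> \<le> ?Chat * (?p * ?H) + ?Chat * ?q"
      using H0 by (intro add_mono mult_right_mono) auto
    also have "\<dots> = ?Chat * (?p * ?H + ?q)" by (simp only: distrib_left)
    finally show "integrable M (\<lambda>\<omega>. (L2_norm (?err \<omega>))\<^sup>2) \<and>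
        L2_Omega_norm M L2_norm ?err \<le> ?Chat * (?p * ?H + ?q)"
      using err_int unfolding err_norm by blast
  qed
qed

end
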